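(* Let $\mathbb{F}$ be a finite field and $c\ge1$. The theory $T_{c,\mathbb{F}}$ is $c$-dependent and has the $(c-1)$-independence property (some formula has $\mathrm{IP}_{c-1}$).
   Context: An LLA over $\mathbb{F}$ of class $\le c$ is a Lie algebra $L$ over $\mathbb{F}$ with subalgebras $L=P_1\supseteq\dots\supseteq P_{c+1}=0$, $[P_i,P_j]\subseteq P_{i+j}$ (with $P_k=0$ for $k>c$), in the language $\{+,-,0,(\lambda\cdot)_{\lambda\in\mathbb{F}},[\cdot,\cdot],P_1,\dots,P_{c+1}\}$. $T_{c,\mathbb{F}}$ is the theory of the Fraïssé limit of the class of finitely generated such LLAs. A formula $\varphi(x;y_0,\dots,y_{k-1})$ has $\mathrm{IP}_k$ if there are $(a_{0,i},\dots,a_{k-1,i})_{i<\omega}$ and $(b_X)_{X\subseteq\omega^k}$ such that for all $X\subseteq\omega^k$, $\models\varphi(b_X;a_{0,i_0},\dots,a_{k-1,i_{k-1}})$ iff $(i_0,\dots,i_{k-1})\in X$. A theory is $k$-dependent if no formula has $\mathrm{IP}_k$. *)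

theory Defs
  imports "HOL-Algebra.Module" "HOL-Library.Countable_Set"
begin

section \<open>First-order logic\<close>

text \<open>The arity functions return \<open>None\<close> on symbols that do not belong to the language.\<close>

record ('f, 'r) language =
  fun_arity :: "'f \<Rightarrow> nat option"
  rel_arity :: "'r \<Rightarrow> nat option"

text \<open>Interpretations are total HOL functions, but only their values at tuples of the right length
  with entries in the universe are meaningful; all notions below depend only on those.\<close>

record ('f, 'r, 'a) interp =
  univ :: "'a set"
  fn :: "'f \<Rightarrow> 'a list \<Rightarrow> 'a"
  rel :: "'r \<Rightarrow> 'a list \<Rightarrow> bool"

definition is_structure :: "('f, 'r) language \<Rightarrow> ('f, 'r, 'a) interp \<Rightarrow> bool" where
  "is_structure \<L> M \<longleftrightarrow> univ M \<noteq> {} \<and>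
     (\<forall>f n xs. fun_arity \<L> f = Some n \<and> length xs = n \<and> set xs \<subseteq> univ M \<longrightarrow> fn M f xs \<in> univ M)"

datatype 'f tm = Var nat | App 'f "'f tm list"

datatype ('f, 'r) fm =
    Eq "'f tm" "'f tm"
  | Rel 'r "'f tm list"
  | Neg "('f, 'r) fm"
  | Conj "('f, 'r) fm" "('f, 'r) fm"
  | Ex nat "('f, 'r) fm"

fun wf_tm :: "('f, 'r) language \<Rightarrow> 'f tm \<Rightarrow> bool" where
  "wf_tm \<L> (Var n) = True"
| "wf_tm \<L> (App f ts) = (fun_arity \<L> f = Some (length ts) \<and> (\<forall>t\<in>set ts. wf_tm \<L> t))"

fun wf_fm :: "('f, 'r) language \<Rightarrow> ('f, 'r) fm \<Rightarrow> bool" where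
  "wf_fm \<L> (Eq s t) = (wf_tm \<L> s \<and> wf_tm \<L> t)"
| "wf_fm \<L> (Rel r ts) = (rel_arity \<L> r = Some (length ts) \<and> (\<forall>t\<in>set ts. wf_tm \<L> t))"
| "wf_fm \<L> (Neg \<phi>) = wf_fm \<L> \<phi>"
| "wf_fm \<L> (Conj \<phi> \<psi>) = (wf_fm \<L> \<phi> \<and> wf_fm \<L> \<psi>)"
| "wf_fm \<L> (Ex n \<phi>) = wf_fm \<L> \<phi>"

fun fv_tm :: "'f tm \<Rightarrow> nat set" where
  "fv_tm (Var n) = {n}"
| "fv_tm (App f ts) = (\<Union>t\<in>set ts. fv_tm t)"

fun fv :: "('f, 'r) fm \<Rightarrow> nat set" where
  "fv (Eq s t) = fv_tm s \<union> fv_tm t"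
| "fv (Rel r ts) = (\<Union>t\<in>set ts. fv_tm t)"
| "fv (Neg \<phi>) = fv \<phi>"
| "fv (Conj \<phi> \<psi>) = fv \<phi> \<union> fv \<psi>"
| "fv (Ex n \<phi>) = fv \<phi> - {n}"

fun eval :: "('f, 'r, 'a) interp \<Rightarrow> (nat \<Rightarrow> 'a) \<Rightarrow> 'f tm \<Rightarrow> 'a" where
  "eval M v (Var n) = v n"
| "eval M v (App f ts) = fn M f (map (eval M v) ts)"

fun sat :: "('f, 'r, 'a) interp \<Rightarrow> (nat \<Rightarrow> 'a) \<Rightarrow> ('f, 'r) fm \<Rightarrow> bool" where
  "sat M v (Eq s t) \<longleftrightarrow> eval M v s = eval M v t"
| "sat M v (Rel r ts) \<longleftrightarrow> rel M r (map (eval M v) ts)"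
| "sat M v (Neg \<phi>) \<longleftrightarrow> \<not> sat M v \<phi>"
| "sat M v (Conj \<phi> \<psi>) \<longleftrightarrow> sat M v \<phi> \<and> sat M v \<psi>"
| "sat M v (Ex n \<phi>) \<longleftrightarrow> (\<exists>a\<in>univ M. sat M (v(n := a)) \<phi>)"

definition sentences :: "('f, 'r) language \<Rightarrow> ('f, 'r) fm set" where
  "sentences \<L> = {\<phi>. wf_fm \<L> \<phi> \<and> fv \<phi> = {}}"

definition theory_of :: "('f, 'r) language \<Rightarrow> ('f, 'r, 'a) interp \<Rightarrow> ('f, 'r) fm set" where
  "theory_of \<L> M = {\<phi> \<in> sentences \<L>. \<forall>v. range v \<subseteq> univ M \<longrightarrow> sat M v \<phi>}"

definition is_model :: "('f, 'r) language \<Rightarrow> ('f, 'r) fm set \<Rightarrow> ('f, 'r, 'a) interp \<Rightarrow> bool" where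
  "is_model \<L> T M \<longleftrightarrow>
     is_structure \<L> M \<and> (\<forall>\<phi>\<in>T. \<forall>v. range v \<subseteq> univ M \<longrightarrow> sat M v \<phi>)"


section \<open>Fraisse limits\<close>

definition embedding ::
    "('f, 'r) language \<Rightarrow> ('f, 'r, 'a) interp \<Rightarrow> ('f, 'r, 'b) interp \<Rightarrow> ('a \<Rightarrow> 'b) \<Rightarrow> bool" where
  "embedding \<L> A B h \<longleftrightarrow>
     h ` univ A \<subseteq> univ B \<and> inj_on h (univ A) \<and>
     (\<forall>f n xs. fun_arity \<L> f = Some n \<and> length xs = n \<and> set xs \<subseteq> univ A \<longrightarrow>
        h (fn A f xs) = fn B f (map h xs)) \<and>
     (\<forall>r n xs. rel_arity \<L> r = Some n \<and> length xs = n \<and> set xs \<subseteq> univ A \<longrightarrow>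
        (rel A r xs \<longleftrightarrow> rel B r (map h xs)))"

definition isomorphism ::
    "('f, 'r) language \<Rightarrow> ('f, 'r, 'a) interp \<Rightarrow> ('f, 'r, 'b) interp \<Rightarrow> ('a \<Rightarrow> 'b) \<Rightarrow> bool" where
  "isomorphism \<L> A B h \<longleftrightarrow> embedding \<L> A B h \<and> h ` univ A = univ B"

definition restrict_to :: "('f, 'r, 'a) interp \<Rightarrow> 'a set \<Rightarrow> ('f, 'r, 'a) interp" where
  "restrict_to M B = M\<lparr>univ := B\<rparr>"

definition is_substructure :: "('f, 'r) language \<Rightarrow> ('f, 'r, 'a) interp \<Rightarrow> 'a set \<Rightarrow> bool" where
  "is_substructure \<L> M B \<longleftrightarrow> B \<subseteq> univ M \<and> is_structure \<L> (restrict_to M B)"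

definition finitely_generated :: "('f, 'r) language \<Rightarrow> ('f, 'r, 'a) interp \<Rightarrow> bool" where
  "finitely_generated \<L> M \<longleftrightarrow>
     (\<exists>X. finite X \<and> X \<subseteq> univ M \<and> (\<forall>B. is_substructure \<L> M B \<and> X \<subseteq> B \<longrightarrow> B = univ M))"

text \<open>In a countable language finitely generated structures are countable, so up to isomorphism they
  all occur with a universe contained in \<^typ>\<open>nat\<close>.  Ages and the classes they are compared with are
  therefore represented by isomorphism-closed sets of structures over \<^typ>\<open>nat\<close>.\<close>

definition age :: "('f, 'r) language \<Rightarrow> ('f, 'r, 'a) interp \<Rightarrow> ('f, 'r, nat) interp set" where
  "age \<L> M = {A. is_structure \<L> A \<and> finitely_generated \<L> A \<and> (\<exists>h. embedding \<L> A M h)}"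

definition ultrahomogeneous :: "('f, 'r) language \<Rightarrow> ('f, 'r, 'a) interp \<Rightarrow> bool" where
  "ultrahomogeneous \<L> M \<longleftrightarrow>
     (\<forall>A B h. is_substructure \<L> M A \<and> finitely_generated \<L> (restrict_to M A) \<and>
        is_substructure \<L> M B \<and> finitely_generated \<L> (restrict_to M B) \<and>
        isomorphism \<L> (restrict_to M A) (restrict_to M B) h \<longrightarrow>
        (\<exists>g. isomorphism \<L> M M g \<and> (\<forall>x\<in>A. g x = h x)))"

definition fraisse_limit ::
    "('f, 'r) language \<Rightarrow> ('f, 'r, nat) interp set \<Rightarrow> ('f, 'r, 'a) interp \<Rightarrow> bool" where
  "fraisse_limit \<L> K M \<longleftrightarrow>
     is_structure \<L> M \<and> countable (univ M) \<and> age \<L> M = K \<and> ultrahomogeneous \<L> M"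


section \<open>The k-independence property\<close>

text \<open>The formula is presented as \<open>\<phi>(x; y\<^sub>0, \<dots>, y\<^sub>k\<^sub>-\<^sub>1)\<close>, where \<open>x\<close> and the members of
  \<open>ys = [y\<^sub>0, \<dots>, y\<^sub>k\<^sub>-\<^sub>1]\<close> are finite tuples of variables, all of them distinct.\<close>

definition partitioned_formula ::
    "('f, 'r) language \<Rightarrow> ('f, 'r) fm \<Rightarrow> nat list \<Rightarrow> nat list list \<Rightarrow> bool" where
  "partitioned_formula \<L> \<phi> x ys \<longleftrightarrow>
     wf_fm \<L> \<phi> \<and> distinct (x @ concat ys) \<and> fv \<phi> \<subseteq> set (x @ concat ys)"

text \<open>The valuation sending the listed variables to the listed values; its values at other
  variables are irrelevant.\<close>

definition assign :: "nat list \<Rightarrow> 'a list \<Rightarrow> nat \<Rightarrow> 'a" where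
  "assign vars vals = (\<lambda>n. the (map_of (zip vars vals) n))"

text \<open>\<open>\<omega>\<^sup>k\<close> is the set of lists of natural numbers of length \<open>k\<close>.\<close>

definition has_IP_in ::
    "('f, 'r, 'a) interp \<Rightarrow> ('f, 'r) fm \<Rightarrow> nat list \<Rightarrow> nat list list \<Rightarrow> bool" where
  "has_IP_in M \<phi> x ys \<longleftrightarrow>
     (let k = length ys; \<omega>k = {is :: nat list. length is = k} in
      \<exists>(a :: nat \<Rightarrow> nat \<Rightarrow> 'a list) (b :: nat list set \<Rightarrow> 'a list).
        (\<forall>j<k. \<forall>i. length (a j i) = length (ys ! j) \<and> set (a j i) \<subseteq> univ M) \<and>
        (\<forall>X\<subseteq>\<omega>k. length (b X) = length x \<and> set (b X) \<subseteq> univ M) \<and>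
        (\<forall>X\<subseteq>\<omega>k. \<forall>is\<in>\<omega>k.
           sat M (assign (x @ concat ys) (b X @ concat (map (\<lambda>j. a j (is ! j)) [0..<k]))) \<phi>
             \<longleftrightarrow> is \<in> X))"

text \<open>The type argument bounds the universes of the models in which witnesses are sought.\<close>

definition has_IP ::
    "('f, 'r) language \<Rightarrow> ('f, 'r) fm set \<Rightarrow> nat \<Rightarrow> 'a itself \<Rightarrow> bool" where
  "has_IP \<L> T k (_ :: 'a itself) \<longleftrightarrow>
     (\<exists>\<phi> x ys. partitioned_formula \<L> \<phi> x ys \<and> length ys = k \<and>
        (\<exists>M :: ('f, 'r, 'a) interp. is_model \<L> T M \<and> has_IP_in M \<phi> x ys))"

definition k_dependent ::
    "('f, 'r) language \<Rightarrow> ('f, 'r) fm set \<Rightarrow> nat \<Rightarrow> 'a itself \<Rightarrow> bool" where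
  "k_dependent \<L> T k U \<longleftrightarrow> \<not> has_IP \<L> T k U"


section \<open>Lazard Lie algebras\<close>

text \<open>The multiplication of the underlying module record, which the \<open>module\<close> locale leaves
  unconstrained, plays the role of the Lie bracket.\<close>

locale lie_algebra = module F L for F (structure) and L (structure) +
  assumes field: "field F"
    and bracket_closed: "\<lbrakk>x \<in> carrier L; y \<in> carrier L\<rbrakk> \<Longrightarrow> x \<otimes>\<^bsub>L\<^esub> y \<in> carrier L"
    and bracket_add_left: "\<lbrakk>x \<in> carrier L; y \<in> carrier L; z \<in> carrier L\<rbrakk> \<Longrightarrow>
      (x \<oplus>\<^bsub>L\<^esub> y) \<otimes>\<^bsub>L\<^esub> z = (x \<otimes>\<^bsub>L\<^esub> z) \<oplus>\<^bsub>L\<^esub> (y \<otimes>\<^bsub>L\<^esub> z)"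
    and bracket_add_right: "\<lbrakk>x \<in> carrier L; y \<in> carrier L; z \<in> carrier L\<rbrakk> \<Longrightarrow>
      x \<otimes>\<^bsub>L\<^esub> (y \<oplus>\<^bsub>L\<^esub> z) = (x \<otimes>\<^bsub>L\<^esub> y) \<oplus>\<^bsub>L\<^esub> (x \<otimes>\<^bsub>L\<^esub> z)"
    and bracket_smult_left: "\<lbrakk>a \<in> carrier F; x \<in> carrier L; y \<in> carrier L\<rbrakk> \<Longrightarrow>
      (a \<odot>\<^bsub>L\<^esub> x) \<otimes>\<^bsub>L\<^esub> y = a \<odot>\<^bsub>L\<^esub> (x \<otimes>\<^bsub>L\<^esub> y)"
    and bracket_smult_right: "\<lbrakk>a \<in> carrier F; x \<in> carrier L; y \<in> carrier L\<rbrakk> \<Longrightarrow>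
      x \<otimes>\<^bsub>L\<^esub> (a \<odot>\<^bsub>L\<^esub> y) = a \<odot>\<^bsub>L\<^esub> (x \<otimes>\<^bsub>L\<^esub> y)"
    and bracket_self: "x \<in> carrier L \<Longrightarrow> x \<otimes>\<^bsub>L\<^esub> x = \<zero>\<^bsub>L\<^esub>"
    and jacobi: "\<lbrakk>x \<in> carrier L; y \<in> carrier L; z \<in> carrier L\<rbrakk> \<Longrightarrow>
      (x \<otimes>\<^bsub>L\<^esub> (y \<otimes>\<^bsub>L\<^esub> z)) \<oplus>\<^bsub>L\<^esub> (y \<otimes>\<^bsub>L\<^esub> (z \<otimes>\<^bsub>L\<^esub> x)) \<oplus>\<^bsub>L\<^esub> (z \<otimes>\<^bsub>L\<^esub> (x \<otimes>\<^bsub>L\<^esub> y)) = \<zero>\<^bsub>L\<^esub>"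

definition lie_subalgebra ::
    "('k, 'm) ring_scheme \<Rightarrow> ('k, 'a, 'n) module_scheme \<Rightarrow> 'a set \<Rightarrow> bool" where
  "lie_subalgebra F L H \<longleftrightarrow> submodule H F L \<and> (\<forall>x\<in>H. \<forall>y\<in>H. x \<otimes>\<^bsub>L\<^esub> y \<in> H)"

datatype 'k lla_fun = Plus | Minus | Zero | Scale 'k | Bracket

datatype lla_rel = P nat

text \<open>\<^term>\<open>Minus\<close> is unary negation.\<close>

definition lla_lang :: "('k, 'm) ring_scheme \<Rightarrow> nat \<Rightarrow> ('k lla_fun, lla_rel) language" where
  "lla_lang F c = \<lparr>
     fun_arity = (\<lambda>f. case f of
         Plus \<Rightarrow> Some 2
       | Minus \<Rightarrow> Some 1
       | Zero \<Rightarrow> Some 0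
       | Scale a \<Rightarrow> (if a \<in> carrier F then Some 1 else None)
       | Bracket \<Rightarrow> Some 2),
     rel_arity = (\<lambda>r. case r of P i \<Rightarrow> (if 1 \<le> i \<and> i \<le> c + 1 then Some 1 else None))\<rparr>"

definition alg_of :: "('k lla_fun, lla_rel, 'a) interp \<Rightarrow> ('k, 'a) module" where
  "alg_of S = \<lparr>carrier = univ S,
     mult = (\<lambda>x y. fn S Bracket [x, y]),
     one = undefined,
     zero = fn S Zero [],
     add = (\<lambda>x y. fn S Plus [x, y]),
     smult = (\<lambda>a x. fn S (Scale a) [x])\<rparr>"

definition layer :: "nat \<Rightarrow> ('k lla_fun, lla_rel, 'a) interp \<Rightarrow> nat \<Rightarrow> 'a set" where
  "layer c S i = (if i \<le> c + 1 then {x \<in> univ S. rel S (P i) [x]} else {fn S Zero []})"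

definition is_lla ::
    "('k, 'm) ring_scheme \<Rightarrow> nat \<Rightarrow> ('k lla_fun, lla_rel, 'a) interp \<Rightarrow> bool" where
  "is_lla F c S \<longleftrightarrow>
     is_structure (lla_lang F c) S \<and>
     lie_algebra F (alg_of S) \<and>
     (\<forall>x\<in>univ S. fn S Minus [x] = \<ominus>\<^bsub>alg_of S\<^esub> x) \<and>
     (\<forall>i\<in>{1..c + 1}. lie_subalgebra F (alg_of S) (layer c S i)) \<and>
     layer c S 1 = univ S \<and>
     layer c S (c + 1) = {\<zero>\<^bsub>alg_of S\<^esub>} \<and>
     (\<forall>i\<in>{1..c}. layer c S (i + 1) \<subseteq> layer c S i) \<and>
     (\<forall>i\<in>{1..c + 1}. \<forall>j\<in>{1..c + 1}. \<forall>x\<in>layer c S i. \<forall>y\<in>layer c S j.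
        x \<otimes>\<^bsub>alg_of S\<^esub> y \<in> layer c S (i + j))"

definition fg_llas ::
    "('k, 'm) ring_scheme \<Rightarrow> nat \<Rightarrow> ('k lla_fun, lla_rel, nat) interp set" where
  "fg_llas F c = {A. is_lla F c A \<and> finitely_generated (lla_lang F c) A}"

end

theory Submission
  imports Defs "HOL-Library.FuncSet"
begin

text \<open>
  Dependence. If some formula had \<open>IP\<^sub>c\<close> in a model of the theory, it would shatter \<open>n \<times> \<dots> \<times> n\<close> grids of
  dimension \<open>c\<close> in the limit for every \<open>n\<close>. By ultrahomogeneity the truth of a formula depends only
  on which terms lie in which \<open>P\<^sub>p\<close>, and since \<open>F\<close> is finite and brackets of more than \<open>c\<close> elements
  vanish, finitely many linear combinations of Lie monomials suffice as terms. A nonzero monomial that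
  involves \<open>x\<close> has room for at most \<open>c - 1\<close> other leaves, hence misses one of \<open>y\<^sub>0, \<dots>, y\<^sub>c\<^sub>-\<^sub>1\<close>. So the value
  of a term on the grid is a fixed function plus a sum of functions each independent of one
  coordinate. The set where such a function lies in a subgroup is determined by a subset whose linear
  conditions are independent; as only about \<open>c n\<^sup>c\<^sup>-\<^sup>1\<close> unknowns are involved, there are only \<open>2\<^sup>o\<^sup>(\<^sup>N\<^sup>)\<close> such sets,
  where \<open>N = n\<^sup>c\<close>, and not all \<open>2\<^sup>N\<close> subsets of the grid are cut out.

  Independence. The formula \<open>[y\<^sub>c\<^sub>-\<^sub>2, \<dots>, [y\<^sub>1, [y\<^sub>0, x]] \<dots>] = 0\<close> shatters grids of dimension \<open>c - 1\<close> in
  finite Lazard Lie algebras built for this purpose, which embed into the limit. A countable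
  ultrapower of the limit then realises the infinite pattern on a universe of size continuum.
\<close>

section \<open>Renaming and transfer of formulas\<close>

text \<open>The values of a term range over the whole algebra, so the functions on the grid cannot
  be counted directly. Independent conditions are few for an additive reason: if every point of
  \<open>S\<close> has a separating function, then any two different subsets of \<open>S\<close> are
  told apart by the sums of one such function, while these sums depend only on how many points lie
  on each line parallel to an axis. There are \<open>c n^(c-1)\<close> lines and
  \<open>N = n^c\<close> points, hence at most \<open>(N+1)^(c n^(c-1))\<close> possible counts, and
  \<open>S\<close> has at most about \<open>c n^(c-1) log N\<close> points. For
  \<open>c >= 2\<close> the countable limit has too few tuples to name all subsets of an infinite
  grid, which forces the passage to an elementary extension. The auxiliary algebras come from
  square-free polynomials: the parameters act as transposes of multiplication by commuting
  variables. Commutation gives the Jacobi identity, and a functional on monomials can single out an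
  arbitrary set of grid points.\<close>

lemma eval_cong: "(\<And>z. z \<in> fv_tm t \<Longrightarrow> v z = w z) \<Longrightarrow> eval M v t = eval M w t"
proof (induction t)
  case (App f ts)
  have "map (eval M v) ts = map (eval M w) ts"
    using App by (intro map_cong refl) auto
  then show ?case by (simp only: eval.simps)
qed auto

lemma sat_cong: "(\<And>z. z \<in> fv \<phi> \<Longrightarrow> v z = w z) \<Longrightarrow> sat M v \<phi> = sat M w \<phi>"
proof (induction \<phi> arbitrary: v w)
  case (Eq s t)
  then show ?case using eval_cong[of s v w M] eval_cong[of t v w M] by auto
next
  case (Rel r ts)
  have "map (eval M v) ts = map (eval M w) ts"
    using Rel by (intro map_cong refl eval_cong) auto
  then show ?case by (simp only: sat.simps)
next
  case (Conj \<phi> \<psi>)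
  then show ?case by (metis UnCI fv.simps(4) sat.simps(4))
next
  case (Ex n \<phi>)
  have "sat M (v(n := a)) \<phi> = sat M (w(n := a)) \<phi>" for a
    by (rule Ex.IH) (use Ex.prems in auto)
  then show ?case by simp
next
  case (Neg \<phi>)
  have "sat M v \<phi> = sat M w \<phi>"
    by (rule Neg.IH) (use Neg.prems in auto)
  then show ?case by simp
qed

lemma finite_fv_tm [simp]: "finite (fv_tm t)"
  by (induction t) auto

lemma finite_fv [simp]: "finite (fv \<phi>)"
  by (induction \<phi>) auto

fun rename_tm :: "(nat \<Rightarrow> nat) \<Rightarrow> 'f tm \<Rightarrow> 'f tm" where
  "rename_tm r (Var n) = Var (r n)"
| "rename_tm r (App f ts) = App f (map (rename_tm r) ts)"

text \<open>Copies of one formula in different variables are later joined in a single formula, so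
  renaming must not capture: a bound variable is replaced by a number above all images of the free
  variables of the body. Inserting \<open>0\<close> keeps \<open>Max\<close> defined when there are
  none.\<close>

fun rename :: "(nat \<Rightarrow> nat) \<Rightarrow> ('f, 'r) fm \<Rightarrow> ('f, 'r) fm" where
  "rename r (Eq s t) = Eq (rename_tm r s) (rename_tm r t)"
| "rename r (Rel q ts) = Rel q (map (rename_tm r) ts)"
| "rename r (Neg \<phi>) = Neg (rename r \<phi>)"
| "rename r (Conj \<phi> \<psi>) = Conj (rename r \<phi>) (rename r \<psi>)"
| "rename r (Ex n \<phi>) = (let m = Suc (Max (insert 0 (r ` fv \<phi>))) in Ex m (rename (r(n := m)) \<phi>))"

lemma eval_rename [simp]: "eval M v (rename_tm r t) = eval M (\<lambda>z. v (r z)) t"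
  by (induction t) (auto intro!: arg_cong[where f = "fn M _"])

lemma wf_rename_tm [simp]: "wf_tm L (rename_tm r t) = wf_tm L t"
  by (induction t) auto

lemma wf_rename [simp]: "wf_fm L (rename r \<phi>) = wf_fm L \<phi>"
  by (induction \<phi> arbitrary: r) (auto simp: Let_def)

lemma sat_rename: "sat M v (rename r \<phi>) = sat M (\<lambda>z. v (r z)) \<phi>"
proof (induction \<phi> arbitrary: v r)
  case (Rel q ts)
  then show ?case by (simp add: comp_def)
next
  case (Ex n \<phi>)
  define m where "m = Suc (Max (insert 0 (r ` fv \<phi>)))"
  have fresh: "r z \<noteq> m" if "z \<in> fv \<phi>" for z
    using that Max_ge[of "insert 0 (r ` fv \<phi>)" "r z"]
    unfolding m_def by (metis finite_fv finite_imageI finite_insert imageI insertCI not_less_eq_eq order_refl)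
  have "sat M (\<lambda>z. (v(m := a)) ((r(n := m)) z)) \<phi> = sat M ((\<lambda>z. v (r z))(n := a)) \<phi>" for a
    by (rule sat_cong) (use fresh in auto)
  then show ?case by (simp add: Let_def Ex.IH flip: m_def)
qed auto

section \<open>Existential closures and satisfiability across models of a complete theory\<close>

fun exs :: "nat list \<Rightarrow> ('f, 'r) fm \<Rightarrow> ('f, 'r) fm" where
  "exs [] \<phi> = \<phi>"
| "exs (n # ns) \<phi> = Ex n (exs ns \<phi>)"

lemma wf_exs [simp]: "wf_fm L (exs ns \<phi>) = wf_fm L \<phi>"
  by (induction ns) auto

lemma fv_exs [simp]: "fv (exs ns \<phi>) = fv \<phi> - set ns"
  by (induction ns) auto

lemma sat_exs:
  "sat M v (exs ns \<phi>) \<longleftrightarrow>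
     (\<exists>w. (\<forall>z\<in>set ns. w z \<in> univ M) \<and> (\<forall>z. z \<notin> set ns \<longrightarrow> w z = v z) \<and> sat M w \<phi>)"
proof (induction ns arbitrary: v)
  case Nil
  have "w = v" if "\<forall>z. w z = v z" for w using that by auto
  then show ?case by auto
next
  case (Cons n ns)
  show ?case
  proof
    assume "sat M v (exs (n # ns) \<phi>)"
    then obtain a where a: "a \<in> univ M" "sat M (v(n := a)) (exs ns \<phi>)" by auto
    then obtain w where "\<forall>z\<in>set ns. w z \<in> univ M" "\<forall>z. z \<notin> set ns \<longrightarrow> w z = (v(n := a)) z" "sat M w \<phi>"
      using Cons.IH by blast
    \<comment> \<open>If \<open>n\<close> occurs again in \<open>ns\<close>, the inner quantifier
      has overwritten \<open>a\<close>, and membership in the universe comes from there.\<close>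
    moreover from this a have "w n \<in> univ M" by (cases "n \<in> set ns") auto
    ultimately show "\<exists>w. (\<forall>z\<in>set (n # ns). w z \<in> univ M) \<and>
        (\<forall>z. z \<notin> set (n # ns) \<longrightarrow> w z = v z) \<and> sat M w \<phi>" by auto
  next
    assume "\<exists>w. (\<forall>z\<in>set (n # ns). w z \<in> univ M) \<and>
        (\<forall>z. z \<notin> set (n # ns) \<longrightarrow> w z = v z) \<and> sat M w \<phi>"
    then obtain w where w: "\<forall>z\<in>set (n # ns). w z \<in> univ M" "\<forall>z. z \<notin> set (n # ns) \<longrightarrow> w z = v z"
      "sat M w \<phi>" by blast
    then have "sat M (v(n := w n)) (exs ns \<phi>)"
      unfolding Cons.IH by (intro exI[of _ w]) auto
    then show "sat M v (exs (n # ns) \<phi>)" using w by auto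
  qed
qed

text \<open>The theory of \<open>M\<close> is complete: if no assignment into \<open>M\<close>
  satisfied the formula, the negation of its existential closure would be a sentence true in
  \<open>M\<close>, hence in \<open>N\<close>.\<close>

lemma satisfiable_transfer:
  fixes M :: "('f, 'r, 'a) interp" and N :: "('f, 'r, 'b) interp"
  assumes M: "is_structure L M" and N: "is_model L (theory_of L M) N" and wf: "wf_fm L \<psi>"
    and w: "range w \<subseteq> univ N" "sat N w \<psi>"
  shows "\<exists>w'. range w' \<subseteq> univ M \<and> sat M w' \<psi>"
proof (rule ccontr)
  assume neg: "\<not> ?thesis"
  let ?\<theta> = "exs (sorted_list_of_set (fv \<psi>)) \<psi>"
  have "\<not> sat M v ?\<theta>" if v: "range v \<subseteq> univ M" for v
  proof
    assume "sat M v ?\<theta>"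
    then obtain w' where "\<forall>z\<in>fv \<psi>. w' z \<in> univ M" "\<forall>z. z \<notin> fv \<psi> \<longrightarrow> w' z = v z" "sat M w' \<psi>"
      unfolding sat_exs by auto
    moreover from this v have "range w' \<subseteq> univ M" by (smt (verit) image_subset_iff rangeI)
    ultimately show False using neg by blast
  qed
  then have "Neg ?\<theta> \<in> theory_of L M"
    using wf by (auto simp: theory_of_def sentences_def)
  then have "\<not> sat N w ?\<theta>"
    using N w(1) by (auto simp: is_model_def)
  moreover have "sat N w ?\<theta>"
    unfolding sat_exs using w by (intro exI[of _ w]) auto
  ultimately show False by blast
qed

text \<open>A variable equated with itself stands for truth, as the syntax has no truth constant. It
  may add a free variable, which is harmless because satisfiability is transferred by closing over
  all free variables.\<close>

definition conjs :: "('f, 'r) fm list \<Rightarrow> ('f, 'r) fm" where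
  "conjs \<phi>s = foldr Conj \<phi>s (Eq (Var 0) (Var 0))"

lemma wf_conjs [simp]: "wf_fm L (conjs \<phi>s) \<longleftrightarrow> (\<forall>\<phi>\<in>set \<phi>s. wf_fm L \<phi>)"
  unfolding conjs_def by (induction \<phi>s) auto

lemma sat_conjs [simp]: "sat M v (conjs \<phi>s) \<longleftrightarrow> (\<forall>\<phi>\<in>set \<phi>s. sat M v \<phi>)"
  unfolding conjs_def by (induction \<phi>s) auto

section \<open>Generated substructures and homogeneity\<close>

lemma eval_closed:
  assumes "is_structure L M" "wf_tm L t" "v ` fv_tm t \<subseteq> univ M"
  shows "eval M v t \<in> univ M"
  using assms(2,3)
proof (induction t)
  case (App f ts)
  have "set (map (eval M v) ts) \<subseteq> univ M"
    using App by (fastforce simp: image_subset_iff)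
  then show ?case using assms(1) App.prems by (simp add: is_structure_def)
qed auto

lemma univ_restrict_to [simp]: "univ (restrict_to M B) = B"
  and fn_restrict_to [simp]: "fn (restrict_to M B) = fn M"
  and rel_restrict_to [simp]: "rel (restrict_to M B) = rel M"
  by (simp_all add: restrict_to_def)

definition generated ::
    "('f, 'r) language \<Rightarrow> ('f, 'r, 'a) interp \<Rightarrow> (nat \<Rightarrow> 'a) \<Rightarrow> nat set \<Rightarrow> 'a set" where
  "generated L M v Z = {eval M v t | t. wf_tm L t \<and> fv_tm t \<subseteq> Z}"

lemma generated_list:
  assumes "set xs \<subseteq> generated L M v Z"
  obtains ts where "xs = map (eval M v) ts" "\<forall>t\<in>set ts. wf_tm L t \<and> fv_tm t \<subseteq> Z"
proof -
  have "\<exists>ts. xs = map (eval M v) ts \<and> (\<forall>t\<in>set ts. wf_tm L t \<and> fv_tm t \<subseteq> Z)"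
    using assms
  proof (induction xs)
    case (Cons x xs)
    then obtain ts t where "xs = map (eval M v) ts" "\<forall>t\<in>set ts. wf_tm L t \<and> fv_tm t \<subseteq> Z"
      "x = eval M v t" "wf_tm L t" "fv_tm t \<subseteq> Z"
      by (auto simp: generated_def)
    then show ?case by (intro exI[of _ "t # ts"]) auto
  qed auto
  then show ?thesis using that by blast
qed

lemma generatedI: "wf_tm L t \<Longrightarrow> fv_tm t \<subseteq> Z \<Longrightarrow> eval M v t \<in> generated L M v Z"
  by (auto simp: generated_def)

lemma generator_in_generated: "z \<in> Z \<Longrightarrow> v z \<in> generated L M v Z"
  using generatedI[of L "Var z" Z M v] by simp

lemma is_substructure_generated:
  assumes M: "is_structure L M" and v: "range v \<subseteq> univ M" and Z: "Z \<noteq> {}"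
  shows "is_substructure L M (generated L M v Z)"
  unfolding is_substructure_def
proof
  show "generated L M v Z \<subseteq> univ M"
    using v by (auto simp: generated_def intro!: eval_closed[OF M])
  show "is_structure L (restrict_to M (generated L M v Z))"
    unfolding is_structure_def
  proof (intro conjI allI impI)
    show "univ (restrict_to M (generated L M v Z)) \<noteq> {}"
      using Z generator_in_generated[of _ Z v L M] by auto
    fix f n xs
    assume *: "fun_arity L f = Some n \<and> length xs = n \<and>
      set xs \<subseteq> univ (restrict_to M (generated L M v Z))"
    then obtain ts where ts: "xs = map (eval M v) ts" "\<forall>t\<in>set ts. wf_tm L t \<and> fv_tm t \<subseteq> Z"
      using generated_list[of xs L M v Z] by auto
    then have "eval M v (App f ts) \<in> generated L M v Z"
      using * by (intro generatedI) auto
    then show "fn (restrict_to M (generated L M v Z)) f xs \<in> univ (restrict_to M (generated L M v Z))"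
      using ts by simp
  qed
qed

lemma finitely_generated_generated:
  assumes Z: "finite Z"
  shows "finitely_generated L (restrict_to M (generated L M v Z))" (is "finitely_generated L ?G")
  unfolding finitely_generated_def
proof (intro exI[of _ "v ` Z"] conjI allI impI)
  show "v ` Z \<subseteq> univ ?G" by (auto intro: generator_in_generated)
  fix B
  assume B: "is_substructure L ?G B \<and> v ` Z \<subseteq> B"
  have "eval M v t \<in> B" if "wf_tm L t" "fv_tm t \<subseteq> Z" for t
    using that
  proof (induction t)
    case (App f ts)
    have "set (map (eval M v) ts) \<subseteq> B"
      using App by fastforce
    then show ?case
      using B App.prems by (auto simp: is_substructure_def is_structure_def)
  qed (use B in auto)
  then show "B = univ ?G"
    using B by (auto simp: is_substructure_def generated_def)
qed (use Z in auto)

lemma embedding_eval: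
  assumes M: "is_structure L M" and g: "embedding L M N g" and t: "wf_tm L t"
    and v: "v ` fv_tm t \<subseteq> univ M"
  shows "eval N (\<lambda>z. g (v z)) t = g (eval M v t)"
  using t v
proof (induction t)
  case (App f ts)
  have "map (eval N (\<lambda>z. g (v z))) ts = map g (map (eval M v) ts)"
    using App by fastforce
  moreover have "set (map (eval M v) ts) \<subseteq> univ M"
    using App.prems eval_closed[OF M] by fastforce
  ultimately show ?case
    using g App.prems by (simp add: embedding_def del: map_map map_eq_conv)
qed auto

lemma isomorphism_sat:
  assumes M: "is_structure L M" and g: "isomorphism L M N g"
  shows "wf_fm L \<phi> \<Longrightarrow> range v \<subseteq> univ M \<Longrightarrow> sat N (\<lambda>z. g (v z)) \<phi> = sat M v \<phi>"
proof (induction \<phi> arbitrary: v)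
  case (Eq s t)
  have "eval M v s \<in> univ M" "eval M v t \<in> univ M"
    using Eq by (auto intro!: eval_closed[OF M])
  moreover have "inj_on g (univ M)" using g by (simp add: isomorphism_def embedding_def)
  moreover have "eval N (\<lambda>z. g (v z)) s = g (eval M v s)" "eval N (\<lambda>z. g (v z)) t = g (eval M v t)"
    using Eq g by (auto intro!: embedding_eval[OF M] simp: isomorphism_def)
  ultimately show ?case by (auto dest: inj_onD)
next
  case (Rel r ts)
  have "map (eval N (\<lambda>z. g (v z))) ts = map g (map (eval M v) ts)"
    using Rel g by (auto intro!: embedding_eval[OF M] simp: isomorphism_def)
  moreover have "set (map (eval M v) ts) \<subseteq> univ M"
    using Rel by (auto intro!: eval_closed[OF M])
  ultimately show ?case
    using g Rel by (simp add: isomorphism_def embedding_def del: map_map map_eq_conv)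
next
  case (Ex n \<phi>)
  have gM: "univ N = g ` univ M" using g by (simp add: isomorphism_def)
  have "sat N ((\<lambda>z. g (v z))(n := g a)) \<phi> = sat M (v(n := a)) \<phi>" if a: "a \<in> univ M" for a
  proof -
    have "(\<lambda>z. g (v z))(n := g a) = (\<lambda>z. g ((v(n := a)) z))" by auto
    moreover have "range (v(n := a)) \<subseteq> univ M" using Ex.prems(2) a by auto
    ultimately show ?thesis using Ex.IH[of "v(n := a)"] Ex.prems by (simp del: fun_upd_apply)
  qed
  then show ?case by (simp add: gM)
qed auto

text \<open>Tuples with the same quantifier-free type generate isomorphic substructures, so by
  ultrahomogeneity they have the same type.\<close>

lemma ultrahomogeneous_sat_eq:
  assumes M: "is_structure L M" and uh: "ultrahomogeneous L M"
    and v: "range v \<subseteq> univ M" and w: "range w \<subseteq> univ M"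
    and Z: "finite Z" "Z \<noteq> {}"
    and eqs: "\<And>s t. \<lbrakk>wf_tm L s; wf_tm L t; fv_tm s \<subseteq> Z; fv_tm t \<subseteq> Z\<rbrakk> \<Longrightarrow>
      eval M v s = eval M v t \<longleftrightarrow> eval M w s = eval M w t"
    and rels: "\<And>r ts. \<lbrakk>rel_arity L r = Some (length ts); \<forall>t\<in>set ts. wf_tm L t \<and> fv_tm t \<subseteq> Z\<rbrakk> \<Longrightarrow>
      rel M r (map (eval M v) ts) \<longleftrightarrow> rel M r (map (eval M w) ts)"
    and \<phi>: "wf_fm L \<phi>" "fv \<phi> \<subseteq> Z"
  shows "sat M v \<phi> = sat M w \<phi>"
proof -
  let ?A = "generated L M v Z" and ?B = "generated L M w Z"
  define tm_of where "tm_of a = (SOME t. wf_tm L t \<and> fv_tm t \<subseteq> Z \<and> a = eval M v t)" for a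
  have tm_of: "wf_tm L (tm_of a) \<and> fv_tm (tm_of a) \<subseteq> Z \<and> a = eval M v (tm_of a)" if "a \<in> ?A" for a
    unfolding tm_of_def by (rule someI_ex) (use that in \<open>auto simp: generated_def\<close>)
  \<comment> \<open>By \<open>eqs\<close> the value does not depend on the term chosen for
    \<open>a\<close>; the converse implication in \<open>eqs\<close> makes \<open>h\<close>
    injective.\<close>
  define h where "h a = eval M w (tm_of a)" for a
  have h: "h (eval M v t) = eval M w t" if "wf_tm L t" "fv_tm t \<subseteq> Z" for t
    using tm_of[of "eval M v t"] eqs[of "tm_of (eval M v t)" t] that
    by (auto simp: h_def generatedI)
  have h_map: "map h (map (eval M v) ts) = map (eval M w) ts" if "\<forall>t\<in>set ts. wf_tm L t \<and> fv_tm t \<subseteq> Z" for ts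
    using that by (auto intro: h)
  have "isomorphism L (restrict_to M ?A) (restrict_to M ?B) h"
    unfolding isomorphism_def embedding_def univ_restrict_to fn_restrict_to rel_restrict_to
  proof (intro conjI allI impI)
    show img: "h ` ?A = ?B"
      using h by (force simp: generated_def)
    then show "h ` ?A \<subseteq> ?B" by simp
    show "inj_on h ?A"
      unfolding inj_on_def generated_def using h eqs by auto
  next
    fix f n xs
    assume *: "fun_arity L f = Some n \<and> length xs = n \<and> set xs \<subseteq> ?A"
    then obtain ts where ts: "xs = map (eval M v) ts" "\<forall>t\<in>set ts. wf_tm L t \<and> fv_tm t \<subseteq> Z"
      using generated_list by blast
    have "h (eval M v (App f ts)) = eval M w (App f ts)"
      by (rule h) (use * ts in auto)
    then show "h (fn M f xs) = fn M f (map h xs)"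
      using h_map[OF ts(2)] ts(1) by (simp del: map_map map_eq_conv)
  next
    fix r n xs
    assume *: "rel_arity L r = Some n \<and> length xs = n \<and> set xs \<subseteq> ?A"
    then obtain ts where ts: "xs = map (eval M v) ts" "\<forall>t\<in>set ts. wf_tm L t \<and> fv_tm t \<subseteq> Z"
      using generated_list by blast
    show "rel M r xs \<longleftrightarrow> rel M r (map h xs)"
      using h_map[OF ts(2)] ts(1) rels[of r ts] * ts(2) by (simp del: map_map map_eq_conv)
  qed
  then obtain g where g: "isomorphism L M M g" "\<forall>x\<in>?A. g x = h x"
    using uh is_substructure_generated[OF M v Z(2)] is_substructure_generated[OF M w Z(2)]
      finitely_generated_generated[OF Z(1)]
    unfolding ultrahomogeneous_def by metis
  \<comment> \<open>The automorphism is known to carry \<open>v\<close> to \<open>w\<close> only on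
    \<open>Z\<close>, which suffices because \<open>Z\<close> contains the free variables of the
    formula.\<close>
  have "g (v z) = w z" if "z \<in> Z" for z
    using g(2) generator_in_generated[OF that, of v L M] h[of "Var z"] that by auto
  then have "sat M (\<lambda>z. g (v z)) \<phi> = sat M w \<phi>"
    using \<phi>(2) by (intro sat_cong) auto
  then show ?thesis
    using isomorphism_sat[OF M g(1) \<phi>(1) v] by simp
qed

section \<open>Transport of structure along injections, and membership in the age\<close>

definition relabel :: "('f, 'r, 'a) interp \<Rightarrow> ('a \<Rightarrow> 'b) \<Rightarrow> ('f, 'r, 'b) interp" where
  "relabel S g = \<lparr>univ = g ` univ S,
     fn = (\<lambda>f xs. g (fn S f (map (inv_into (univ S) g) xs))),
     rel = (\<lambda>r xs. rel S r (map (inv_into (univ S) g) xs))\<rparr>"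

lemma set_map_inv_into:
  "set xs \<subseteq> g ` A \<Longrightarrow> set (map (inv_into A g) xs) \<subseteq> A"
  by (auto intro!: inv_into_into)

lemma is_structure_relabel:
  assumes "is_structure L S"
  shows "is_structure L (relabel S g)"
  unfolding is_structure_def
proof (intro conjI allI impI)
  show "univ (relabel S g) \<noteq> {}"
    using assms by (simp add: relabel_def is_structure_def)
  fix f n xs
  assume *: "fun_arity L f = Some n \<and> length xs = n \<and> set xs \<subseteq> univ (relabel S g)"
  then have "fn S f (map (inv_into (univ S) g) xs) \<in> univ S"
    using assms set_map_inv_into[of xs g "univ S"] by (simp add: is_structure_def relabel_def)
  then show "fn (relabel S g) f xs \<in> univ (relabel S g)"
    by (simp add: relabel_def)
qed

lemma embedding_relabel:
  assumes S: "is_structure L S" and g: "inj_on g (univ S)"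
  shows "embedding L S (relabel S g) g"
    and "embedding L (relabel S g) S (inv_into (univ S) g)"
proof -
  have map_id: "map (\<lambda>x. inv_into (univ S) g (g x)) xs = xs" if "set xs \<subseteq> univ S" for xs
    using that g by (intro map_idI) (auto intro!: inv_into_f_f)
  show "embedding L S (relabel S g) g"
    using g unfolding embedding_def relabel_def by (auto simp: comp_def map_id)
  show "embedding L (relabel S g) S (inv_into (univ S) g)"
    unfolding embedding_def
  proof (intro conjI allI impI)
    show "inv_into (univ S) g ` univ (relabel S g) \<subseteq> univ S"
      by (auto simp: relabel_def intro!: inv_into_into)
    show "inj_on (inv_into (univ S) g) (univ (relabel S g))"
      by (simp add: relabel_def inj_on_inv_into)
  next
    fix f n xs
    assume *: "fun_arity L f = Some n \<and> length xs = n \<and> set xs \<subseteq> univ (relabel S g)"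
    then have "fn S f (map (inv_into (univ S) g) xs) \<in> univ S"
      using S set_map_inv_into[of xs g "univ S"] by (simp add: is_structure_def relabel_def)
    then show "inv_into (univ S) g (fn (relabel S g) f xs) = fn S f (map (inv_into (univ S) g) xs)"
      using g by (simp add: relabel_def)
  qed (simp add: relabel_def)
qed

lemma finitely_generated_relabel:
  assumes S: "is_structure L S" and g: "inj_on g (univ S)" and fg: "finitely_generated L S"
  shows "finitely_generated L (relabel S g)"
proof -
  obtain X where X: "finite X" "X \<subseteq> univ S" "\<forall>B. is_substructure L S B \<and> X \<subseteq> B \<longrightarrow> B = univ S"
    using fg unfolding finitely_generated_def by (elim exE conjE)
  show ?thesis
    unfolding finitely_generated_def
  proof (intro exI[of _ "g ` X"] conjI allI impI)
    show "g ` X \<subseteq> univ (relabel S g)" using X(2) by (auto simp: relabel_def)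
    fix B
    assume B: "is_substructure L (relabel S g) B \<and> g ` X \<subseteq> B"
    define B0 where "B0 = inv_into (univ S) g ` B"
    have B_sub: "B \<subseteq> g ` univ S" using B by (simp add: is_substructure_def relabel_def)
    have gB0: "g ` B0 = B"
      using B_sub by (simp add: B0_def image_image f_inv_into_f subset_iff)
    have B0_sub: "B0 \<subseteq> univ S"
      using B_sub by (auto simp: B0_def intro!: inv_into_into)
    have "is_substructure L S B0"
      unfolding is_substructure_def is_structure_def
    proof (intro conjI allI impI)
      show "B0 \<subseteq> univ S" by (rule B0_sub)
      show "univ (restrict_to S B0) \<noteq> {}"
        using B by (simp add: B0_def is_substructure_def is_structure_def)
      fix f n xs
      assume *: "fun_arity L f = Some n \<and> length xs = n \<and> set xs \<subseteq> univ (restrict_to S B0)"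
      have xs: "set xs \<subseteq> univ S" using * B0_sub by auto
      have "set (map g xs) \<subseteq> B" using * gB0 by auto
      then have "fn (relabel S g) f (map g xs) \<in> B"
        using B * by (simp add: is_substructure_def is_structure_def)
      moreover have "fn (relabel S g) f (map g xs) = g (fn S f xs)"
        using embedding_relabel(1)[OF S g] * xs by (simp add: embedding_def)
      moreover have "fn S f xs \<in> univ S" using S * xs by (simp add: is_structure_def)
      ultimately show "fn (restrict_to S B0) f xs \<in> univ (restrict_to S B0)"
        using inj_on_image_mem_iff[OF g _ B0_sub] gB0 by simp
    qed
    moreover have "X \<subseteq> B0"
      using B X(2) inj_on_image_mem_iff[OF g] gB0 B0_sub by blast
    ultimately have "B0 = univ S" using X(3) by blast
    then show "B = univ (relabel S g)" using gB0 by (simp add: relabel_def)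
  qed (use X(1) in simp)
qed

text \<open>The age consists of structures on natural numbers, so a countable finitely generated
  substructure enters it through a copy numbered by \<open>to_nat_on\<close>; the inverse of the
  numbering is the embedding back.\<close>

lemma relabel_substructure_in_age:
  assumes B: "is_substructure L M B" "finitely_generated L (restrict_to M B)" "countable B"
  shows "relabel (restrict_to M B) (to_nat_on B) \<in> age L M"
    and "embedding L (relabel (restrict_to M B) (to_nat_on B)) M (inv_into B (to_nat_on B))"
proof -
  let ?S = "restrict_to M B"
  have S: "is_structure L ?S" "inj_on (to_nat_on B) (univ ?S)"
    using B inj_on_to_nat_on by (simp_all add: is_substructure_def)
  show emb: "embedding L (relabel ?S (to_nat_on B)) M (inv_into B (to_nat_on B))"
    using embedding_relabel(2)[OF S] B(1)
    by (auto simp: embedding_def is_substructure_def)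
  then show "relabel ?S (to_nat_on B) \<in> age L M"
    using is_structure_relabel[OF S(1)] finitely_generated_relabel[OF S B(2)]
    by (auto simp: age_def)
qed

section \<open>Countable ultrapowers\<close>

text \<open>The equivalence \<open>compl_iff\<close> expresses maximality and properness at once;
  together with \<open>finite_notin\<close> it makes every cofinite set large.\<close>

locale free_ultrafilter =
  fixes U :: "nat set set"
  assumes compl_iff: "- S \<in> U \<longleftrightarrow> S \<notin> U"
    and Int_mem: "\<lbrakk>S \<in> U; S' \<in> U\<rbrakk> \<Longrightarrow> S \<inter> S' \<in> U"
    and superset: "\<lbrakk>S \<in> U; S \<subseteq> S'\<rbrakk> \<Longrightarrow> S' \<in> U"
    and finite_notin: "finite S \<Longrightarrow> S \<notin> U"
begin

lemma Int_iff: "S \<inter> S' \<in> U \<longleftrightarrow> S \<in> U \<and> S' \<in> U"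
  by (metis Int_mem superset Int_lower1 Int_lower2)

lemma Collect_ball_mem:
  "finite A \<Longrightarrow> (\<And>x. x \<in> A \<Longrightarrow> {n. Q x n} \<in> U) \<Longrightarrow> {n. \<forall>x\<in>A. Q x n} \<in> U"
proof (induction A rule: finite_induct)
  case empty
  then show ?case using compl_iff[of "{}"] finite_notin[of "{}"] by simp
next
  case (insert x A)
  have "{n. \<forall>y\<in>insert x A. Q y n} = {n. Q x n} \<inter> {n. \<forall>y\<in>A. Q y n}" by auto
  then show ?case using insert by (simp add: Int_iff)
qed

lemma Collect_cong_mem:
  assumes "{n. Q n} \<in> U" "\<And>n. Q n \<Longrightarrow> R n \<longleftrightarrow> R' n"
  shows "{n. R n} \<in> U \<longleftrightarrow> {n. R' n} \<in> U"
proof -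
  have "{n. Q n} \<inter> {n. R n} = {n. Q n} \<inter> {n. R' n}" using assms(2) by auto
  then show ?thesis using assms(1) Int_iff by metis
qed

end

text \<open>Zorn's lemma is applied to families whose finite subfamilies have infinite intersection;
  this stronger form of the finite intersection property excludes finite members from the
  start.\<close>

lemma free_ultrafilter_exists: "\<exists>U. free_ultrafilter U"
proof -
  define A :: "nat set set set" where "A = {U. \<forall>G. finite G \<and> G \<subseteq> U \<longrightarrow> infinite (\<Inter>G)}"
  have "\<Union>C \<in> A" if C: "subset.chain A C" for C
    unfolding A_def
  proof (intro CollectI allI impI)
    fix G
    assume G: "finite G \<and> G \<subseteq> \<Union>C"
    show "infinite (\<Inter>G)"
    proof (cases "G = {}")
      case False
      then have "C \<noteq> {}" using G by auto
      then obtain X where "X \<in> C" "G \<subseteq> X"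
        using finite_subset_Union_chain[of G C] G C by (metis subset_chain_def)
      moreover have "C \<subseteq> A" using C by (simp add: subset.chain_def)
      ultimately show ?thesis using G by (auto simp: A_def)
    qed simp
  qed
  then obtain U where U: "U \<in> A" and max: "\<And>X. X \<in> A \<Longrightarrow> U \<subseteq> X \<Longrightarrow> X = U"
    using subset_Zorn'[of A] by blast
  have inf: "infinite (\<Inter>G)" if "finite G" "G \<subseteq> U" for G
    using U that by (auto simp: A_def)
  \<comment> \<open>Maximality: a set that cannot be added meets some finite intersection of members
    in a finite set.\<close>
  have notin: "\<exists>G. finite G \<and> G \<subseteq> U \<and> finite (S \<inter> \<Inter>G)" if S: "S \<notin> U" for S
  proof -
    have "insert S U \<notin> A" using max[of "insert S U"] S by auto
    then obtain G where G: "finite G" "G \<subseteq> insert S U" "finite (\<Inter>G)"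
      by (auto simp: A_def)
    have "S \<inter> \<Inter>(G - {S}) \<subseteq> \<Inter>G" by auto
    then show ?thesis using G by (intro exI[of _ "G - {S}"]) (auto intro: finite_subset)
  qed
  have two: "infinite (S \<inter> S')" if "S \<in> U" "S' \<in> U" for S S'
    using inf[of "{S, S'}"] that by simp
  have compl: "S \<in> U \<or> - S \<in> U" for S
  proof (rule ccontr)
    assume "\<not> (S \<in> U \<or> - S \<in> U)"
    then obtain G H where G: "finite G" "G \<subseteq> U" "finite (S \<inter> \<Inter>G)"
      and H: "finite H" "H \<subseteq> U" "finite (- S \<inter> \<Inter>H)"
      using notin by meson
    \<comment> \<open>One obstruction to \<open>S\<close> and one to its complement together would
      cover an infinite intersection by two finite sets.\<close>
    have "\<Inter>(G \<union> H) \<subseteq> (S \<inter> \<Inter>G) \<union> (- S \<inter> \<Inter>H)" by auto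
    then have "finite (\<Inter>(G \<union> H))" using G(3) H(3) by (meson finite_UnI finite_subset)
    then show False using inf[of "G \<union> H"] G H by auto
  qed
  have "free_ultrafilter U"
  proof
    show "- S \<in> U \<longleftrightarrow> S \<notin> U" for S
      using compl[of S] two[of S "- S"] by auto
    show "S' \<in> U" if "S \<in> U" "S \<subseteq> S'" for S S'
    proof (rule ccontr)
      assume "S' \<notin> U"
      then have "infinite (S \<inter> - S')" using compl[of S'] two that by blast
      moreover have "S \<inter> - S' = {}" using that by blast
      ultimately show False by simp
    qed
    show "S \<inter> S' \<in> U" if "S \<in> U" "S' \<in> U" for S S'
    proof (rule ccontr)
      assume "S \<inter> S' \<notin> U"
      then have "infinite (\<Inter>{S, S', - (S \<inter> S')})" using compl[of "S \<inter> S'"] that by (intro inf) auto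
      moreover have "\<Inter>{S, S', - (S \<inter> S')} = {}" by auto
      ultimately show False by simp
    qed
    show "S \<notin> U" if "finite S" for S
      using inf[of "{S}"] that by auto
  qed
  then show ?thesis by blast
qed

text \<open>The elements of the ultrapower are representatives, chosen by \<open>cls\<close>, of the sequences in the
  universe of \<open>M\<close>, given through a surjective coding \<open>dec\<close> of these sequences by the
  type \<open>'b\<close>.\<close>

locale ultrapower = free_ultrafilter U for U +
  fixes L :: "('f, 'r) language" and M :: "('f, 'r, 'a) interp" and dec :: "'b \<Rightarrow> nat \<Rightarrow> 'a"
  assumes M: "is_structure L M"
    and dec_in: "dec x n \<in> univ M"
    and dec_surj: "range f \<subseteq> univ M \<Longrightarrow> \<exists>x. dec x = f"
begin

definition cls :: "(nat \<Rightarrow> 'a) \<Rightarrow> 'b" where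
  "cls f = (SOME x. {n. dec x n = f n} \<in> U)"

definition N :: "('f, 'r, 'b) interp" where
  "N = \<lparr>univ = cls ` {f. range f \<subseteq> univ M},
     fn = (\<lambda>f xs. cls (\<lambda>n. fn M f (map (\<lambda>x. dec x n) xs))),
     rel = (\<lambda>r xs. {n. rel M r (map (\<lambda>x. dec x n) xs)} \<in> U)\<rparr>"

lemma UNIV_mem: "UNIV \<in> U"
  using compl_iff[of "{}"] finite_notin[of "{}"] by simp

lemma dec_cls:
  assumes "range f \<subseteq> univ M"
  shows "{n. dec (cls f) n = f n} \<in> U"
proof -
  obtain x where "dec x = f" using dec_surj[OF assms] by blast
  then have "{n. dec x n = f n} \<in> U" by (simp add: UNIV_mem)
  then show ?thesis unfolding cls_def by (rule someI)
qed

lemma cls_in: "range f \<subseteq> univ M \<Longrightarrow> cls f \<in> univ N"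
  by (auto simp: N_def)

text \<open>The quotient is formed by choice: sequences that agree on a large set satisfy the same
  selecting predicate under \<open>SOME\<close>, so they receive literally the same
  representative.\<close>

lemma cls_cong:
  assumes "{n. f n = g n} \<in> U"
  shows "cls f = cls g"
proof -
  have "{n. dec x n = f n} \<in> U \<longleftrightarrow> {n. dec x n = g n} \<in> U" for x
    using assms by (rule Collect_cong_mem) auto
  then show ?thesis by (simp add: cls_def)
qed

lemma N_eq_iff:
  assumes "x \<in> univ N" "y \<in> univ N"
  shows "x = y \<longleftrightarrow> {n. dec x n = dec y n} \<in> U"
proof -
  have cls_dec: "cls (dec x) = x" if x: "x \<in> univ N" for x
  proof -
    obtain f where f: "x = cls f" "range f \<subseteq> univ M" using x by (auto simp: N_def)
    have "cls (dec x) = cls f" by (rule cls_cong) (use dec_cls f in simp)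
    then show ?thesis using f by simp
  qed
  show ?thesis
  proof
    assume "{n. dec x n = dec y n} \<in> U"
    then have "cls (dec x) = cls (dec y)" by (rule cls_cong)
    then show "x = y" using cls_dec assms by simp
  qed (simp add: UNIV_mem)
qed

lemma fn_M_closed:
  assumes "fun_arity L f = Some (length xs)"
  shows "range (\<lambda>n. fn M f (map (\<lambda>x. dec x n) xs)) \<subseteq> univ M"
proof (intro image_subsetI)
  fix n
  have "set (map (\<lambda>x. dec x n) xs) \<subseteq> univ M" using dec_in by auto
  then show "fn M f (map (\<lambda>x. dec x n) xs) \<in> univ M"
    using M assms by (simp add: is_structure_def)
qed

lemma is_structure_N: "is_structure L N"
  unfolding is_structure_def
proof (intro conjI allI impI)
  obtain a where "a \<in> univ M" using M by (auto simp: is_structure_def)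
  then have "range (\<lambda>_. a) \<subseteq> univ M" by auto
  from cls_in[OF this] show "univ N \<noteq> {}" by auto
  fix f n xs
  assume *: "fun_arity L f = Some n \<and> length xs = n \<and> set xs \<subseteq> univ N"
  have "cls (\<lambda>n. fn M f (map (\<lambda>x. dec x n) xs)) \<in> univ N"
    by (rule cls_in[OF fn_M_closed]) (use * in simp)
  then show "fn N f xs \<in> univ N"
    by (simp add: N_def)
qed

lemma dec_eval:
  "wf_tm L t \<Longrightarrow> {n. dec (eval N v t) n = eval M (\<lambda>z. dec (v z) n) t} \<in> U"
proof (induction t)
  case (Var z)
  then show ?case by (simp add: UNIV_mem)
next
  case (App f ts)
  let ?xs = "map (eval N v) ts"
  have *: "{n. \<forall>t\<in>set ts. dec (eval N v t) n = eval M (\<lambda>z. dec (v z) n) t} \<in> U"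
    using App by (intro Collect_ball_mem) auto
  have "{n. dec (cls (\<lambda>n. fn M f (map (\<lambda>x. dec x n) ?xs))) n = fn M f (map (\<lambda>x. dec x n) ?xs)} \<in> U"
    by (rule dec_cls[OF fn_M_closed]) (use App.prems in simp)
  then have "{n. dec (eval N v (App f ts)) n = fn M f (map (\<lambda>x. dec x n) ?xs)} \<in> U"
    by (simp add: N_def)
  moreover have "{n. dec (eval N v (App f ts)) n = fn M f (map (\<lambda>x. dec x n) ?xs)} \<in> U \<longleftrightarrow>
      {n. dec (eval N v (App f ts)) n = eval M (\<lambda>z. dec (v z) n) (App f ts)} \<in> U"
    using * by (rule Collect_cong_mem) (auto cong: map_cong simp: comp_def)
  ultimately show ?case by simp
qed

text \<open>Los's theorem by induction on the formula: negation uses that exactly one of a set and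
  its complement is large, conjunction uses intersections, and an existential quantifier is
  witnessed coordinatewise.\<close>

theorem sat_N:
  "wf_fm L \<phi> \<Longrightarrow> range v \<subseteq> univ N \<Longrightarrow> sat N v \<phi> \<longleftrightarrow> {n. sat M (\<lambda>z. dec (v z) n) \<phi>} \<in> U"
proof (induction \<phi> arbitrary: v)
  case (Eq s t)
  have in_N: "eval N v s \<in> univ N" "eval N v t \<in> univ N"
    using Eq by (auto intro!: eval_closed[OF is_structure_N])
  have ev: "{n. dec (eval N v s) n = eval M (\<lambda>z. dec (v z) n) s \<and>
      dec (eval N v t) n = eval M (\<lambda>z. dec (v z) n) t} \<in> U"
    using dec_eval[of s v] dec_eval[of t v] Eq.prems(1) Int_mem by (auto simp: Collect_conj_eq)
  show ?case
    unfolding sat.simps N_eq_iff[OF in_N] using ev by (rule Collect_cong_mem) auto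
next
  case (Rel r ts)
  have ev: "{n. \<forall>t\<in>set ts. dec (eval N v t) n = eval M (\<lambda>z. dec (v z) n) t} \<in> U"
    using Rel by (intro Collect_ball_mem dec_eval) auto
  have "sat N v (Rel r ts) \<longleftrightarrow> {n. rel M r (map (\<lambda>t. dec (eval N v t) n) ts)} \<in> U"
    by (simp add: N_def comp_def)
  also have "\<dots> \<longleftrightarrow> {n. sat M (\<lambda>z. dec (v z) n) (Rel r ts)} \<in> U"
    using ev by (rule Collect_cong_mem) (auto cong: map_cong)
  finally show ?case .
next
  case (Neg \<phi>)
  have "{n. sat M (\<lambda>z. dec (v z) n) (Neg \<phi>)} = - {n. sat M (\<lambda>z. dec (v z) n) \<phi>}" by auto
  then show ?case using Neg by (simp add: compl_iff)
next
  case (Conj \<phi> \<psi>)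
  then show ?case by (simp add: Collect_conj_eq Int_iff)
next
  case (Ex m \<phi>)
  have upd: "(\<lambda>z. dec ((v(m := x)) z) n) = (\<lambda>z. dec (v z) n)(m := dec x n)" for x n
    by auto
  have IH: "sat N (v(m := x)) \<phi> \<longleftrightarrow> {n. sat M ((\<lambda>z. dec (v z) n)(m := dec x n)) \<phi>} \<in> U"
    if x: "x \<in> univ N" for x
  proof -
    have "range (v(m := x)) \<subseteq> univ N" using Ex.prems(2) x by auto
    then show ?thesis using Ex.IH[of "v(m := x)"] Ex.prems(1) unfolding upd by (simp del: fun_upd_apply)
  qed
  show ?case
  proof
    assume "sat N v (Ex m \<phi>)"
    then obtain x where "x \<in> univ N" "sat N (v(m := x)) \<phi>" by auto
    then have "{n. sat M ((\<lambda>z. dec (v z) n)(m := dec x n)) \<phi>} \<in> U" using IH by (simp del: fun_upd_apply)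
    then show "{n. sat M (\<lambda>z. dec (v z) n) (Ex m \<phi>)} \<in> U"
      by (rule superset) (use dec_in in auto)
  next
    assume *: "{n. sat M (\<lambda>z. dec (v z) n) (Ex m \<phi>)} \<in> U"
    obtain a where a: "a \<in> univ M" using M by (auto simp: is_structure_def)
    \<comment> \<open>At coordinates without a witness any element of the universe will do, so that
      \<open>f\<close> becomes a sequence in the universe.\<close>
    have "\<forall>n. \<exists>x. x \<in> univ M \<and> (sat M (\<lambda>z. dec (v z) n) (Ex m \<phi>) \<longrightarrow>
        sat M ((\<lambda>z. dec (v z) n)(m := x)) \<phi>)" using a by (metis sat.simps(5))
    then obtain f where f: "\<And>n. f n \<in> univ M"
      "\<And>n. sat M (\<lambda>z. dec (v z) n) (Ex m \<phi>) \<Longrightarrow> sat M ((\<lambda>z. dec (v z) n)(m := f n)) \<phi>"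
      by metis
    have "range f \<subseteq> univ M" using f(1) by auto
    then have c: "cls f \<in> univ N" "{n. dec (cls f) n = f n} \<in> U"
      by (rule cls_in, rule dec_cls)
    have "{n. sat M ((\<lambda>z. dec (v z) n)(m := dec (cls f) n)) \<phi>} \<in> U"
    proof (rule superset[OF Int_mem[OF * c(2)]], intro subsetI CollectI)
      fix n
      assume "n \<in> {n. sat M (\<lambda>z. dec (v z) n) (Ex m \<phi>)} \<inter> {n. dec (cls f) n = f n}"
      then show "sat M ((\<lambda>z. dec (v z) n)(m := dec (cls f) n)) \<phi>"
        using f(2)[of n] by simp
    qed
    then have "sat N (v(m := cls f)) \<phi>" using IH[OF c(1)] by simp
    then show "sat N v (Ex m \<phi>)" using c(1) by auto
  qed
qed

lemma is_model_N: "is_model L (theory_of L M) N"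
  unfolding is_model_def
proof (intro conjI ballI allI impI is_structure_N)
  fix \<phi> and v :: "nat \<Rightarrow> 'b"
  assume \<phi>: "\<phi> \<in> theory_of L M" and v: "range v \<subseteq> univ N"
  have "sat M (\<lambda>z. dec (v z) n) \<phi>" for n
  proof -
    have "range (\<lambda>z. dec (v z) n) \<subseteq> univ M" using dec_in by auto
    then show ?thesis using \<phi> by (simp add: theory_of_def)
  qed
  then show "sat N v \<phi>"
    using sat_N[OF _ v, of \<phi>] \<phi> by (simp add: theory_of_def sentences_def UNIV_mem)
qed

end

text \<open>A sequence in a countable set is stored as the graph of the numbers of its entries,
  coded as one set of natural numbers; this is why the ultrapower can live on
  \<open>nat set\<close>. Sets that code no graph still decode to some sequence in
  \<open>A\<close>.\<close>

lemma sequence_coding: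
  assumes "countable A" "A \<noteq> {}"
  obtains dec :: "nat set \<Rightarrow> nat \<Rightarrow> 'a"
  where "\<And>x n. dec x n \<in> A" "\<And>f. range f \<subseteq> A \<Longrightarrow> \<exists>x. dec x = f"
proof
  define dec :: "nat set \<Rightarrow> nat \<Rightarrow> 'a"
    where "dec x n = from_nat_into A (SOME m. prod_encode (n, m) \<in> x)" for x n
  show "dec x n \<in> A" for x n
    using assms by (simp add: dec_def from_nat_into)
  show "\<exists>x. dec x = f" if f: "range f \<subseteq> A" for f
  proof
    let ?x = "range (\<lambda>n. prod_encode (n, to_nat_on A (f n)))"
    have "(SOME m. prod_encode (n, m) \<in> ?x) = to_nat_on A (f n)" for n
      by (rule some_equality) auto
    then show "dec ?x = f"
      using f assms(1) by (auto simp: dec_def fun_eq_iff intro!: from_nat_into_to_nat_on)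
  qed
qed

section \<open>Lazard Lie algebras as a universal class\<close>

text \<open>The axioms at given arguments. None involves more than three elements, so a structure is a Lazard
  Lie algebra as soon as its finitely generated substructures are.\<close>

definition lla_at ::
    "('k, 'm) ring_scheme \<Rightarrow> nat \<Rightarrow> ('k lla_fun, lla_rel, 'a) interp \<Rightarrow>
      'k \<Rightarrow> 'k \<Rightarrow> nat \<Rightarrow> nat \<Rightarrow> 'a \<Rightarrow> 'a \<Rightarrow> 'a \<Rightarrow> bool" where
  "lla_at F c S a b i j x y z \<longleftrightarrow>
     (x \<oplus>\<^bsub>alg_of S\<^esub> y) \<oplus>\<^bsub>alg_of S\<^esub> z = x \<oplus>\<^bsub>alg_of S\<^esub> (y \<oplus>\<^bsub>alg_of S\<^esub> z) \<and>
     x \<oplus>\<^bsub>alg_of S\<^esub> y = y \<oplus>\<^bsub>alg_of S\<^esub> x \<and>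
     \<zero>\<^bsub>alg_of S\<^esub> \<oplus>\<^bsub>alg_of S\<^esub> x = x \<and>
     fn S Minus [x] \<oplus>\<^bsub>alg_of S\<^esub> x = \<zero>\<^bsub>alg_of S\<^esub> \<and>
     (a \<oplus>\<^bsub>F\<^esub> b) \<odot>\<^bsub>alg_of S\<^esub> x = a \<odot>\<^bsub>alg_of S\<^esub> x \<oplus>\<^bsub>alg_of S\<^esub> b \<odot>\<^bsub>alg_of S\<^esub> x \<and>
     a \<odot>\<^bsub>alg_of S\<^esub> (x \<oplus>\<^bsub>alg_of S\<^esub> y) = a \<odot>\<^bsub>alg_of S\<^esub> x \<oplus>\<^bsub>alg_of S\<^esub> a \<odot>\<^bsub>alg_of S\<^esub> y \<and>
     (a \<otimes>\<^bsub>F\<^esub> b) \<odot>\<^bsub>alg_of S\<^esub> x = a \<odot>\<^bsub>alg_of S\<^esub> (b \<odot>\<^bsub>alg_of S\<^esub> x) \<and>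
     \<one>\<^bsub>F\<^esub> \<odot>\<^bsub>alg_of S\<^esub> x = x \<and>
     (x \<oplus>\<^bsub>alg_of S\<^esub> y) \<otimes>\<^bsub>alg_of S\<^esub> z = x \<otimes>\<^bsub>alg_of S\<^esub> z \<oplus>\<^bsub>alg_of S\<^esub> y \<otimes>\<^bsub>alg_of S\<^esub> z \<and>
     x \<otimes>\<^bsub>alg_of S\<^esub> (y \<oplus>\<^bsub>alg_of S\<^esub> z) = x \<otimes>\<^bsub>alg_of S\<^esub> y \<oplus>\<^bsub>alg_of S\<^esub> x \<otimes>\<^bsub>alg_of S\<^esub> z \<and>
     (a \<odot>\<^bsub>alg_of S\<^esub> x) \<otimes>\<^bsub>alg_of S\<^esub> y = a \<odot>\<^bsub>alg_of S\<^esub> (x \<otimes>\<^bsub>alg_of S\<^esub> y) \<and>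
     x \<otimes>\<^bsub>alg_of S\<^esub> (a \<odot>\<^bsub>alg_of S\<^esub> y) = a \<odot>\<^bsub>alg_of S\<^esub> (x \<otimes>\<^bsub>alg_of S\<^esub> y) \<and>
     x \<otimes>\<^bsub>alg_of S\<^esub> x = \<zero>\<^bsub>alg_of S\<^esub> \<and>
     (x \<otimes>\<^bsub>alg_of S\<^esub> (y \<otimes>\<^bsub>alg_of S\<^esub> z)) \<oplus>\<^bsub>alg_of S\<^esub> (y \<otimes>\<^bsub>alg_of S\<^esub> (z \<otimes>\<^bsub>alg_of S\<^esub> x))
       \<oplus>\<^bsub>alg_of S\<^esub> (z \<otimes>\<^bsub>alg_of S\<^esub> (x \<otimes>\<^bsub>alg_of S\<^esub> y)) = \<zero>\<^bsub>alg_of S\<^esub> \<and>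
     rel S (P 1) [x] \<and>
     (rel S (P (c + 1)) [x] \<longleftrightarrow> x = \<zero>\<^bsub>alg_of S\<^esub>) \<and>
     rel S (P i) [\<zero>\<^bsub>alg_of S\<^esub>] \<and>
     (rel S (P i) [x] \<longrightarrow> rel S (P i) [y] \<longrightarrow> rel S (P i) [x \<oplus>\<^bsub>alg_of S\<^esub> y]) \<and>
     (rel S (P i) [x] \<longrightarrow> rel S (P i) [a \<odot>\<^bsub>alg_of S\<^esub> x]) \<and>
     (rel S (P i) [x] \<longrightarrow> rel S (P i) [fn S Minus [x]]) \<and>
     (i \<le> c \<longrightarrow> rel S (P (i + 1)) [x] \<longrightarrow> rel S (P i) [x]) \<and>
     (i + j \<le> c + 1 \<longrightarrow> rel S (P i) [x] \<longrightarrow> rel S (P j) [y] \<longrightarrow>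
        rel S (P (i + j)) [x \<otimes>\<^bsub>alg_of S\<^esub> y]) \<and>
     (\<not> i + j \<le> c + 1 \<longrightarrow> rel S (P i) [x] \<longrightarrow> rel S (P j) [y] \<longrightarrow>
        x \<otimes>\<^bsub>alg_of S\<^esub> y = \<zero>\<^bsub>alg_of S\<^esub>)"

lemma fun_arity_lla [simp]:
  "fun_arity (lla_lang F c) Plus = Some 2"
  "fun_arity (lla_lang F c) Minus = Some 1"
  "fun_arity (lla_lang F c) Zero = Some 0"
  "fun_arity (lla_lang F c) (Scale a) = (if a \<in> carrier F then Some 1 else None)"
  "fun_arity (lla_lang F c) Bracket = Some 2"
  "rel_arity (lla_lang F c) (P i) = (if 1 \<le> i \<and> i \<le> c + 1 then Some 1 else None)"
  by (simp_all add: lla_lang_def)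

lemma alg_of_simps:
  "carrier (alg_of S) = univ S"
  "x \<otimes>\<^bsub>alg_of S\<^esub> y = fn S Bracket [x, y]"
  "\<zero>\<^bsub>alg_of S\<^esub> = fn S Zero []"
  "x \<oplus>\<^bsub>alg_of S\<^esub> y = fn S Plus [x, y]"
  "a \<odot>\<^bsub>alg_of S\<^esub> x = fn S (Scale a) [x]"
  by (simp_all add: alg_of_def)

lemma is_structure_closed:
  "is_structure L S \<Longrightarrow> fun_arity L f = Some (length xs) \<Longrightarrow> set xs \<subseteq> univ S \<Longrightarrow> fn S f xs \<in> univ S"
  by (simp add: is_structure_def)

lemma lla_closed:
  assumes S: "is_structure (lla_lang F c) S"
  shows "x \<in> univ S \<Longrightarrow> y \<in> univ S \<Longrightarrow> fn S Plus [x, y] \<in> univ S"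
    and "x \<in> univ S \<Longrightarrow> y \<in> univ S \<Longrightarrow> fn S Bracket [x, y] \<in> univ S"
    and "x \<in> univ S \<Longrightarrow> fn S Minus [x] \<in> univ S"
    and "x \<in> univ S \<Longrightarrow> a \<in> carrier F \<Longrightarrow> fn S (Scale a) [x] \<in> univ S"
    and "fn S Zero [] \<in> univ S"
  by (rule is_structure_closed[OF S]; simp)+

lemma embedding_fn:
  "embedding L A S h \<Longrightarrow> fun_arity L f = Some (length xs) \<Longrightarrow> set xs \<subseteq> univ A \<Longrightarrow>
     h (fn A f xs) = fn S f (map h xs)"
  by (simp add: embedding_def)

lemma embedding_rel:
  "embedding L A S h \<Longrightarrow> rel_arity L r = Some (length xs) \<Longrightarrow> set xs \<subseteq> univ A \<Longrightarrow>
     rel A r xs = rel S r (map h xs)"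
  by (simp add: embedding_def)

text \<open>Every clause is a Boolean combination of atomic formulas in the given elements, which an
  embedding preserves and reflects. The guards \<open>i <= c\<close> and
  \<open>i + j <= c + 1\<close> keep the layers that are mentioned inside the language.\<close>

lemma lla_at_embedding:
  assumes A: "is_structure (lla_lang F c) A" and F: "field F" and h: "embedding (lla_lang F c) A S h"
    and ab: "a \<in> carrier F" "b \<in> carrier F" and ij: "i \<in> {1..c + 1}" "j \<in> {1..c + 1}"
    and xyz: "x \<in> univ A" "y \<in> univ A" "z \<in> univ A"
  shows "lla_at F c A a b i j x y z \<longleftrightarrow> lla_at F c S a b i j (h x) (h y) (h z)"
proof -
  interpret F: field F by (rule F)
  note closed = lla_closed[OF A]
  have h_fn: "u \<in> univ A \<Longrightarrow> v \<in> univ A \<Longrightarrow> fn S Plus [h u, h v] = h (fn A Plus [u, v])"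
    "u \<in> univ A \<Longrightarrow> v \<in> univ A \<Longrightarrow> fn S Bracket [h u, h v] = h (fn A Bracket [u, v])"
    "u \<in> univ A \<Longrightarrow> fn S Minus [h u] = h (fn A Minus [u])"
    "u \<in> univ A \<Longrightarrow> a \<in> carrier F \<Longrightarrow> fn S (Scale a) [h u] = h (fn A (Scale a) [u])"
    "fn S Zero [] = h (fn A Zero [])" for u v a
    using embedding_fn[OF h, of Plus "[u, v]"] embedding_fn[OF h, of Bracket "[u, v]"]
      embedding_fn[OF h, of Minus "[u]"] embedding_fn[OF h, of "Scale a" "[u]"]
      embedding_fn[OF h, of Zero "[]"]
    by simp_all
  have h_rel: "u \<in> univ A \<Longrightarrow> 1 \<le> i \<Longrightarrow> i \<le> c + 1 \<Longrightarrow> rel S (P i) [h u] \<longleftrightarrow> rel A (P i) [u]" for u i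
    using embedding_rel[OF h, of "P i" "[u]"] by simp
  have h_eq: "u \<in> univ A \<Longrightarrow> v \<in> univ A \<Longrightarrow> h u = h v \<longleftrightarrow> u = v" for u v
    using h by (auto simp: embedding_def dest: inj_onD)
  show ?thesis
    unfolding lla_at_def alg_of_simps using ab ij by (simp add: h_fn h_rel h_eq closed xyz)
qed

lemma is_lla_imp_lla_at:
  assumes S: "is_lla F c S" and ab: "a \<in> carrier F" "b \<in> carrier F"
    and i: "i \<in> {1..c + 1}" and j: "j \<in> {1..c + 1}"
    and xyz: "x \<in> univ S" "y \<in> univ S" "z \<in> univ S"
  shows "lla_at F c S a b i j x y z"
proof -
  have str: "is_structure (lla_lang F c) S" using S by (simp add: is_lla_def)
  have L: "lie_algebra F (alg_of S)" using S by (simp add: is_lla_def)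
  interpret lie_algebra F "alg_of S" by (rule L)
  have car: "carrier (alg_of S) = univ S" by (simp add: alg_of_simps)
  note xyz' = xyz[folded car]
  have minus: "fn S Minus [x] = \<ominus>\<^bsub>alg_of S\<^esub> x" using S xyz by (simp add: is_lla_def)
  have sub: "submodule (layer c S i) F (alg_of S)" if "i \<in> {1..c + 1}" for i
    using S that by (simp add: is_lla_def lie_subalgebra_def)
  have lay: "u \<in> layer c S i \<longleftrightarrow> rel S (P i) [u]" if "i \<le> c + 1" "u \<in> univ S" for i u
    using that by (simp add: layer_def)
  have lay0: "layer c S i = {\<zero>\<^bsub>alg_of S\<^esub>}" if "\<not> i \<le> c + 1" for i
    using that by (simp add: layer_def alg_of_simps)
  have br: "u \<otimes>\<^bsub>alg_of S\<^esub> v \<in> layer c S (i + j)"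
    if "i \<in> {1..c + 1}" "j \<in> {1..c + 1}" "u \<in> layer c S i" "v \<in> layer c S j" for u v i j
    using S that unfolding is_lla_def by blast
  have top: "layer c S 1 = univ S" "layer c S (c + 1) = {\<zero>\<^bsub>alg_of S\<^esub>}"
    and mono: "\<And>i. i \<in> {1..c} \<Longrightarrow> layer c S (i + 1) \<subseteq> layer c S i"
    using S unfolding is_lla_def by blast+
  have zero: "\<zero>\<^bsub>alg_of S\<^esub> \<in> univ S" using zero_closed car by simp
  show ?thesis
    unfolding lla_at_def
  proof (intro conjI impI)
    show "x \<oplus>\<^bsub>alg_of S\<^esub> y = y \<oplus>\<^bsub>alg_of S\<^esub> x" by (rule M.a_comm[OF xyz'(1,2)])
    show "rel S (P 1) [x]" using top(1) lay[of 1 x] xyz by simp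
    show "rel S (P (c + 1)) [x] \<longleftrightarrow> x = \<zero>\<^bsub>alg_of S\<^esub>" using top(2) lay[of "c + 1" x] xyz by simp
    have zi: "\<zero>\<^bsub>alg_of S\<^esub> \<in> layer c S i"
      using subgroup.one_closed[OF submodule.axioms(1)[OF sub[OF i]]] by simp
    then show "rel S (P i) [\<zero>\<^bsub>alg_of S\<^esub>]" using lay[of i] i zero by simp
    show "rel S (P i) [x \<oplus>\<^bsub>alg_of S\<^esub> y]" if "rel S (P i) [x]" "rel S (P i) [y]"
    proof -
      have "x \<oplus>\<^bsub>alg_of S\<^esub> y \<in> layer c S i"
        using submoduleE(5)[OF sub[OF i]] lay[of i] xyz i that by simp
      then show ?thesis using i by (simp add: layer_def)
    qed
    show "rel S (P i) [fn S Minus [x]]" if "rel S (P i) [x]"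
    proof -
      have "\<ominus>\<^bsub>alg_of S\<^esub> x \<in> layer c S i"
        using submoduleE(3)[OF sub[OF i]] lay[of i] xyz i that by simp
      then show ?thesis using i minus by (simp add: layer_def)
    qed
    show "rel S (P i) [a \<odot>\<^bsub>alg_of S\<^esub> x]" if "rel S (P i) [x]"
    proof -
      have "a \<odot>\<^bsub>alg_of S\<^esub> x \<in> layer c S i"
        using submoduleE(4)[OF sub[OF i]] lay[of i] xyz i ab that by simp
      then show ?thesis using i by (simp add: layer_def)
    qed
    have *: "x \<otimes>\<^bsub>alg_of S\<^esub> y \<in> layer c S (i + j)" if "rel S (P i) [x]" "rel S (P j) [y]"
      by (rule br[OF i j]) (use lay xyz i j that in auto)
    show "rel S (P (i + j)) [x \<otimes>\<^bsub>alg_of S\<^esub> y]"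
      if "i + j \<le> c + 1" "rel S (P i) [x]" "rel S (P j) [y]"
      using * that by (simp add: layer_def)
    show "x \<otimes>\<^bsub>alg_of S\<^esub> y = \<zero>\<^bsub>alg_of S\<^esub>"
      if "\<not> i + j \<le> c + 1" "rel S (P i) [x]" "rel S (P j) [y]"
      using * lay0 that by simp
    show "rel S (P i) [x]" if "i \<le> c" "rel S (P (i + 1)) [x]"
      using mono[of i] lay[of i x] lay[of "i + 1" x] xyz i that by auto
  qed (simp_all add: xyz' ab minus smult_l_distr smult_r_distr smult_assoc1 M.a_assoc M.l_neg
      bracket_add_left bracket_add_right bracket_smult_left bracket_smult_right bracket_self jacobi)
qed

section \<open>Recovering a Lazard Lie algebra from its axioms at single arguments\<close>

locale pointwise_lla =
  fixes F :: "('k, 'm) ring_scheme" and c :: nat and S :: "('k lla_fun, lla_rel, 'a) interp"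
  assumes F: "field F" and S: "is_structure (lla_lang F c) S"
    and at: "\<And>a b i j x y z. \<lbrakk>a \<in> carrier F; b \<in> carrier F; i \<in> {1..c + 1}; j \<in> {1..c + 1};
        x \<in> univ S; y \<in> univ S; z \<in> univ S\<rbrakk> \<Longrightarrow> lla_at F c S a b i j x y z"
begin

lemma one_in_F: "\<one>\<^bsub>F\<^esub> \<in> carrier F"
proof -
  interpret field F by (rule F)
  show ?thesis by simp
qed

lemma one_index: "1 \<in> {1..c + 1}"
  by simp

lemma assoc:
  assumes "x \<in> univ S" "y \<in> univ S" "z \<in> univ S"
  shows "(x \<oplus>\<^bsub>alg_of S\<^esub> y) \<oplus>\<^bsub>alg_of S\<^esub> z = x \<oplus>\<^bsub>alg_of S\<^esub> (y \<oplus>\<^bsub>alg_of S\<^esub> z)"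
  using at[OF one_in_F one_in_F one_index one_index assms(1) assms(2) assms(3)]
  unfolding lla_at_def by (elim conjE)

lemma comm:
  assumes "x \<in> univ S" "y \<in> univ S"
  shows "x \<oplus>\<^bsub>alg_of S\<^esub> y = y \<oplus>\<^bsub>alg_of S\<^esub> x"
  using at[OF one_in_F one_in_F one_index one_index assms(1) assms(2) assms(1)]
  unfolding lla_at_def by (elim conjE)

lemma zero:
  assumes "x \<in> univ S"
  shows "\<zero>\<^bsub>alg_of S\<^esub> \<oplus>\<^bsub>alg_of S\<^esub> x = x"
  using at[OF one_in_F one_in_F one_index one_index assms(1) assms(1) assms(1)]
  unfolding lla_at_def by (elim conjE)

lemma neg:
  assumes "x \<in> univ S"
  shows "fn S Minus [x] \<oplus>\<^bsub>alg_of S\<^esub> x = \<zero>\<^bsub>alg_of S\<^esub>"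
  using at[OF one_in_F one_in_F one_index one_index assms(1) assms(1) assms(1)]
  unfolding lla_at_def by (elim conjE)

lemma ldistr:
  assumes "a \<in> carrier F" "b \<in> carrier F" "x \<in> univ S"
  shows "(a \<oplus>\<^bsub>F\<^esub> b) \<odot>\<^bsub>alg_of S\<^esub> x = a \<odot>\<^bsub>alg_of S\<^esub> x \<oplus>\<^bsub>alg_of S\<^esub> b \<odot>\<^bsub>alg_of S\<^esub> x"
  using at[OF assms(1) assms(2) one_index one_index assms(3) assms(3) assms(3)]
  unfolding lla_at_def by (elim conjE)

lemma rdistr:
  assumes "a \<in> carrier F" "x \<in> univ S" "y \<in> univ S"
  shows "a \<odot>\<^bsub>alg_of S\<^esub> (x \<oplus>\<^bsub>alg_of S\<^esub> y) = a \<odot>\<^bsub>alg_of S\<^esub> x \<oplus>\<^bsub>alg_of S\<^esub> a \<odot>\<^bsub>alg_of S\<^esub> y"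
  using at[OF assms(1) one_in_F one_index one_index assms(2) assms(3) assms(2)]
  unfolding lla_at_def by (elim conjE)

lemma sassoc:
  assumes "a \<in> carrier F" "b \<in> carrier F" "x \<in> univ S"
  shows "(a \<otimes>\<^bsub>F\<^esub> b) \<odot>\<^bsub>alg_of S\<^esub> x = a \<odot>\<^bsub>alg_of S\<^esub> (b \<odot>\<^bsub>alg_of S\<^esub> x)"
  using at[OF assms(1) assms(2) one_index one_index assms(3) assms(3) assms(3)]
  unfolding lla_at_def by (elim conjE)

lemma sone:
  assumes "x \<in> univ S"
  shows "\<one>\<^bsub>F\<^esub> \<odot>\<^bsub>alg_of S\<^esub> x = x"
  using at[OF one_in_F one_in_F one_index one_index assms(1) assms(1) assms(1)]
  unfolding lla_at_def by (elim conjE)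

lemma bl:
  assumes "x \<in> univ S" "y \<in> univ S" "z \<in> univ S"
  shows "(x \<oplus>\<^bsub>alg_of S\<^esub> y) \<otimes>\<^bsub>alg_of S\<^esub> z = x \<otimes>\<^bsub>alg_of S\<^esub> z \<oplus>\<^bsub>alg_of S\<^esub> y \<otimes>\<^bsub>alg_of S\<^esub> z"
  using at[OF one_in_F one_in_F one_index one_index assms(1) assms(2) assms(3)]
  unfolding lla_at_def by (elim conjE)

lemma br:
  assumes "x \<in> univ S" "y \<in> univ S" "z \<in> univ S"
  shows "x \<otimes>\<^bsub>alg_of S\<^esub> (y \<oplus>\<^bsub>alg_of S\<^esub> z) = x \<otimes>\<^bsub>alg_of S\<^esub> y \<oplus>\<^bsub>alg_of S\<^esub> x \<otimes>\<^bsub>alg_of S\<^esub> z"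
  using at[OF one_in_F one_in_F one_index one_index assms(1) assms(2) assms(3)]
  unfolding lla_at_def by (elim conjE)

lemma bsl:
  assumes "a \<in> carrier F" "x \<in> univ S" "y \<in> univ S"
  shows "(a \<odot>\<^bsub>alg_of S\<^esub> x) \<otimes>\<^bsub>alg_of S\<^esub> y = a \<odot>\<^bsub>alg_of S\<^esub> (x \<otimes>\<^bsub>alg_of S\<^esub> y)"
  using at[OF assms(1) one_in_F one_index one_index assms(2) assms(3) assms(2)]
  unfolding lla_at_def by (elim conjE)

lemma bsr:
  assumes "a \<in> carrier F" "x \<in> univ S" "y \<in> univ S"
  shows "x \<otimes>\<^bsub>alg_of S\<^esub> (a \<odot>\<^bsub>alg_of S\<^esub> y) = a \<odot>\<^bsub>alg_of S\<^esub> (x \<otimes>\<^bsub>alg_of S\<^esub> y)"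
  using at[OF assms(1) one_in_F one_index one_index assms(2) assms(3) assms(2)]
  unfolding lla_at_def by (elim conjE)

lemma bself:
  assumes "x \<in> univ S"
  shows "x \<otimes>\<^bsub>alg_of S\<^esub> x = \<zero>\<^bsub>alg_of S\<^esub>"
  using at[OF one_in_F one_in_F one_index one_index assms(1) assms(1) assms(1)]
  unfolding lla_at_def by (elim conjE)

lemma jac:
  assumes "x \<in> univ S" "y \<in> univ S" "z \<in> univ S"
  shows "(x \<otimes>\<^bsub>alg_of S\<^esub> (y \<otimes>\<^bsub>alg_of S\<^esub> z)) \<oplus>\<^bsub>alg_of S\<^esub> (y \<otimes>\<^bsub>alg_of S\<^esub> (z \<otimes>\<^bsub>alg_of S\<^esub> x)) \<oplus>\<^bsub>alg_of S\<^esub> (z \<otimes>\<^bsub>alg_of S\<^esub> (x \<otimes>\<^bsub>alg_of S\<^esub> y)) = \<zero>\<^bsub>alg_of S\<^esub>"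
  using at[OF one_in_F one_in_F one_index one_index assms(1) assms(2) assms(3)]
  unfolding lla_at_def by (elim conjE)

lemma P1:
  assumes "x \<in> univ S"
  shows "rel S (P 1) [x]"
  using at[OF one_in_F one_in_F one_index one_index assms(1) assms(1) assms(1)]
  unfolding lla_at_def by (elim conjE)

lemma Ptop:
  assumes "x \<in> univ S"
  shows "rel S (P (c + 1)) [x] \<longleftrightarrow> x = \<zero>\<^bsub>alg_of S\<^esub>"
  using at[OF one_in_F one_in_F one_index one_index assms(1) assms(1) assms(1)]
  unfolding lla_at_def by (elim conjE)

lemma Pzero:
  assumes "i \<in> {1..c + 1}"
  shows "rel S (P i) [\<zero>\<^bsub>alg_of S\<^esub>]"
proof -
  note zero_in = lla_closed(5)[OF S]
  show ?thesis
    using at[OF one_in_F one_in_F assms one_index zero_in zero_in zero_in]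
  unfolding lla_at_def by (elim conjE)
qed

lemma Padd:
  assumes "i \<in> {1..c + 1}" "x \<in> univ S" "y \<in> univ S" "rel S (P i) [x]" "rel S (P i) [y]"
  shows "rel S (P i) [x \<oplus>\<^bsub>alg_of S\<^esub> y]"
  using at[OF one_in_F one_in_F assms(1) one_index assms(2) assms(3) assms(2)] assms(4-)
  unfolding lla_at_def
  by - (elim conjE, rule mp, rule mp, assumption+)

lemma Psmult:
  assumes "i \<in> {1..c + 1}" "a \<in> carrier F" "x \<in> univ S" "rel S (P i) [x]"
  shows "rel S (P i) [a \<odot>\<^bsub>alg_of S\<^esub> x]"
  using at[OF assms(2) one_in_F assms(1) one_index assms(3) assms(3) assms(3)] assms(4-)
  unfolding lla_at_def
  by - (elim conjE, rule mp, assumption+)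

lemma Pminus:
  assumes "i \<in> {1..c + 1}" "x \<in> univ S" "rel S (P i) [x]"
  shows "rel S (P i) [fn S Minus [x]]"
  using at[OF one_in_F one_in_F assms(1) one_index assms(2) assms(2) assms(2)] assms(3-)
  unfolding lla_at_def
  by - (elim conjE, rule mp, assumption+)

lemma Pmono:
  assumes "i \<in> {1..c}" "x \<in> univ S" "rel S (P (i + 1)) [x]"
  shows "rel S (P i) [x]"
proof -
  have "i \<in> {1..c + 1}" using assms(1) by simp
  from at[OF one_in_F one_in_F this one_index assms(2) assms(2) assms(2)] show ?thesis
    using assms(1,3) unfolding lla_at_def by simp
qed

lemma Pbr:
  assumes "i \<in> {1..c + 1}" "j \<in> {1..c + 1}" "x \<in> univ S" "y \<in> univ S" "i + j \<le> c + 1" "rel S (P i) [x]" "rel S (P j) [y]"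
  shows "rel S (P (i + j)) [x \<otimes>\<^bsub>alg_of S\<^esub> y]"
  using at[OF one_in_F one_in_F assms(1) assms(2) assms(3) assms(4) assms(3)] assms(5-)
  unfolding lla_at_def
  by - (elim conjE, rule mp, rule mp, rule mp, assumption+)

lemma Pbr0:
  assumes "i \<in> {1..c + 1}" "j \<in> {1..c + 1}" "x \<in> univ S" "y \<in> univ S" "\<not> i + j \<le> c + 1" "rel S (P i) [x]" "rel S (P j) [y]"
  shows "x \<otimes>\<^bsub>alg_of S\<^esub> y = \<zero>\<^bsub>alg_of S\<^esub>"
  using at[OF one_in_F one_in_F assms(1) assms(2) assms(3) assms(4) assms(3)] assms(5-)
  unfolding lla_at_def
  by - (elim conjE, rule mp, rule mp, rule mp, assumption+)

lemma is_lla: "is_lla F c S"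
proof -
  interpret F: field F by (rule F)
  have car: "carrier (alg_of S) = univ S" by (simp add: alg_of_simps)
  note closed = lla_closed[OF S, folded alg_of_simps(2-5)]
  have "\<exists>y\<in>univ S. y \<oplus>\<^bsub>alg_of S\<^esub> x = \<zero>\<^bsub>alg_of S\<^esub>" if "x \<in> univ S" for x
    using neg[OF that] closed(3)[OF that] by (rule bexI)
  then have ab: "abelian_group (alg_of S)"
  proof (intro abelian_groupI, unfold car)
    show "x \<oplus>\<^bsub>alg_of S\<^esub> y = y \<oplus>\<^bsub>alg_of S\<^esub> x" if "x \<in> univ S" "y \<in> univ S" for x y
      by (rule comm[OF that])
  qed (simp_all add: assoc zero closed)
  have mod: "module F (alg_of S)"
    by (rule moduleI[OF F.is_cring ab]) (simp_all add: car closed ldistr rdistr sassoc sone)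
  interpret module F "alg_of S" by (rule mod)
  have lie: "lie_algebra F (alg_of S)"
    by (intro lie_algebra.intro lie_algebra_axioms.intro mod F)
      (simp_all add: car closed bl br bsl bsr bself jac)
  have minus: "fn S Minus [x] = \<ominus>\<^bsub>alg_of S\<^esub> x" if "x \<in> univ S" for x
    using M.minus_equality[OF neg[OF that]] that closed(3)[OF that] by (simp add: car)
  have lay: "layer c S i = {x \<in> univ S. rel S (P i) [x]}" if "i \<le> c + 1" for i
    using that by (simp add: layer_def)
  have sub: "lie_subalgebra F (alg_of S) (layer c S i)" if i: "i \<in> {1..c + 1}" for i
  proof -
    have "x \<otimes>\<^bsub>alg_of S\<^esub> y \<in> layer c S i" if xy: "x \<in> layer c S i" "y \<in> layer c S i" for x y
    proof -
      have x: "x \<in> univ S" "rel S (P i) [x]" and y: "y \<in> univ S" "rel S (P i) [y]"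
        using xy lay[of i] i by auto
      have "rel S (P i) [x \<otimes>\<^bsub>alg_of S\<^esub> y]"
      \<comment> \<open>Since \<open>P 1\<close> is everything, \<open>[P i, P i]\<close> lies in
        \<open>[P i, P 1]\<close>, hence in \<open>P (i + 1)\<close> and in \<open>P i\<close>. For
        \<open>i = c + 1\<close> the bracket is zero instead.\<close>
      proof (cases "i + 1 \<le> c + 1")
        case True
        then have "rel S (P (i + 1)) [x \<otimes>\<^bsub>alg_of S\<^esub> y]"
          using Pbr[OF i _ x(1) y(1) True x(2) P1[OF y(1)]] by simp
        then show ?thesis using Pmono[of i] True i closed(2)[OF x(1) y(1)] by simp
      next
        case False
        then show ?thesis using Pbr0[OF i _ x(1) y(1) False x(2) P1[OF y(1)]] Pzero[OF i] by simp
      qed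
      then show ?thesis using closed(2)[OF x(1) y(1)] i by (simp add: lay)
    qed
    moreover have "submodule (layer c S i) F (alg_of S)"
      by (rule submoduleI)
        (use i in \<open>auto simp: lay car closed minus[symmetric] intro: Pzero Padd Psmult Pminus\<close>)
    ultimately show ?thesis by (simp add: lie_subalgebra_def)
  qed
  have "x \<otimes>\<^bsub>alg_of S\<^esub> y \<in> layer c S (i + j)"
    if i: "i \<in> {1..c + 1}" and j: "j \<in> {1..c + 1}" and xy: "x \<in> layer c S i" "y \<in> layer c S j"
    for i j x y
  proof -
    have x: "x \<in> univ S" "rel S (P i) [x]" and y: "y \<in> univ S" "rel S (P j) [y]"
      using xy lay[of i] lay[of j] i j by auto
    show ?thesis
    proof (cases "i + j \<le> c + 1")
      case True
      then show ?thesis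
        using Pbr[OF i j x(1) y(1) True x(2) y(2)] closed(2)[OF x(1) y(1)] by (simp add: lay)
    next
      case False
      then show ?thesis
        using Pbr0[OF i j x(1) y(1) False x(2) y(2)] by (simp add: layer_def alg_of_simps)
    qed
  qed
  moreover have "layer c S 1 = univ S" using P1 by (auto simp: lay)
  moreover have "layer c S (c + 1) = {\<zero>\<^bsub>alg_of S\<^esub>}" 
    using closed(5) by (auto simp: lay Ptop[simplified])
  moreover have "layer c S (i + 1) \<subseteq> layer c S i" if i: "i \<in> {1..c}" for i
  proof
    fix x
    assume "x \<in> layer c S (i + 1)"
    then have "x \<in> univ S" "rel S (P (i + 1)) [x]" using i by (simp_all add: lay)
    then show "x \<in> layer c S i" using Pmono[OF i, of x] i by (simp add: lay)
  qed
  ultimately show ?thesis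
    unfolding is_lla_def using S lie minus sub by (intro conjI ballI)
qed

end

text \<open>Each instance of an axiom concerns elements in the image of one embedded algebra; it
  holds there and is carried over by the embedding. The algebra may vary with the elements.\<close>

lemma is_lla_local:
  fixes S :: "('k lla_fun, lla_rel, 'a) interp"
  assumes F: "field F" and S: "is_structure (lla_lang F c) S"
    and loc: "\<And>x y z. x \<in> univ S \<Longrightarrow> y \<in> univ S \<Longrightarrow> z \<in> univ S \<Longrightarrow>
      \<exists>(A :: ('k lla_fun, lla_rel, 'b) interp) h. is_lla F c A \<and> embedding (lla_lang F c) A S h \<and>
        {x, y, z} \<subseteq> h ` univ A"
  shows "is_lla F c S"
proof -
  have "lla_at F c S a b i j x y z"
    if ab: "a \<in> carrier F" "b \<in> carrier F" and ij: "i \<in> {1..c + 1}" "j \<in> {1..c + 1}"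
      and xyz: "x \<in> univ S" "y \<in> univ S" "z \<in> univ S" for a b i j x y z
  proof -
    obtain A :: "('k lla_fun, lla_rel, 'b) interp" and h where
      A: "is_lla F c A" "embedding (lla_lang F c) A S h" and "{x, y, z} \<subseteq> h ` univ A"
      using loc[OF xyz] by blast
    then have "x \<in> h ` univ A" "y \<in> h ` univ A" "z \<in> h ` univ A" by simp_all
    then obtain x' y' z' where x': "x = h x'" "y = h y'" "z = h z'" "x' \<in> univ A" "y' \<in> univ A" "z' \<in> univ A"
      by (elim imageE)
    have "is_structure (lla_lang F c) A" using A(1) by (simp add: is_lla_def)
    then show ?thesis
      using lla_at_embedding[OF _ F A(2) ab ij x'(4-6)] is_lla_imp_lla_at[OF A(1) ab ij x'(4-6)] x'(1-3)
      by simp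
  qed
  then interpret pointwise_lla F c S
    by (rule pointwise_lla.intro[OF F S])
  show ?thesis by (rule is_lla)
qed

lemma is_lla_relabel:
  fixes A :: "('k lla_fun, lla_rel, 'a) interp"
  assumes F: "field F" and A: "is_lla F c A" and g: "inj_on g (univ A)"
  shows "is_lla F c (relabel A g)"
proof (rule is_lla_local[OF F])
  have str: "is_structure (lla_lang F c) A" using A by (simp add: is_lla_def)
  then show "is_structure (lla_lang F c) (relabel A g)" by (rule is_structure_relabel)
  show "\<exists>(B :: ('k lla_fun, lla_rel, 'a) interp) h. is_lla F c B \<and> embedding (lla_lang F c) B (relabel A g) h \<and> {x, y, z} \<subseteq> h ` univ B"
    if "x \<in> univ (relabel A g)" "y \<in> univ (relabel A g)" "z \<in> univ (relabel A g)" for x y z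
    using A embedding_relabel(1)[OF str g] that by (intro exI[of _ A] exI[of _ g]) (simp add: relabel_def)
qed

section \<open>The limit as a Lazard Lie algebra, and the finite algebras inside it\<close>

lemma embedding_comp:
  assumes A: "is_structure L A" and g: "embedding L A B g" and h: "embedding L B C h"
  shows "embedding L A C (\<lambda>x. h (g x))"
  unfolding embedding_def
proof (intro conjI allI impI)
  have gA: "g ` univ A \<subseteq> univ B" and hB: "h ` univ B \<subseteq> univ C"
    and inj: "inj_on g (univ A)" "inj_on h (univ B)"
    using g h by (simp_all add: embedding_def)
  then show "(\<lambda>x. h (g x)) ` univ A \<subseteq> univ C" by blast
  show "inj_on (\<lambda>x. h (g x)) (univ A)"
    using inj gA by (auto simp: inj_on_def image_subset_iff)
  have g_set: "set (map g xs) \<subseteq> univ B" if "set xs \<subseteq> univ A" for xs using that gA by auto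
  fix xs n
  {
    fix f
    assume *: "fun_arity L f = Some n \<and> length xs = n \<and> set xs \<subseteq> univ A"
    then have "h (g (fn A f xs)) = h (fn B f (map g xs))"
      using embedding_fn[OF g, of f xs] by simp
    also have "\<dots> = fn C f (map h (map g xs))"
      by (rule embedding_fn[OF h _ g_set]) (use * in simp_all)
    finally show "h (g (fn A f xs)) = fn C f (map (\<lambda>x. h (g x)) xs)"
      by (simp add: comp_def)
  next
    fix r
    assume *: "rel_arity L r = Some n \<and> length xs = n \<and> set xs \<subseteq> univ A"
    then have "rel A r xs = rel B r (map g xs)"
      using embedding_rel[OF g, of r xs] by simp
    also have "\<dots> = rel C r (map h (map g xs))"
      by (rule embedding_rel[OF h _ g_set]) (use * in simp_all)
    finally show "rel A r xs = rel C r (map (\<lambda>x. h (g x)) xs)"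
      by (simp add: comp_def)
  }
qed

lemma finitely_generated_finite:
  assumes "finite (univ S)"
  shows "finitely_generated L S"
  unfolding finitely_generated_def
  by (rule exI[of _ "univ S"]) (use assms in \<open>auto simp: is_substructure_def\<close>)

text \<open>The class is prescribed only for the finitely generated substructures of the limit.
  Three elements generate such a substructure, and its copy on natural numbers lies in the age, so
  the local criterion applies.\<close>

lemma is_lla_limit:
  fixes M :: "('k lla_fun, lla_rel, 'a) interp"
  assumes F: "field F" and M: "fraisse_limit (lla_lang F c) (fg_llas F c) M"
  shows "is_lla F c M"
proof -
  have str: "is_structure (lla_lang F c) M" and cnt: "countable (univ M)"
    and age: "age (lla_lang F c) M = fg_llas F c"
    using M by (simp_all add: fraisse_limit_def)
  show ?thesis
  proof (rule is_lla_local[OF F str])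
    fix x y z
    assume xyz: "x \<in> univ M" "y \<in> univ M" "z \<in> univ M"
    \<comment> \<open>Variables \<open>0\<close>, \<open>1\<close>, \<open>2\<close> receive
      \<open>x\<close>, \<open>y\<close>, \<open>z\<close>; all later ones are sent to
      \<open>z\<close> only to stay in the universe.\<close>
    let ?v = "((\<lambda>_. z)(0 := x, 1 := y)) :: nat \<Rightarrow> _"
    let ?B = "generated (lla_lang F c) M ?v {0, 1, 2}"
    let ?A = "relabel (restrict_to M ?B) (to_nat_on ?B)"
    have v: "range ?v \<subseteq> univ M" using xyz by auto
    have B: "is_substructure (lla_lang F c) M ?B" by (rule is_substructure_generated[OF str v]) simp
    have cB: "countable ?B"
      using B cnt by (meson countable_subset is_substructure_def)
    have fg: "finitely_generated (lla_lang F c) (restrict_to M ?B)"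
      by (rule finitely_generated_generated) simp
    have "?A \<in> fg_llas F c" using relabel_substructure_in_age(1)[OF B fg cB] age by simp
    moreover have "inv_into ?B (to_nat_on ?B) ` univ ?A = ?B"
      using inj_on_to_nat_on[OF cB] by (simp add: relabel_def image_image)
    moreover have "{x, y, z} \<subseteq> ?B"
      using generator_in_generated[of 0 "{0, 1, 2}" ?v "lla_lang F c" M]
        generator_in_generated[of 1 "{0, 1, 2}" ?v "lla_lang F c" M]
        generator_in_generated[of 2 "{0, 1, 2}" ?v "lla_lang F c" M] by simp
    ultimately show "\<exists>(A :: ('k lla_fun, lla_rel, nat) interp) h. is_lla F c A \<and>
        embedding (lla_lang F c) A M h \<and> {x, y, z} \<subseteq> h ` univ A"
      using relabel_substructure_in_age(2)[OF B fg cB]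
      by (intro exI[of _ ?A] exI[of _ "inv_into ?B (to_nat_on ?B)"]) (simp add: fg_llas_def)
  qed
qed

text \<open>A finite algebra is finitely generated, so its copy on natural numbers lies in the
  class, and the class is the age of the limit.\<close>

lemma finite_lla_embeds_in_limit:
  fixes A :: "('k lla_fun, lla_rel, 'b) interp"
  assumes F: "field F" and M: "fraisse_limit (lla_lang F c) (fg_llas F c) M"
    and A: "is_lla F c A" and fin: "finite (univ A)"
  shows "\<exists>h. embedding (lla_lang F c) A M h"
proof -
  let ?g = "to_nat_on (univ A)"
  have g: "inj_on ?g (univ A)" by (rule inj_on_to_nat_on[OF countable_finite[OF fin]])
  have str: "is_structure (lla_lang F c) A" using A by (simp add: is_lla_def)
  have "relabel A ?g \<in> fg_llas F c"
    using is_lla_relabel[OF F A g] finitely_generated_relabel[OF str g finitely_generated_finite[OF fin]]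
    by (simp add: fg_llas_def)
  then have "relabel A ?g \<in> age (lla_lang F c) M" using M by (simp add: fraisse_limit_def)
  then obtain h where "embedding (lla_lang F c) (relabel A ?g) M h" by (auto simp: age_def)
  then show ?thesis using embedding_comp[OF str embedding_relabel(1)[OF str g]] by blast
qed

section \<open>Counting zero patterns on grids\<close>

definition grid :: "nat \<Rightarrow> nat \<Rightarrow> nat list set" where
  "grid k n = {is. set is \<subseteq> {..<n} \<and> length is = k}"

definition del :: "nat \<Rightarrow> 'a list \<Rightarrow> 'a list" where
  "del j xs = take j xs @ drop (Suc j) xs"

lemma finite_grid [simp]: "finite (grid k n)"
  unfolding grid_def by (rule finite_lists_length_eq) simp

lemma card_grid [simp]: "card (grid k n) = n ^ k"
  unfolding grid_def by (simp add: card_lists_length_eq)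

lemma del_in_grid: "j < k \<Longrightarrow> xs \<in> grid k n \<Longrightarrow> del j xs \<in> grid (k - 1) n"
  by (auto simp: grid_def del_def dest: in_set_takeD in_set_dropD)

lemma del_eq_nth:
  assumes "del j xs = del j ys" "length xs = length ys" "l < length xs" "l \<noteq> j"
  shows "xs ! l = ys ! l"
proof (cases "j < length xs")
  case True
  then have *: "take j xs = take j ys" "drop (Suc j) xs = drop (Suc j) ys"
    using assms(1,2) by (simp_all add: del_def append_eq_append_conv)
  show ?thesis
  proof (cases "l < j")
    case True
    then show ?thesis using arg_cong[OF *(1), of "\<lambda>zs. zs ! l"] by simp
  next
    case False
    then have "l = Suc j + (l - Suc j)" using assms(4) by simp
    then show ?thesis
      using arg_cong[OF *(2), of "\<lambda>zs. zs ! (l - Suc j)"] True assms(2)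
      by (metis Suc_leI nth_drop)
  qed
next
  case False
  then show ?thesis using assms(1,2) by (simp add: del_def)
qed

text \<open>A subset with at most \<open>m\<close> elements is listed by a word of length
  \<open>m\<close> over \<open>I\<close> and one padding symbol \<open>None\<close>.\<close>

lemma card_bounded_subsets:
  assumes I: "finite I"
  shows "card {S. S \<subseteq> I \<and> card S \<le> m} \<le> (card I + 1) ^ m"
proof -
  let ?A = "insert None (Some ` I)"
  let ?L = "{xs. set xs \<subseteq> ?A \<and> length xs = m}"
  have "{S. S \<subseteq> I \<and> card S \<le> m} \<subseteq> (\<lambda>xs. {i. Some i \<in> set xs}) ` ?L"
  proof
    fix S
    assume "S \<in> {S. S \<subseteq> I \<and> card S \<le> m}"
    then have S: "S \<subseteq> I" "card S \<le> m" by auto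
    then obtain xs where xs: "set xs = S" "length xs = card S"
      using I by (metis finite_distinct_list distinct_card finite_subset)
    let ?ys = "map Some xs @ replicate (m - card S) None"
    have "S = {i. Some i \<in> set ?ys}" using xs by auto
    moreover have "?ys \<in> ?L" using xs S by auto
    ultimately show "S \<in> (\<lambda>xs. {i. Some i \<in> set xs}) ` ?L" by blast
  qed
  moreover have "finite ?L" by (rule finite_lists_length_eq) (simp add: I)
  ultimately have "card {S. S \<subseteq> I \<and> card S \<le> m} \<le> card ?L"
    by (meson card_image_le card_mono finite_imageI le_trans)
  also have "card ?L = card ?A ^ m" by (rule card_lists_length_eq) (simp add: I)
  also have "card ?A = card I + 1" using I by (simp add: card_image)
  finally show ?thesis by simp
qed

text \<open>Used for grids of side \<open>2^q\<close>: \<open>R\<close> will be the number of atomic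
  conditions, the left side the exponent of two that bounds the combinations of their patterns, and
  the right side the number of grid points.\<close>

lemma exponential_dominates:
  assumes k: "1 \<le> k"
  shows "\<exists>q. R * ((q * k + 1)\<^sup>2 * k * (2 ^ q) ^ (k - 1)) < (2 ^ q :: nat) ^ k"
proof -
  \<comment> \<open>With \<open>q = 3p\<close> the factor \<open>(qk + 1)^2\<close> is at most
    \<open>(3k + 1)^2 (p + 1)^2\<close>; this \<open>p\<close> then bounds the whole factor by
    \<open>p (p + 1)^2 < (p + 1)^3 <= 2^(3p)\<close>.\<close>
  define p where "p = R * k * (3 * k + 1)\<^sup>2"
  define q where "q = 3 * p"
  have "q * k + 1 \<le> (3 * k + 1) * (p + 1)"
    by (simp add: q_def algebra_simps)
  then have "(q * k + 1)\<^sup>2 \<le> (3 * k + 1)\<^sup>2 * (p + 1)\<^sup>2"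
    by (metis power_mono power_mult_distrib zero_le)
  then have "R * k * (q * k + 1)\<^sup>2 \<le> R * k * ((3 * k + 1)\<^sup>2 * (p + 1)\<^sup>2)"
    by (rule mult_le_mono2)
  also have "\<dots> = p * (p + 1)\<^sup>2" by (simp add: p_def)
  also have "\<dots> < (p + 1) * (p + 1)\<^sup>2" by simp
  also have "\<dots> = (p + 1) ^ 3" by (simp add: power2_eq_square power3_eq_cube)
  also have "\<dots> \<le> (2 ^ p) ^ 3"
    by (intro power_mono) (use less_exp[of p] in \<open>auto simp: Suc_le_eq\<close>)
  also have "\<dots> = 2 ^ q" by (simp add: q_def power_mult[symmetric] mult.commute)
  finally have "R * k * (q * k + 1)\<^sup>2 < 2 ^ q" .
  then have "R * k * (q * k + 1)\<^sup>2 * (2 ^ q) ^ (k - 1) < 2 ^ q * (2 ^ q) ^ (k - 1)" by simp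
  also have "\<dots> = (2 ^ q) ^ k" using k by (metis Suc_diff_1 less_eq_Suc_le One_nat_def power_Suc)
  finally show ?thesis by (intro exI[of _ q]) (simp add: ac_simps)
qed

section \<open>Sums of functions that forget one coordinate\<close>

context abelian_group
begin

text \<open>A cylinder function: on \<open>I\<close> it is a finite sum of functions, each constant
  along the fibres of some \<open>del j\<close>. Values are compared only on \<open>I\<close>, so
  the behaviour elsewhere is arbitrary; the inductive form lets additive properties be proved
  summand by summand.\<close>

inductive cyl :: "nat \<Rightarrow> nat list set \<Rightarrow> (nat list \<Rightarrow> 'a) \<Rightarrow> bool" for k I where
  base: "\<lbrakk>j < k; \<And>i. i \<in> I \<Longrightarrow> f i \<in> carrier G;
      \<And>i i'. \<lbrakk>i \<in> I; i' \<in> I; del j i = del j i'\<rbrakk> \<Longrightarrow> f i = f i'\<rbrakk> \<Longrightarrow> cyl k I f"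
| plus: "\<lbrakk>cyl k I f; cyl k I g; \<And>i. i \<in> I \<Longrightarrow> h i = f i \<oplus> g i\<rbrakk> \<Longrightarrow> cyl k I h"

lemma cyl_closed: "cyl k I f \<Longrightarrow> i \<in> I \<Longrightarrow> f i \<in> carrier G"
proof (induction rule: cyl.induct)
  case (base j f)
  show ?case by (rule base.hyps(2)[OF base.prems])
next
  case (plus f g h)
  then show ?case by simp
qed

lemma cyl_zero:
  assumes "0 < k" "\<And>i. i \<in> I \<Longrightarrow> f i = \<zero>"
  shows "cyl k I f"
  by (rule base[OF assms(1)]) (simp_all add: assms(2))

lemma cyl_hom:
  assumes "cyl k I f"
    and "\<And>x. x \<in> carrier G \<Longrightarrow> \<phi> x \<in> carrier G"
    and "\<And>x y. \<lbrakk>x \<in> carrier G; y \<in> carrier G\<rbrakk> \<Longrightarrow> \<phi> (x \<oplus> y) = \<phi> x \<oplus> \<phi> y"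
  shows "cyl k I (\<lambda>i. \<phi> (f i))"
  using assms(1)
proof induction
  case (base j f)
  show ?case
  proof (rule cyl.base[OF base.hyps(1)])
    show "\<phi> (f i) = \<phi> (f i')" if "i \<in> I" "i' \<in> I" "del j i = del j i'" for i i'
      using base.hyps(3)[OF that] by simp
  qed (rule assms(2)[OF base.hyps(2)])
next
  case (plus f g h)
  show ?case
  proof (rule cyl.plus[OF plus.IH])
    show "\<phi> (h i) = \<phi> (f i) \<oplus> \<phi> (g i)" if i: "i \<in> I" for i
      using plus.hyps(3)[OF i] assms(3) cyl_closed[OF plus.hyps(1) i] cyl_closed[OF plus.hyps(2) i]
      by simp
  qed
qed

text \<open>The function factors through \<open>p\<close>, so equal fibre counts allow the terms of
  both sums to be matched: the induction removes a point of \<open>B\<close> together with a point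
  of \<open>B'\<close> in the same fibre.\<close>

lemma finsum_fibres_cong:
  assumes "finite B" "finite B'" "B \<subseteq> I" "B' \<subseteq> I"
    and f: "\<And>i. i \<in> I \<Longrightarrow> f i \<in> carrier G"
    and p: "\<And>i i'. \<lbrakk>i \<in> I; i' \<in> I; p i = p i'\<rbrakk> \<Longrightarrow> f i = f i'"
    and card: "\<And>r. card {s \<in> B. p s = r} = card {s \<in> B'. p s = r}"
  shows "finsum G f B = finsum G f B'"
  using assms(1-4) card
proof (induction B arbitrary: B' rule: finite_induct)
  case empty
  have "B' = {}"
  proof (rule ccontr)
    assume "B' \<noteq> {}"
    then obtain s where "s \<in> B'" by auto
    then have "card {t \<in> B'. p t = p s} \<noteq> 0" using empty(1) by auto
    then show False using empty(4)[of "p s"] by simp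
  qed
  then show ?case by simp
next
  case (insert s B)
  have fin: "finite {t \<in> insert s B. p t = p s}" using insert.hyps by simp
  have "s \<in> {t \<in> insert s B. p t = p s}" by simp
  then have "card {t \<in> insert s B. p t = p s} \<noteq> 0" using fin by (metis card_eq_0_iff empty_iff)
  then have "{t \<in> B'. p t = p s} \<noteq> {}" using insert.prems(4)[of "p s"] by (metis card.empty)
  then obtain s' where s': "s' \<in> B'" "p s' = p s" by auto
  have eqs: "finsum G f B = finsum G f (B' - {s'})"
  proof (rule insert.IH)
    fix r
    have 1: "{t \<in> insert s B. p t = r} = (if p s = r then insert s {t \<in> B. p t = r} else {t \<in> B. p t = r})"
      by auto
    have 2: "{t \<in> B'. p t = r} =
        (if p s = r then insert s' {t \<in> B' - {s'}. p t = r} else {t \<in> B' - {s'}. p t = r})"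
      using s' by auto
    show "card {t \<in> B. p t = r} = card {t \<in> B' - {s'}. p t = r}"
      using insert.prems(4)[of r] insert.hyps insert.prems(1) unfolding 1 2
      by (simp split: if_splits)
  qed (use insert.prems in auto)
  have "finsum G f (insert s B) = f s \<oplus> finsum G f B"
    by (rule finsum_insert) (use insert.hyps insert.prems f in auto)
  also have "\<dots> = f s' \<oplus> finsum G f (B' - {s'})"
    using eqs p[of s' s] s' insert.prems by auto
  also have "\<dots> = finsum G f (insert s' (B' - {s'}))"
    by (rule finsum_insert[symmetric]) (use insert.prems s' f in auto)
  also have "insert s' (B' - {s'}) = B'" using s' by auto
  finally show ?case .
qed

text \<open>By additivity it is enough to treat a function of a single projection
  \<open>del j\<close>, whose sums are determined by the fibre counts of that projection.\<close>

lemma cyl_finsum_cong: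
  assumes "cyl k I f" "finite B" "finite B'" "B \<subseteq> I" "B' \<subseteq> I"
    and card: "\<And>j r. j < k \<Longrightarrow> card {s \<in> B. del j s = r} = card {s \<in> B'. del j s = r}"
  shows "finsum G f B = finsum G f B'"
  using assms(1)
proof induction
  case (base j f)
  show ?case
    by (rule finsum_fibres_cong[OF assms(2-5) base.hyps(2,3) card[OF base.hyps(1)]])
next
  case (plus f g h)
  have "finsum G h C = finsum G f C \<oplus> finsum G g C" if C: "C \<subseteq> I" for C
  proof -
    have closed: "f \<in> C \<rightarrow> carrier G" "g \<in> C \<rightarrow> carrier G" using plus.hyps(1,2) C cyl_closed by blast+
    have "finsum G h C = finsum G (\<lambda>i. f i \<oplus> g i) C"
      by (rule finsum_cong') (use plus.hyps(3) C closed in auto)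
    then show ?thesis using finsum_addf[OF closed] by simp
  qed
  then show ?case using plus.IH assms(4,5) by simp
qed

text \<open>Different subsets of \<open>S\<close> give different fibre counts, because \<open>cyl\<close> functions separate the
  corresponding sums.\<close>

lemma independent_card_bound:
  assumes I: "finite I" and Q: "subgroup Q (add_monoid G)" and S: "S \<subseteq> I"
    and ind: "\<And>t. t \<in> S \<Longrightarrow> \<exists>d. cyl k I d \<and> (\<forall>s\<in>S - {t}. d s \<in> Q) \<and> d t \<notin> Q"
  shows "2 ^ card S \<le> (card I + 1) ^ card (SIGMA j:{..<k}. del j ` I)"
proof -
  let ?C = "SIGMA j:{..<k}. del j ` I"
  \<comment> \<open>\<open>cnt B\<close> counts the points of \<open>B\<close> on every line of
    \<open>I\<close> parallel to an axis; restricting it to the pairs in \<open>?C\<close> makes it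
    a member of a finite function space.\<close>
  define cnt where "cnt B = restrict (\<lambda>(j, r). card {s \<in> B. del j s = r}) ?C" for B :: "nat list set"
  have finS: "finite S" using I S finite_subset by blast
  have finsum_Q: "finsum G d B \<in> Q" if "finite B" "\<forall>s\<in>B. d s \<in> Q" for d :: "nat list \<Rightarrow> 'a" and B
    using that
  proof (induction B rule: finite_induct)
    case empty
    then show ?case using subgroup.one_closed[OF Q] by simp
  next
    case (insert s B)
    moreover have "Q \<subseteq> carrier G" using subgroup.subset[OF Q] by simp
    ultimately show ?case using subgroup.m_closed[OF Q] by (subst finsum_insert) auto
  qed
  \<comment> \<open>A point \<open>t\<close> of \<open>B\<close> outside \<open>B'\<close> would
    have a separating \<open>d\<close>. Equal counts force equal sums of \<open>d\<close> over
    \<open>B\<close> and \<open>B'\<close>; all terms except \<open>d t\<close> lie in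
    \<open>Q\<close>, so \<open>d t\<close> would lie there too.\<close>
  have sub: "B \<subseteq> B'" if B: "B \<subseteq> S" "B' \<subseteq> S" and eq: "cnt B = cnt B'" for B B'
  proof (rule ccontr)
    assume "\<not> B \<subseteq> B'"
    then obtain t where t: "t \<in> B" "t \<notin> B'" by auto
    then obtain d where d: "cyl k I d" "\<forall>s\<in>S - {t}. d s \<in> Q" "d t \<notin> Q"
      using ind B by blast
    have fin: "finite B" "finite B'" using B finS finite_subset by blast+
    have BI: "B \<subseteq> I" "B' \<subseteq> I" using B S by auto
    have "card {s \<in> B. del j s = r} = card {s \<in> B'. del j s = r}" if j: "j < k" for j r
    proof (cases "r \<in> del j ` I")
      case True
      then show ?thesis using fun_cong[OF eq, of "(j, r)"] j by (simp add: cnt_def)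
    next
      case False
      then have "{s \<in> B. del j s = r} = {}" "{s \<in> B'. del j s = r} = {}" using BI by auto
      then show ?thesis by (simp only:)
    qed
    then have eqs: "finsum G d B = finsum G d B'"
      by (rule cyl_finsum_cong[OF d(1) fin BI])
    have dt: "d t \<in> carrier G" using d(1) cyl_closed t BI by blast
    have rest: "finsum G d (B - {t}) \<in> Q"
      by (rule finsum_Q) (use fin d(2) B in auto)
    then have restc: "finsum G d (B - {t}) \<in> carrier G" using subgroup.subset[OF Q] by auto
    have "finsum G d (insert t (B - {t})) = d t \<oplus> finsum G d (B - {t})"
      by (rule finsum_insert) (use fin d(1) BI cyl_closed dt in auto)
    then have "d t \<oplus> finsum G d (B - {t}) = finsum G d B'"
      using t eqs by (simp add: insert_absorb)
    moreover have "finsum G d B' \<in> Q"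
      by (rule finsum_Q) (use fin d(2) B t in auto)
    ultimately have "(d t \<oplus> finsum G d (B - {t})) \<oplus> \<ominus> finsum G d (B - {t}) \<in> Q"
      using subgroup.m_closed[OF Q] subgroup.m_inv_closed[OF Q] rest by (simp add: a_inv_def)
    then show False using d(3) dt restc by (simp add: a_assoc r_neg)
  qed
  have inj: "inj_on cnt (Pow S)"
  proof (rule inj_onI)
    fix B B'
    assume "B \<in> Pow S" "B' \<in> Pow S" "cnt B = cnt B'"
    then show "B = B'" using sub[of B B'] sub[of B' B] by auto
  qed
  have "card {s \<in> B. del j s = r} \<le> card I" if "B \<subseteq> S" for B and j :: nat and r
    using that S I by (intro card_mono) auto
  then have "cnt B \<in> ?C \<rightarrow>\<^sub>E {..card I}" if "B \<subseteq> S" for B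
    using that by (auto simp: cnt_def)
  then have "cnt ` Pow S \<subseteq> ?C \<rightarrow>\<^sub>E {..card I}" by auto
  moreover have "finite (?C \<rightarrow>\<^sub>E {..card I})" using I by (intro finite_PiE) auto
  ultimately have "card (Pow S) \<le> card (?C \<rightarrow>\<^sub>E {..card I})"
    using inj by (metis card_image card_mono)
  then show ?thesis using finS I by (simp add: card_Pow card_funcsetE)
qed

text \<open>A spanning subset of least cardinality works. Without \<open>t\<close> it no longer
  spans, so some \<open>d\<close> lies in \<open>Q\<close> on the rest but fails at a point of
  \<open>S\<close>; since the full subset spans, \<open>d\<close> must already fail at
  \<open>t\<close>.\<close>

lemma exists_base:
  assumes S: "finite S"
  obtains S0 where "S0 \<subseteq> S"
    "\<And>d. cyl k I d \<Longrightarrow> \<forall>t\<in>S0. d t \<in> Q \<Longrightarrow> \<forall>t\<in>S. d t \<in> Q"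
    "\<And>t. t \<in> S0 \<Longrightarrow> \<exists>d. cyl k I d \<and> (\<forall>s\<in>S0 - {t}. d s \<in> Q) \<and> d t \<notin> Q"
proof -
  define spans where "spans S0 \<longleftrightarrow> S0 \<subseteq> S \<and> (\<forall>d. cyl k I d \<longrightarrow> (\<forall>t\<in>S0. d t \<in> Q) \<longrightarrow> (\<forall>t\<in>S. d t \<in> Q))"
    for S0
  have "spans S" by (auto simp: spans_def)
  then obtain S0 where S0: "spans S0" and min: "\<And>S1. spans S1 \<Longrightarrow> card S0 \<le> card S1"
    using ex_has_least_nat[of spans S card] by blast
  have fin: "finite S0" using S0 S finite_subset by (auto simp: spans_def)
  show ?thesis
  proof (rule that)
    fix t
    assume t: "t \<in> S0"
    then have "card (S0 - {t}) < card S0" using fin by (rule card_Diff1_less[rotated])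
    then have "\<not> spans (S0 - {t})" using min leD by blast
    then obtain d s where d: "cyl k I d" "\<forall>s\<in>S0 - {t}. d s \<in> Q" "s \<in> S" "d s \<notin> Q"
      using S0 by (auto simp: spans_def)
    then have "d t \<notin> Q" using S0 by (auto simp: spans_def)
    then show "\<exists>d. cyl k I d \<and> (\<forall>s\<in>S0 - {t}. d s \<in> Q) \<and> d t \<notin> Q" using d by blast
  qed (use S0 in \<open>auto simp: spans_def\<close>)
qed

text \<open>Every pattern is recovered from a base of it, so it suffices to count the possible
  bases, which are small subsets of the grid. The side \<open>2^q\<close> turns all bounds into
  powers of two that are compared by their exponents.\<close>

lemma zero_pattern_bound:
  assumes k: "1 \<le> k" and Q: "subgroup Q (add_monoid G)"
    and E: "\<And>e i. e \<in> E \<Longrightarrow> i \<in> grid k (2 ^ q) \<Longrightarrow> e i \<in> carrier G"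
    and diff: "\<And>e e'. \<lbrakk>e \<in> E; e' \<in> E\<rbrakk> \<Longrightarrow> cyl k (grid k (2 ^ q)) (\<lambda>i. e i \<ominus> e' i)"
  shows "card ((\<lambda>e. {i \<in> grid k (2 ^ q). e i \<in> Q}) ` E) \<le> 2 ^ ((q * k + 1)\<^sup>2 * k * (2 ^ q) ^ (k - 1))"
proof -
  let ?I = "grid k (2 ^ q)"
  define pat where "pat e = {i \<in> ?I. e i \<in> Q}" for e
  define is_base where "is_base S S0 \<longleftrightarrow> S0 \<subseteq> S \<and>
     (\<forall>d. cyl k ?I d \<longrightarrow> (\<forall>t\<in>S0. d t \<in> Q) \<longrightarrow> (\<forall>t\<in>S. d t \<in> Q)) \<and>
     (\<forall>t\<in>S0. \<exists>d. cyl k ?I d \<and> (\<forall>s\<in>S0 - {t}. d s \<in> Q) \<and> d t \<notin> Q)" for S S0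
  define base_of where "base_of S = (SOME S0. is_base S S0)" for S
  have base_of: "is_base S (base_of S)" if "S \<subseteq> ?I" for S
  proof -
    have "finite S" by (rule finite_subset[OF that]) simp
    then obtain S0 where "is_base S S0"
      unfolding is_base_def by (rule exists_base[of S k ?I Q]) blast
    then show ?thesis unfolding base_of_def by (rule someI)
  qed
  \<comment> \<open>The base-two logarithm of the bound for independent sets: there are at most
    \<open>k (2^q)^(k-1)\<close> lines, and each has at most \<open>card ?I + 1 <= 2^(qk+1)\<close>
    possible counts.\<close>
  let ?m = "(q * k + 1) * (k * (2 ^ q) ^ (k - 1))"
  have I_le: "card ?I + 1 \<le> 2 ^ (q * k + 1)"
    by (simp add: power_mult[symmetric])
  have "card (SIGMA j:{..<k}. del j ` ?I) = (\<Sum>j<k. card (del j ` ?I))"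
    by (rule card_SigmaI) auto
  also have "\<dots> \<le> (\<Sum>j<k. card (grid (k - 1) (2 ^ q)))"
    by (intro sum_mono card_mono image_subsetI finite_grid del_in_grid) simp_all
  finally have C_le: "card (SIGMA j:{..<k}. del j ` ?I) \<le> k * (2 ^ q) ^ (k - 1)"
    by (simp only: card_grid sum_constant card_lessThan of_nat_id)
  have card_base: "card (base_of S) \<le> ?m" if S: "S \<subseteq> ?I" for S
  proof -
    have "2 ^ card (base_of S) \<le> (card ?I + 1) ^ card (SIGMA j:{..<k}. del j ` ?I)"
      by (rule independent_card_bound[OF _ Q])
        (use base_of[OF S] S in \<open>auto simp: is_base_def\<close>)
    also have "\<dots> \<le> (card ?I + 1) ^ (k * (2 ^ q) ^ (k - 1))"
      using C_le by (intro power_increasing) auto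
    also have "\<dots> \<le> (2 ^ (q * k + 1)) ^ (k * (2 ^ q) ^ (k - 1))"
      using I_le by (intro power_mono) auto
    also have "\<dots> = 2 ^ ?m" by (simp only: power_mult)
    finally show ?thesis by simp
  qed
  \<comment> \<open>Only the difference is a cylinder function, not \<open>e\<close> itself. It lies
    in \<open>Q\<close> on the common base, hence on all of \<open>pat e\<close>, where subtracting
    it from \<open>e\<close> shows that \<open>e'\<close> takes values in \<open>Q\<close>.\<close>
  have sub: "pat e \<subseteq> pat e'" if e: "e \<in> E" "e' \<in> E" and eq: "base_of (pat e) = base_of (pat e')" for e e'
  proof -
    let ?d = "\<lambda>i. e i \<ominus> e' i"
    have pI: "pat e \<subseteq> ?I" "pat e' \<subseteq> ?I" by (auto simp: pat_def)
    have diffQ: "x \<ominus> y \<in> Q" if "x \<in> Q" "y \<in> Q" for x y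
      using that subgroup.m_closed[OF Q] subgroup.m_inv_closed[OF Q] by (simp add: a_inv_def minus_eq)
    have base_sub: "base_of (pat e) \<subseteq> pat e" "base_of (pat e) \<subseteq> pat e'"
      using base_of[OF pI(1)] base_of[OF pI(2)] eq unfolding is_base_def by simp_all
    have "\<forall>t\<in>base_of (pat e). ?d t \<in> Q"
    proof
      fix t
      assume "t \<in> base_of (pat e)"
      then have "t \<in> pat e" "t \<in> pat e'" using base_sub by auto
      then show "?d t \<in> Q" unfolding pat_def by (intro diffQ) simp_all
    qed
    moreover have "\<forall>d. cyl k ?I d \<longrightarrow> (\<forall>t\<in>base_of (pat e). d t \<in> Q) \<longrightarrow> (\<forall>t\<in>pat e. d t \<in> Q)"
      using base_of[OF pI(1)] unfolding is_base_def by (elim conjE)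
    ultimately have d: "\<forall>t\<in>pat e. ?d t \<in> Q"
      using diff[OF e] by (elim allE[of _ ?d]) (rule mp[OF mp])
    show ?thesis
    proof
      fix t
      assume t: "t \<in> pat e"
      then have "t \<in> ?I" "e t \<in> Q" by (auto simp: pat_def)
      moreover have "e t \<ominus> ?d t = e' t"
        using E[OF e(1) \<open>t \<in> ?I\<close>] E[OF e(2) \<open>t \<in> ?I\<close>]
        by (simp add: minus_eq minus_add a_assoc[symmetric] r_neg)
      moreover have "?d t \<in> Q" using d t by (rule bspec)
      ultimately show "t \<in> pat e'"
        using diffQ[of "e t" "?d t"] by (simp add: pat_def del: minus_add)
    qed
  qed
  have inj: "inj_on base_of (pat ` E)"
  proof (rule inj_onI)
    fix S S'
    assume "S \<in> pat ` E" "S' \<in> pat ` E" "base_of S = base_of S'"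
    then obtain e e' where "e \<in> E" "e' \<in> E" "S = pat e" "S' = pat e'" "base_of (pat e) = base_of (pat e')"
      by blast
    then show "S = S'" using sub[of e e'] sub[of e' e] by simp
  qed
  have bases: "base_of ` pat ` E \<subseteq> {S. S \<subseteq> ?I \<and> card S \<le> ?m}"
  proof (intro image_subsetI CollectI conjI)
    fix S
    assume "S \<in> pat ` E"
    then have S: "S \<subseteq> ?I" by (auto simp: pat_def)
    show "base_of S \<subseteq> ?I" using base_of[OF S] S by (auto simp: is_base_def)
    show "card (base_of S) \<le> ?m" by (rule card_base[OF S])
  qed
  have "card (pat ` E) = card (base_of ` pat ` E)"
    by (rule card_image[OF inj, symmetric])
  also have "\<dots> \<le> card {S. S \<subseteq> ?I \<and> card S \<le> ?m}"
    by (rule card_mono[OF _ bases]) (rule finite_subset[of _ "Pow ?I"], auto)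
  also have "\<dots> \<le> (card ?I + 1) ^ ?m" by (rule card_bounded_subsets) simp
  also have "\<dots> \<le> (2 ^ (q * k + 1)) ^ ?m" using I_le by (intro power_mono) auto
  also have "\<dots> = 2 ^ ((q * k + 1) * ?m)" by (simp only: power_mult)
  \<comment> \<open>One factor \<open>q * k + 1\<close> comes from the size of a base, the other
    from the number of choices for each of its elements.\<close>
  also have "(q * k + 1) * ?m = (q * k + 1)\<^sup>2 * k * (2 ^ q) ^ (k - 1)"
    by (simp only: power2_eq_square mult.assoc)
  finally show ?thesis by (simp only: pat_def)
qed

end

section \<open>Shattering of finite grids\<close>

text \<open>Tuples are replaced by functions on variables: \<open>A\<close> holds the variables of
  \<open>x\<close>, and \<open>J z\<close> is the index of the parameter tuple containing
  \<open>z\<close>. Variables of one parameter tuple thus follow the same grid coordinate.\<close>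

definition shatters ::
    "('f, 'r, 'a) interp \<Rightarrow> ('f, 'r) fm \<Rightarrow> nat set \<Rightarrow> (nat \<Rightarrow> nat) \<Rightarrow> nat \<Rightarrow> nat \<Rightarrow> bool" where
  "shatters M \<phi> A J k n \<longleftrightarrow>
     (\<exists>a b. (\<forall>z m. a z m \<in> univ M) \<and> (\<forall>X z. b X z \<in> univ M) \<and>
        (\<forall>X\<subseteq>grid k n. \<forall>i\<in>grid k n.
           sat M (\<lambda>z. if z \<in> A then b X z else a z (i ! J z)) \<phi> \<longleftrightarrow> i \<in> X))"

lemma assign_in_set:
  assumes "z \<in> set vs" "length ws = length vs"
  shows "assign vs ws z \<in> set ws"
proof -
  obtain y where y: "map_of (zip vs ws) z = Some y"
    using assms map_of_zip_is_Some[of vs ws z] by auto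
  then have "y \<in> set ws" by (rule set_zip_rightD[OF map_of_SomeD])
  then show ?thesis using y by (simp add: assign_def)
qed

lemma assign_append:
  assumes "length ws = length vs"
  shows "assign (vs @ vs') (ws @ ws') z = (if z \<in> set vs then assign vs ws z else assign vs' ws' z)"
proof (cases "z \<in> set vs")
  case True
  then obtain y where "map_of (zip vs ws) z = Some y"
    using map_of_zip_is_None[OF assms[symmetric], of z] by blast
  then show ?thesis using True assms by (simp add: assign_def)
next
  case False
  then have "map_of (zip vs ws) z = None"
    using map_of_zip_is_None[OF assms[symmetric], of z] by blast
  then show ?thesis using False assms by (simp add: assign_def map_add_def del: map_of_zip_is_None)
qed

lemma assign_concat:
  "\<lbrakk>list_all2 (\<lambda>vs ws. length ws = length vs) vss wss; distinct (concat vss);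
    j < length vss; z \<in> set (vss ! j)\<rbrakk> \<Longrightarrow> assign (concat vss) (concat wss) z = assign (vss ! j) (wss ! j) z"
proof (induction vss wss arbitrary: j rule: list_all2_induct)
  case (Cons vs vss ws wss)
  show ?case
  proof (cases j)
    case 0
    then show ?thesis using Cons.hyps(1) Cons.prems(3) by (simp add: assign_append)
  next
    case (Suc l)
    then have "z \<in> set (concat vss)" using Cons.prems by auto
    then have "z \<notin> set vs" using Cons.prems(1) by auto
    then show ?thesis using Cons.hyps(1) Cons.IH[of l] Cons.prems Suc by (simp add: assign_append)
  qed
qed simp

text \<open>A subset of a finite grid is also a subset of the infinite one, so the same witnesses
  serve every \<open>n\<close>, with \<open>J\<close> independent of \<open>n\<close>.\<close>

lemma IP_shatters:
  fixes N :: "('f, 'r, 'a) interp"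
  assumes part: "partitioned_formula L \<phi> x ys" and IP: "has_IP_in N \<phi> x ys"
    and N: "is_structure L N" and k: "length ys = k" "0 < k"
  shows "\<exists>J. (\<forall>z. J z < k) \<and> (\<forall>n. shatters N \<phi> (set x) J k n)"
proof -
  \<comment> \<open>Variables outside all parameter tuples get index \<open>0\<close>, a legal
    coordinate since \<open>0 < k\<close>; likewise the element \<open>d\<close> below fills values
    that the formula never reads.\<close>
  define J where "J z = (if \<exists>j<k. z \<in> set (ys ! j) then SOME j. j < k \<and> z \<in> set (ys ! j) else 0)" for z
  have J: "J z < k \<and> z \<in> set (ys ! J z)" if z: "z \<in> set (concat ys)" for z
  proof -
    obtain vs where "vs \<in> set ys" "z \<in> set vs" using z by auto
    then have ex: "\<exists>j<k. z \<in> set (ys ! j)" using k(1) by (metis in_set_conv_nth)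
    then have "\<exists>j. j < k \<and> z \<in> set (ys ! j)" by blast
    from someI_ex[OF this] ex show ?thesis by (simp add: J_def)
  qed
  have Jk: "J z < k" for z
  proof (cases "\<exists>j<k. z \<in> set (ys ! j)")
    case True
    then have "\<exists>j. j < k \<and> z \<in> set (ys ! j)" by blast
    from someI_ex[OF this] True show ?thesis by (simp add: J_def)
  next
    case False
    then have "J z = 0" unfolding J_def by (rule if_not_P)
    then show ?thesis using k by simp
  qed
  let ?W = "{is :: nat list. length is = k}"
  obtain a b where
    a0: "\<forall>j<k. \<forall>i. length (a j i) = length (ys ! j) \<and> set (a j i) \<subseteq> univ N"
    and b0: "\<forall>X\<subseteq>?W. length (b X) = length x \<and> set (b X) \<subseteq> univ N"
    and ab0: "\<forall>X\<subseteq>?W. \<forall>is\<in>?W.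
      sat N (assign (x @ concat ys) (b X @ concat (map (\<lambda>j. a j (is ! j)) [0..<k]))) \<phi> \<longleftrightarrow> is \<in> X"
    using IP unfolding has_IP_in_def Let_def k(1) by (elim exE conjE)
  have a: "length (a j i) = length (ys ! j) \<and> set (a j i) \<subseteq> univ N" if "j < k" for j i
    using a0 that by blast
  have b: "length (b X) = length x \<and> set (b X) \<subseteq> univ N" if "X \<subseteq> ?W" for X
    using b0 that by blast
  have ab: "sat N (assign (x @ concat ys) (b X @ concat (map (\<lambda>j. a j (is ! j)) [0..<k]))) \<phi>
      \<longleftrightarrow> is \<in> X" if "X \<subseteq> ?W" "length is = k" for X "is"
    using ab0 that by blast
  obtain d where d: "d \<in> univ N" using N by (auto simp: is_structure_def)
  define a' where "a' z m = (if z \<in> set (ys ! J z) then assign (ys ! J z) (a (J z) m) z else d)" for z m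
  define b' where "b' X z = (if z \<in> set x \<and> X \<subseteq> {is. length is = k} then assign x (b X) z else d)" for X z
  have "shatters N \<phi> (set x) J k n" for n
    unfolding shatters_def
  proof (intro exI[of _ a'] exI[of _ b'] conjI allI impI ballI)
    show "a' z m \<in> univ N" for z m
      using a[OF Jk[of z], of m] d assign_in_set[of z "ys ! J z" "a (J z) m"] by (auto simp: a'_def)
    show "b' X z \<in> univ N" for X z
      using b[of X] d assign_in_set[of z x "b X"] by (auto simp: b'_def)
    fix X i
    assume X: "X \<subseteq> grid k n" and i: "i \<in> grid k n"
    then have X': "X \<subseteq> {is. length is = k}" and i': "length i = k" by (auto simp: grid_def)
    let ?as = "map (\<lambda>j. a j (i ! j)) [0..<k]"
    have len: "list_all2 (\<lambda>vs ws. length ws = length vs) ys ?as"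
      using a k by (auto simp: list_all2_conv_all_nth)
    have "sat N (\<lambda>z. if z \<in> set x then b' X z else a' z (i ! J z)) \<phi> \<longleftrightarrow>
        sat N (assign (x @ concat ys) (b X @ concat ?as)) \<phi>"
    proof (rule sat_cong)
      fix z
      assume "z \<in> fv \<phi>"
      then have z: "z \<in> set x \<or> z \<in> set (concat ys)"
        using part unfolding partitioned_formula_def by auto
      have "assign (concat ys) (concat ?as) z = a' z (i ! J z)" if "z \<notin> set x"
      proof -
        have zJ: "J z < k" "z \<in> set (ys ! J z)" using J z that by blast+
        then have "assign (concat ys) (concat ?as) z = assign (ys ! J z) (?as ! J z) z"
          using part k by (intro assign_concat[OF len]) (auto simp: partitioned_formula_def)
        then show ?thesis using zJ by (simp add: a'_def)
      qed
      then show "(if z \<in> set x then b' X z else a' z (i ! J z)) =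
          assign (x @ concat ys) (b X @ concat ?as) z"
        using assign_append[of "b X" x "concat ys" "concat ?as" z] b[OF X'] X'
        by (simp add: b'_def)
    qed
    then show "sat N (\<lambda>z. if z \<in> set x then b' X z else a' z (i ! J z)) \<phi> \<longleftrightarrow> i \<in> X"
      using ab[OF X' i'] by simp
  qed
  then show ?thesis using Jk by blast
qed

text \<open>Being shattered is expressed by a sentence: the components of the tuples are the variables
  \<open>prod_encode (z, m)\<close>, where \<open>m\<close> is a row of the grid or the number of a subset.\<close>

lemma shatters_transfer:
  fixes M :: "('f, 'r, 'a) interp" and N :: "('f, 'r, 'b) interp"
  assumes M: "is_structure L M" and N: "is_model L (theory_of L M) N" and wf: "wf_fm L \<phi>"
    and sh: "shatters N \<phi> A J k n"
  shows "shatters M \<phi> A J k n"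
proof -
  obtain a b where a: "\<forall>z m. a z m \<in> univ N" and b: "\<forall>X z. b X z \<in> univ N"
    and ab0: "\<forall>X\<subseteq>grid k n. \<forall>i\<in>grid k n.
      sat N (\<lambda>z. if z \<in> A then b X z else a z (i ! J z)) \<phi> \<longleftrightarrow> i \<in> X"
    using sh unfolding shatters_def by (elim exE conjE)
  have ab: "sat N (\<lambda>z. if z \<in> A then b X z else a z (i ! J z)) \<phi> \<longleftrightarrow> i \<in> X"
    if "X \<subseteq> grid k n" "i \<in> grid k n" for X i
    using ab0 that by blast
  obtain Is where Is: "set Is = grid k n" using finite_list[of "grid k n"] by auto
  obtain Xs where Xs: "set Xs = Pow (grid k n)" using finite_list[of "Pow (grid k n)"] by auto
  \<comment> \<open>Copies of the formula share variables exactly as the pattern demands: those for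
    one subset share the variables in \<open>A\<close>, and those whose grid points agree in
    coordinate \<open>J z\<close> share the parameter variable \<open>z\<close>.\<close>
  define r where "r q i z = prod_encode (z, if z \<in> A then q else i ! J z)" for q i z
  define lit where "lit q i = (if i \<in> Xs ! q then rename (r q i) \<phi> else Neg (rename (r q i) \<phi>))" for q i
  define \<psi> where "\<psi> = conjs (map (\<lambda>(q, i). lit q i) (List.product [0..<length Xs] Is))"
  define w where "w l = (case prod_decode l of (z, m) \<Rightarrow> if z \<in> A then b (Xs ! m) z else a z m)" for l
  have sat_\<psi>: "sat K v \<psi> \<longleftrightarrow> (\<forall>q<length Xs. \<forall>i\<in>grid k n.
      sat K (\<lambda>z. v (r q i z)) \<phi> \<longleftrightarrow> i \<in> Xs ! q)" for K :: "('f, 'r, 'c) interp" and v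
  proof -
    have "sat K v (lit q i) \<longleftrightarrow> (sat K (\<lambda>z. v (r q i z)) \<phi> \<longleftrightarrow> i \<in> Xs ! q)" for q i
      by (simp add: lit_def sat_rename)
    moreover have "sat K v \<psi> \<longleftrightarrow> (\<forall>q<length Xs. \<forall>i\<in>grid k n. sat K v (lit q i))"
      unfolding \<psi>_def by (auto simp: Is)
    ultimately show ?thesis by simp
  qed
  have "sat N w \<psi>"
    unfolding sat_\<psi>
  proof (intro allI impI ballI)
    fix q i
    assume q: "q < length Xs" and i: "i \<in> grid k n"
    have "(\<lambda>z. w (r q i z)) = (\<lambda>z. if z \<in> A then b (Xs ! q) z else a z (i ! J z))"
      by (rule ext) (simp add: w_def r_def)
    moreover have "Xs ! q \<subseteq> grid k n" using nth_mem[OF q] Xs by auto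
    ultimately show "sat N (\<lambda>z. w (r q i z)) \<phi> \<longleftrightarrow> i \<in> Xs ! q" using ab[OF _ i] by simp
  qed
  moreover have "range w \<subseteq> univ N" using a b by (auto simp: w_def split: prod.splits)
  moreover have "wf_fm L \<psi>" using wf by (auto simp: \<psi>_def lit_def)
  ultimately obtain w' where w': "range w' \<subseteq> univ M" "sat M w' \<psi>"
    using satisfiable_transfer[OF M N] by blast
  define idx where "idx X = (SOME q. q < length Xs \<and> Xs ! q = X)" for X
  have idx: "idx X < length Xs \<and> Xs ! idx X = X" if "X \<subseteq> grid k n" for X
    unfolding idx_def by (rule someI_ex) (use that Xs in \<open>auto simp: in_set_conv_nth\<close>)
  show ?thesis
    unfolding shatters_def
  proof (intro exI[of _ "\<lambda>z m. w' (prod_encode (z, m))"] exI[of _ "\<lambda>X z. w' (prod_encode (z, idx X))"]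
      conjI allI impI ballI)
    fix X i
    assume X: "X \<subseteq> grid k n" and i: "i \<in> grid k n"
    have "(\<lambda>z. w' (r (idx X) i z)) =
        (\<lambda>z. if z \<in> A then w' (prod_encode (z, idx X)) else w' (prod_encode (z, i ! J z)))"
      by (rule ext) (simp add: r_def)
    then show "sat M (\<lambda>z. if z \<in> A then w' (prod_encode (z, idx X)) else w' (prod_encode (z, i ! J z))) \<phi>
        \<longleftrightarrow> i \<in> X"
      using w'(2)[unfolded sat_\<psi>] idx[OF X] i by fastforce
  qed (use w'(1) in auto)
qed

section \<open>Normal forms of terms\<close>

text \<open>The number counts leaves with repetition. It plays the role of the degree, because every
  variable takes its value in \<open>P 1\<close>.\<close>

inductive monomial :: "nat set \<Rightarrow> nat \<Rightarrow> 'k lla_fun tm \<Rightarrow> bool" for Z where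
  Var: "z \<in> Z \<Longrightarrow> monomial Z 1 (Var z)"
| Bracket: "\<lbrakk>monomial Z i s; monomial Z j t\<rbrakk> \<Longrightarrow> monomial Z (i + j) (App Bracket [s, t])"

lemma monomial_pos: "monomial Z m t \<Longrightarrow> 1 \<le> m"
  by (induction rule: monomial.induct) auto

lemma monomial_wf: "monomial Z m t \<Longrightarrow> wf_tm (lla_lang F c) t"
  by (induction rule: monomial.induct) auto

lemma monomial_card_fv: "monomial Z m t \<Longrightarrow> card (fv_tm t) \<le> m"
proof (induction rule: monomial.induct)
  case (Bracket i s j t)
  have "card (fv_tm s \<union> fv_tm t) \<le> card (fv_tm s) + card (fv_tm t)" by (rule card_Un_le)
  then show ?case using Bracket.IH by simp
qed simp

text \<open>Both factors of a bracket have at least one leaf, hence fewer leaves than the whole: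
  strong induction on the degree.\<close>

lemma finite_monomial:
  assumes Z: "finite Z"
  shows "finite {t :: 'k lla_fun tm. monomial Z m t}"
proof (induction m rule: less_induct)
  case (less m)
  let ?B = "\<Union>i\<in>{..<m}. \<Union>j\<in>{..<m}.
    (\<lambda>(s, t). App Bracket [s, t]) ` ({s :: 'k lla_fun tm. monomial Z i s} \<times> {t. monomial Z j t})"
  have "{t :: 'k lla_fun tm. monomial Z m t} \<subseteq> Var ` Z \<union> ?B"
  proof
    fix u :: "'k lla_fun tm"
    assume "u \<in> {t. monomial Z m t}"
    then have "monomial Z m u" by simp
    then show "u \<in> Var ` Z \<union> ?B"
    proof cases
      case (Bracket i s j t)
      then have "i < m" "j < m" using monomial_pos[of Z i s] monomial_pos[of Z j t] by auto
      moreover have "u \<in> (\<lambda>(s, t). App Bracket [s, t]) ` ({s. monomial Z i s} \<times> {t. monomial Z j t})"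
        using Bracket by (intro image_eqI[of _ _ "(s, t)"]) simp_all
      ultimately show ?thesis by (intro UnI2 UN_I[of i] UN_I[of j]) simp_all
    qed simp
  qed
  moreover have "finite (Var ` Z \<union> ?B)" using Z less by simp
  ultimately show ?case by (rule finite_subset)
qed

text \<open>One term for each vector of coefficients, with the generators in a fixed order and zero
  coefficients written out; so there are only finitely many when \<open>F\<close> is finite.\<close>

fun combs :: "('k, 'm) ring_scheme \<Rightarrow> 'k lla_fun tm list \<Rightarrow> 'k lla_fun tm set" where
  "combs F [] = {App Zero []}"
| "combs F (w # ws) = {App Plus [App (Scale a) [w], t] | a t. a \<in> carrier F \<and> t \<in> combs F ws}"

lemma finite_combs:
  assumes "finite (carrier F)"
  shows "finite (combs F ws)"
proof (induction ws)
  case (Cons w ws)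
  have "combs F (w # ws) = (\<lambda>(a, t). App Plus [App (Scale a) [w], t]) ` (carrier F \<times> combs F ws)"
    by auto
  then show ?case using Cons assms by simp
qed simp

lemma wf_combs:
  "t \<in> combs F ws \<Longrightarrow> \<forall>w\<in>set ws. wf_tm (lla_lang F c) w \<Longrightarrow> wf_tm (lla_lang F c) t"
  by (induction ws arbitrary: t) auto

section \<open>The span of the monomials in a Lazard Lie algebra\<close>

locale lla = lie_algebra F "alg_of M"
  for F :: "('k, 'm) ring_scheme" and c :: nat and M :: "('k lla_fun, lla_rel, 'a) interp" +
  assumes is_lla: "is_lla F c M"
begin

lemma carrier_alg [simp]: "carrier (alg_of M) = univ M"
  by (simp add: alg_of_def)

lemma is_structure: "is_structure (lla_lang F c) M"
  using is_lla by (simp add: is_lla_def)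

lemma eval_op [simp]:
  "eval M v (App Plus [s, t]) = eval M v s \<oplus>\<^bsub>alg_of M\<^esub> eval M v t"
  "eval M v (App Zero []) = \<zero>\<^bsub>alg_of M\<^esub>"
  "eval M v (App (Scale a) [s]) = a \<odot>\<^bsub>alg_of M\<^esub> eval M v s"
  "eval M v (App Bracket [s, t]) = eval M v s \<otimes>\<^bsub>alg_of M\<^esub> eval M v t"
  "eval M v (App Minus [s]) = fn M Minus [eval M v s]"
  by (simp_all add: alg_of_def)

declare eval.simps(2) [simp del]

lemmas closed [simp] = M.zero_closed[unfolded carrier_alg] M.a_closed[unfolded carrier_alg]
  M.a_inv_closed[unfolded carrier_alg] smult_closed[unfolded carrier_alg]
  bracket_closed[unfolded carrier_alg]

lemma Minus_eq: "x \<in> univ M \<Longrightarrow> fn M Minus [x] = \<ominus>\<^bsub>alg_of M\<^esub> x"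
  using is_lla by (simp add: is_lla_def)

lemma eval_in: "wf_tm (lla_lang F c) t \<Longrightarrow> range v \<subseteq> univ M \<Longrightarrow> eval M v t \<in> univ M"
  by (rule eval_closed[OF is_structure]) auto

lemma bracket_zero [simp]:
  assumes "x \<in> univ M"
  shows "\<zero>\<^bsub>alg_of M\<^esub> \<otimes>\<^bsub>alg_of M\<^esub> x = \<zero>\<^bsub>alg_of M\<^esub>" "x \<otimes>\<^bsub>alg_of M\<^esub> \<zero>\<^bsub>alg_of M\<^esub> = \<zero>\<^bsub>alg_of M\<^esub>"
  using bracket_smult_left[of "\<zero>\<^bsub>F\<^esub>" x x] bracket_smult_right[of "\<zero>\<^bsub>F\<^esub>" x x] assms bracket_closed[of x x]
  by simp_all

lemma layer_subgroup:
  assumes "i \<in> {1..c + 1}"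
  shows "subgroup (layer c M i) (add_monoid (alg_of M))"
proof -
  have "\<forall>i\<in>{1..c + 1}. lie_subalgebra F (alg_of M) (layer c M i)"
    using is_lla by (simp add: is_lla_def)
  then have "submodule (layer c M i) F (alg_of M)"
    using assms unfolding lie_subalgebra_def by blast
  then show ?thesis by (rule submodule.axioms(1))
qed

text \<open>The axiom speaks of indices up to \<open>c + 1\<close>; beyond that a layer is
  \<open>{0}\<close> by convention, so one factor vanishes and with it the bracket.\<close>

lemma layer_bracket:
  assumes "1 \<le> i" "1 \<le> j" "x \<in> layer c M i" "y \<in> layer c M j" "x \<in> univ M" "y \<in> univ M"
  shows "x \<otimes>\<^bsub>alg_of M\<^esub> y \<in> layer c M (i + j)"
proof (cases "i \<le> c + 1 \<and> j \<le> c + 1")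
  case True
  then have "i \<in> {1..c + 1}" "j \<in> {1..c + 1}" using assms(1,2) by auto
  moreover have "\<forall>i\<in>{1..c + 1}. \<forall>j\<in>{1..c + 1}. \<forall>x\<in>layer c M i. \<forall>y\<in>layer c M j.
        x \<otimes>\<^bsub>alg_of M\<^esub> y \<in> layer c M (i + j)"
    using is_lla by (simp add: is_lla_def)
  ultimately show ?thesis using assms(3,4) by blast
next
  case False
  then have "x = \<zero>\<^bsub>alg_of M\<^esub> \<or> y = \<zero>\<^bsub>alg_of M\<^esub>"
    using assms(3,4) by (auto simp: layer_def alg_of_def split: if_splits)
  then have "x \<otimes>\<^bsub>alg_of M\<^esub> y = \<zero>\<^bsub>alg_of M\<^esub>" using assms(5,6) bracket_zero by auto
  moreover have "\<not> i + j \<le> c + 1" using False assms(1,2) by auto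
  ultimately show ?thesis by (simp add: layer_def alg_of_def)
qed

lemma monomial_in_layer:
  assumes v: "range v \<subseteq> univ M"
  shows "monomial Z m t \<Longrightarrow> eval M v t \<in> layer c M m"
proof (induction rule: monomial.induct)
  case (Var z)
  have "layer c M 1 = univ M" using is_lla by (simp add: is_lla_def)
  then show ?case using v by auto
next
  case (Bracket i s j t)
  have "eval M v s \<in> univ M" "eval M v t \<in> univ M"
    using Bracket.hyps monomial_wf v by (blast intro: eval_in)+
  then show ?case
    unfolding eval_op using Bracket monomial_pos by (intro layer_bracket) blast+
qed

lemma monomial_eq_zero:
  assumes "monomial Z m t" "c < m" "range v \<subseteq> univ M"
  shows "eval M v t = \<zero>\<^bsub>alg_of M\<^esub>"
proof -
  have "layer c M m = {\<zero>\<^bsub>alg_of M\<^esub>}"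
  proof (cases "m = c + 1")
    case True
    then show ?thesis using is_lla by (simp add: is_lla_def)
  next
    case False
    then show ?thesis using assms(2) by (simp add: layer_def alg_of_def)
  qed
  then show ?thesis using monomial_in_layer[OF assms(3,1)] by simp
qed

text \<open>Equality is an identity of \<open>M\<close>, for all assignments at once, so that one
  normal form of a term serves at every point of the grid.\<close>

definition equal_tm :: "'k lla_fun tm \<Rightarrow> 'k lla_fun tm \<Rightarrow> bool" where
  "equal_tm s t \<longleftrightarrow> (\<forall>v. range v \<subseteq> univ M \<longrightarrow> eval M v s = eval M v t)"

definition has_nf :: "'k lla_fun tm list \<Rightarrow> 'k lla_fun tm \<Rightarrow> bool" where
  "has_nf ws t \<longleftrightarrow> (\<exists>u\<in>combs F ws. equal_tm t u)"

lemma equal_tmD: "equal_tm s t \<Longrightarrow> range v \<subseteq> univ M \<Longrightarrow> eval M v s = eval M v t"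
  by (simp add: equal_tm_def)

lemma has_nf_cong: "has_nf ws t \<Longrightarrow> equal_tm s t \<Longrightarrow> has_nf ws s"
  unfolding has_nf_def equal_tm_def by fastforce

context
  fixes ws :: "'k lla_fun tm list"
  assumes ws: "\<forall>w\<in>set ws. wf_tm (lla_lang F c) w"
begin

lemma comb_in: "set us \<subseteq> set ws \<Longrightarrow> t \<in> combs F us \<Longrightarrow> range v \<subseteq> univ M \<Longrightarrow> eval M v t \<in> univ M"
  using ws by (intro eval_in wf_combs[of t F us c]) auto

lemma gen_in: "w \<in> set ws \<Longrightarrow> range v \<subseteq> univ M \<Longrightarrow> eval M v w \<in> univ M"
  using ws by (intro eval_in) auto

lemma combs_zero: "set us \<subseteq> set ws \<Longrightarrow> has_nf us (App Zero [])"
proof (induction us)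
  case Nil
  then show ?case by (simp add: has_nf_def equal_tm_def)
next
  case (Cons w us)
  then obtain u where u: "u \<in> combs F us" "equal_tm (App Zero []) u" by (auto simp: has_nf_def)
  let ?u = "App Plus [App (Scale \<zero>\<^bsub>F\<^esub>) [w], u]"
  have "equal_tm (App Zero []) ?u"
    unfolding equal_tm_def
  proof (intro allI impI)
    fix v :: "nat \<Rightarrow> 'a"
    assume v: "range v \<subseteq> univ M"
    have "eval M v u = \<zero>\<^bsub>alg_of M\<^esub>" using equal_tmD[OF u(2) v] by simp
    moreover have "eval M v w \<in> univ M" using gen_in[OF _ v] Cons.prems by simp
    ultimately show "eval M v (App Zero []) = eval M v ?u" by simp
  qed
  moreover have "?u \<in> combs F (w # us)" using u(1) by auto
  ultimately show ?case unfolding has_nf_def by blast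
qed

lemma combs_plus:
  "\<lbrakk>set us \<subseteq> set ws; s \<in> combs F us; t \<in> combs F us\<rbrakk> \<Longrightarrow> has_nf us (App Plus [s, t])"
proof (induction us arbitrary: s t)
  case Nil
  then show ?case by (simp add: has_nf_def equal_tm_def)
next
  case (Cons w us)
  obtain a s' where s: "s = App Plus [App (Scale a) [w], s']" "a \<in> carrier F" "s' \<in> combs F us"
    using Cons.prems(2) by auto
  obtain b t' where t: "t = App Plus [App (Scale b) [w], t']" "b \<in> carrier F" "t' \<in> combs F us"
    using Cons.prems(3) by auto
  have us: "set us \<subseteq> set ws" "w \<in> set ws" using Cons.prems(1) by auto
  obtain u where u: "u \<in> combs F us" "equal_tm (App Plus [s', t']) u"
    using Cons.IH[OF us(1) s(3) t(3)] by (auto simp: has_nf_def)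
  let ?u = "App Plus [App (Scale (a \<oplus>\<^bsub>F\<^esub> b)) [w], u]"
  have "equal_tm (App Plus [s, t]) ?u"
    unfolding equal_tm_def
  proof (intro allI impI)
    fix v :: "nat \<Rightarrow> 'a"
    assume v: "range v \<subseteq> univ M"
    have in_M: "eval M v w \<in> univ M" "eval M v s' \<in> univ M" "eval M v t' \<in> univ M"
      using gen_in[OF us(2) v] comb_in[OF us(1) _ v] s(3) t(3) by auto
    have "eval M v u = eval M v s' \<oplus>\<^bsub>alg_of M\<^esub> eval M v t'" using equal_tmD[OF u(2) v] by simp
    then show "eval M v (App Plus [s, t]) = eval M v ?u"
      using in_M s(1,2) t(1,2) by (simp add: smult_l_distr M.a_ac)
  qed
  moreover have "?u \<in> combs F (w # us)" using u(1) s(2) t(2) by auto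
  ultimately show ?case unfolding has_nf_def by blast
qed

lemma combs_scale:
  "\<lbrakk>set us \<subseteq> set ws; a \<in> carrier F; t \<in> combs F us\<rbrakk> \<Longrightarrow> has_nf us (App (Scale a) [t])"
proof (induction us arbitrary: t)
  case Nil
  then show ?case by (simp add: has_nf_def equal_tm_def)
next
  case (Cons w us)
  obtain b t' where t: "t = App Plus [App (Scale b) [w], t']" "b \<in> carrier F" "t' \<in> combs F us"
    using Cons.prems(3) by auto
  have us: "set us \<subseteq> set ws" "w \<in> set ws" using Cons.prems(1) by auto
  obtain u where u: "u \<in> combs F us" "equal_tm (App (Scale a) [t']) u"
    using Cons.IH[OF us(1) Cons.prems(2) t(3)] by (auto simp: has_nf_def)
  let ?u = "App Plus [App (Scale (a \<otimes>\<^bsub>F\<^esub> b)) [w], u]"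
  have "equal_tm (App (Scale a) [t]) ?u"
    unfolding equal_tm_def
  proof (intro allI impI)
    fix v :: "nat \<Rightarrow> 'a"
    assume v: "range v \<subseteq> univ M"
    have in_M: "eval M v w \<in> univ M" "eval M v t' \<in> univ M"
      using gen_in[OF us(2) v] comb_in[OF us(1) _ v] t(3) by auto
    have "eval M v u = a \<odot>\<^bsub>alg_of M\<^esub> eval M v t'" using equal_tmD[OF u(2) v] by simp
    then show "eval M v (App (Scale a) [t]) = eval M v ?u"
      using in_M t(1,2) Cons.prems(2) by (simp add: smult_r_distr smult_assoc1)
  qed
  moreover have "?u \<in> combs F (w # us)" using u(1) Cons.prems(2) t(2) by auto
  ultimately show ?case unfolding has_nf_def by blast
qed

lemma combs_mem: "\<lbrakk>set us \<subseteq> set ws; w \<in> set us\<rbrakk> \<Longrightarrow> has_nf us w"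
proof (induction us)
  case (Cons x us)
  have us: "set us \<subseteq> set ws" "x \<in> set ws" using Cons.prems(1) by auto
  obtain a u where u: "a \<in> carrier F" "u \<in> combs F us"
    "equal_tm w (App Plus [App (Scale a) [x], u])"
  proof (cases "w = x")
    case True
    obtain u where u: "u \<in> combs F us" "equal_tm (App Zero []) u"
      using combs_zero[OF us(1)] by (auto simp: has_nf_def)
    have "equal_tm w (App Plus [App (Scale \<one>\<^bsub>F\<^esub>) [x], u])"
      unfolding equal_tm_def
    proof (intro allI impI)
      fix v :: "nat \<Rightarrow> 'a"
      assume v: "range v \<subseteq> univ M"
      have "eval M v u = \<zero>\<^bsub>alg_of M\<^esub>" using equal_tmD[OF u(2) v] by simp
      then show "eval M v w = eval M v (App Plus [App (Scale \<one>\<^bsub>F\<^esub>) [x], u])"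
        using gen_in[OF us(2) v] True by simp
    qed
    then show ?thesis using that u(1) by blast
  next
    case False
    then obtain u where u: "u \<in> combs F us" "equal_tm w u"
      using Cons.IH[OF us(1)] Cons.prems(2) by (auto simp: has_nf_def)
    have "equal_tm w (App Plus [App (Scale \<zero>\<^bsub>F\<^esub>) [x], u])"
      unfolding equal_tm_def
    proof (intro allI impI)
      fix v :: "nat \<Rightarrow> 'a"
      assume v: "range v \<subseteq> univ M"
      show "eval M v w = eval M v (App Plus [App (Scale \<zero>\<^bsub>F\<^esub>) [x], u])"
        using gen_in[OF us(2) v] comb_in[OF us(1) u(1) v] equal_tmD[OF u(2) v] by simp
    qed
    then show ?thesis using that u(1) by blast
  qed
  then show ?case unfolding has_nf_def by auto
qed simp

lemma has_nf_plus:
  assumes "has_nf ws s" "has_nf ws t"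
  shows "has_nf ws (App Plus [s, t])"
proof -
  obtain s' t' where *: "s' \<in> combs F ws" "t' \<in> combs F ws" "equal_tm s s'" "equal_tm t t'"
    using assms by (auto simp: has_nf_def)
  show ?thesis
    by (rule has_nf_cong[OF combs_plus[OF _ *(1,2)]]) (use *(3,4) in \<open>auto simp: equal_tm_def\<close>)
qed

lemma has_nf_scale:
  assumes "a \<in> carrier F" "has_nf ws t"
  shows "has_nf ws (App (Scale a) [t])"
proof -
  obtain t' where *: "t' \<in> combs F ws" "equal_tm t t'"
    using assms by (auto simp: has_nf_def)
  show ?thesis
    by (rule has_nf_cong[OF combs_scale[OF _ assms(1) *(1)]]) (use *(2) in \<open>auto simp: equal_tm_def\<close>)
qed

context
  assumes gen_bracket: "\<And>w u. w \<in> set ws \<Longrightarrow> u \<in> set ws \<Longrightarrow> has_nf ws (App Bracket [w, u])"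
begin

text \<open>Bilinearity in the right argument; \<open>comb_bracket_comb\<close> adds the left one.
  The induction shortens \<open>us\<close> while the results stay in the span of the whole list
  \<open>ws\<close>.\<close>

lemma gen_bracket_comb:
  "\<lbrakk>w \<in> set ws; set us \<subseteq> set ws; t \<in> combs F us\<rbrakk> \<Longrightarrow> has_nf ws (App Bracket [w, t])"
proof (induction us arbitrary: t)
  case Nil
  then have "equal_tm (App Bracket [w, t]) (App Zero [])"
    using gen_in by (simp add: equal_tm_def)
  then show ?case using has_nf_cong[OF combs_zero] by blast
next
  case (Cons x us)
  obtain a t' where t: "t = App Plus [App (Scale a) [x], t']" "a \<in> carrier F" "t' \<in> combs F us"
    using Cons.prems(3) by auto
  have us: "set us \<subseteq> set ws" "x \<in> set ws" using Cons.prems(2) by auto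
  have "has_nf ws (App Plus [App (Scale a) [App Bracket [w, x]], App Bracket [w, t']])"
    by (intro has_nf_plus has_nf_scale gen_bracket Cons.IH Cons.prems(1) us t)
  moreover have "equal_tm (App Bracket [w, t])
      (App Plus [App (Scale a) [App Bracket [w, x]], App Bracket [w, t']])"
    unfolding equal_tm_def
  proof (intro allI impI)
    fix v :: "nat \<Rightarrow> 'a"
    assume v: "range v \<subseteq> univ M"
    show "eval M v (App Bracket [w, t]) =
        eval M v (App Plus [App (Scale a) [App Bracket [w, x]], App Bracket [w, t']])"
      using gen_in[OF us(2) v] gen_in[OF Cons.prems(1) v] comb_in[OF us(1) t(3) v] t(1,2)
      by (simp add: bracket_add_right bracket_smult_right)
  qed
  ultimately show ?case by (rule has_nf_cong)
qed

lemma comb_bracket_comb: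
  "\<lbrakk>set us \<subseteq> set ws; s \<in> combs F us; t \<in> combs F ws\<rbrakk> \<Longrightarrow> has_nf ws (App Bracket [s, t])"
proof (induction us arbitrary: s)
  case Nil
  then have "equal_tm (App Bracket [s, t]) (App Zero [])"
    using comb_in[of ws t] by (simp add: equal_tm_def)
  then show ?case using has_nf_cong[OF combs_zero] by blast
next
  case (Cons x us)
  obtain a s' where s: "s = App Plus [App (Scale a) [x], s']" "a \<in> carrier F" "s' \<in> combs F us"
    using Cons.prems(2) by auto
  have us: "set us \<subseteq> set ws" "x \<in> set ws" using Cons.prems(1) by auto
  have "has_nf ws (App Plus [App (Scale a) [App Bracket [x, t]], App Bracket [s', t]])"
    by (intro has_nf_plus has_nf_scale gen_bracket_comb[of _ ws] Cons.IH subset_refl us s Cons.prems(3))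
  moreover have "equal_tm (App Bracket [s, t])
      (App Plus [App (Scale a) [App Bracket [x, t]], App Bracket [s', t]])"
    unfolding equal_tm_def
  proof (intro allI impI)
    fix v :: "nat \<Rightarrow> 'a"
    assume v: "range v \<subseteq> univ M"
    show "eval M v (App Bracket [s, t]) =
        eval M v (App Plus [App (Scale a) [App Bracket [x, t]], App Bracket [s', t]])"
      using gen_in[OF us(2) v] comb_in[OF _ Cons.prems(3) v] comb_in[OF us(1) s(3) v] s(1,2)
      by (simp add: bracket_add_left bracket_smult_left)
  qed
  ultimately show ?case by (rule has_nf_cong)
qed

lemma has_nf_bracket:
  assumes "has_nf ws s" "has_nf ws t"
  shows "has_nf ws (App Bracket [s, t])"
proof -
  obtain s' t' where *: "s' \<in> combs F ws" "t' \<in> combs F ws" "equal_tm s s'" "equal_tm t t'"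
    using assms by (auto simp: has_nf_def)
  show ?thesis
    by (rule has_nf_cong[OF comb_bracket_comb[OF _ *(1,2)]]) (use *(3,4) in \<open>auto simp: equal_tm_def\<close>)
qed

lemma has_nf_tm:
  assumes vars: "\<And>z. z \<in> Z \<Longrightarrow> Var z \<in> set ws"
  shows "wf_tm (lla_lang F c) t \<Longrightarrow> fv_tm t \<subseteq> Z \<Longrightarrow> has_nf ws t"
proof (induction t)
  case (Var z)
  then show ?case using vars combs_mem[of ws "Var z"] by simp
next
  case (App f ts)
  have IH: "has_nf ws t" if "t \<in> set ts" for t
    using App.IH[OF that] App.prems that by auto
  have len: "fun_arity (lla_lang F c) f = Some (length ts)" using App.prems by simp
  show ?case
  proof (cases f)
    case Plus
    then have "length ts = 2" using len by simp
    then obtain s t where "ts = [s, t]" by (auto simp: numeral_2_eq_2 length_Suc_conv)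
    then show ?thesis using IH Plus has_nf_plus by simp
  next
    case Minus
    then have "length ts = 1" using len by simp
    then obtain t where t: "ts = [t]" by (auto simp: length_Suc_conv)
    \<comment> \<open>Negation is treated as multiplication by the scalar \<open>-1\<close>.\<close>
    have "equal_tm (App f ts) (App (Scale (\<ominus>\<^bsub>F\<^esub> \<one>\<^bsub>F\<^esub>)) [t])"
      unfolding equal_tm_def
    proof (intro allI impI)
      fix v :: "nat \<Rightarrow> 'a"
      assume v: "range v \<subseteq> univ M"
      have "eval M v t \<in> univ M" using App.prems t v by (intro eval_in) auto
      then show "eval M v (App f ts) = eval M v (App (Scale (\<ominus>\<^bsub>F\<^esub> \<one>\<^bsub>F\<^esub>)) [t])"
        using t Minus by (simp add: Minus_eq smult_l_minus)
    qed
    moreover have "has_nf ws (App (Scale (\<ominus>\<^bsub>F\<^esub> \<one>\<^bsub>F\<^esub>)) [t])"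
      using IH t by (intro has_nf_scale) simp_all
    ultimately show ?thesis by (rule has_nf_cong[rotated])
  next
    case Zero
    then have "ts = []" using len by simp
    then show ?thesis using combs_zero[of ws] Zero by simp
  next
    case (Scale a)
    then have "length ts = 1" "a \<in> carrier F" using len by (auto split: if_splits)
    moreover then obtain t where "ts = [t]" by (auto simp: length_Suc_conv)
    ultimately show ?thesis using IH Scale has_nf_scale by simp
  next
    case Bracket
    then have "length ts = 2" using len by simp
    then obtain s t where "ts = [s, t]" by (auto simp: numeral_2_eq_2 length_Suc_conv)
    then show ?thesis using IH Bracket has_nf_bracket by simp
  qed
qed

end

end

text \<open>The list consists of all monomials with at most \<open>c\<close> leaves. A bracket of
  two of them is again in the list or has more than \<open>c\<close> leaves and vanishes, so their
  span is closed under brackets; \<open>1 <= c\<close> puts the variables into the list.\<close>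

lemma exists_normal_forms:
  assumes Z: "finite Z" and c: "1 \<le> c"
  shows "\<exists>ws. (\<forall>w\<in>set ws. \<exists>m\<le>c. monomial Z m w) \<and>
    (\<forall>t. wf_tm (lla_lang F c) t \<and> fv_tm t \<subseteq> Z \<longrightarrow> has_nf ws t)"
proof -
  have fin: "finite (\<Union>m\<in>{..c}. {t :: 'k lla_fun tm. monomial Z m t})"
    using Z by (simp add: finite_monomial)
  obtain ws :: "'k lla_fun tm list" where "set ws = (\<Union>m\<in>{..c}. {t. monomial Z m t})"
    using finite_list[OF fin] by (elim exE)
  then have mem: "w \<in> set ws \<longleftrightarrow> (\<exists>m\<le>c. monomial Z m w)" for w by auto
  have wf: "\<forall>w\<in>set ws. wf_tm (lla_lang F c) w"
  proof
    fix w
    assume "w \<in> set ws"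
    then obtain m where "monomial Z m w" using mem by auto
    then show "wf_tm (lla_lang F c) w" by (rule monomial_wf)
  qed
  have "has_nf ws (App Bracket [w, u])" if wu: "w \<in> set ws" "u \<in> set ws" for w u
  proof -
    obtain i j where ij: "monomial Z i w" "monomial Z j u" using wu mem by auto
    then have m: "monomial Z (i + j) (App Bracket [w, u])" by (rule monomial.Bracket)
    show ?thesis
    proof (cases "i + j \<le> c")
      case True
      then have "App Bracket [w, u] \<in> set ws" unfolding mem using m by (intro exI conjI)
      then show ?thesis by (rule combs_mem[OF wf subset_refl])
    next
      case False
      then have "equal_tm (App Bracket [w, u]) (App Zero [])"
        using monomial_eq_zero[OF m] by (simp add: equal_tm_def)
      then show ?thesis by (rule has_nf_cong[OF combs_zero[OF wf subset_refl]])
    qed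
  qed
  note brackets = this
  have vars: "Var z \<in> set ws" if "z \<in> Z" for z
    unfolding mem using c monomial.Var[OF that] by (intro exI conjI)
  show ?thesis
  proof (intro exI[of _ ws] conjI ballI allI impI)
    show "\<exists>m\<le>c. monomial Z m w" if "w \<in> set ws" for w
      using that by (simp only: mem)
    show "has_nf ws t" if "wf_tm (lla_lang F c) t \<and> fv_tm t \<subseteq> Z" for t
      by (rule has_nf_tm[OF wf brackets vars conjunct1[OF that] conjunct2[OF that]])
  qed
qed

end

section \<open>Dependence\<close>

definition grid_val :: "nat set \<Rightarrow> (nat \<Rightarrow> nat) \<Rightarrow> (nat \<Rightarrow> nat \<Rightarrow> 'a) \<Rightarrow> (nat \<Rightarrow> 'a) \<Rightarrow> nat list \<Rightarrow> nat \<Rightarrow> 'a" where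
  "grid_val A J a b i = (\<lambda>z. if z \<in> A then b z else a z (i ! J z))"

context lla
begin

text \<open>A monomial with at most \<open>c\<close> leaves, one of them in \<open>A\<close>, misses one of the \<open>c\<close> rows of the
  grid.\<close>

lemma monomial_cyl:
  assumes w: "monomial Z m w" "m \<le> c" and c: "1 \<le> c" and J: "\<And>z. J z < c"
    and a: "\<And>z m. a z m \<in> univ M" and b: "\<And>z. b z \<in> univ M" and b': "\<And>z. b' z \<in> univ M"
  shows "M.cyl c (grid c n)
    (\<lambda>i. eval M (grid_val A J a b i) w \<ominus>\<^bsub>alg_of M\<^esub> eval M (grid_val A J a b' i) w)"
proof -
  have ran: "range (grid_val A J a b i) \<subseteq> univ M" "range (grid_val A J a b' i) \<subseteq> univ M" for i
    using a b b' by (auto simp: grid_val_def)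
  have ev: "eval M (grid_val A J a b i) w \<in> univ M" "eval M (grid_val A J a b' i) w \<in> univ M" for i
    by (rule eval_in[OF monomial_wf[OF w(1)] ran(1)], rule eval_in[OF monomial_wf[OF w(1)] ran(2)])
  show ?thesis
  \<comment> \<open>A monomial without leaves in \<open>A\<close> may depend on all \<open>c\<close>
    coordinates. This is why differences are considered: there the two values agree and
    cancel.\<close>
  proof (cases "fv_tm w \<inter> A = {}")
    case True
    have eq: "eval M (grid_val A J a b i) w = eval M (grid_val A J a b' i) w" for i
      by (rule eval_cong) (use True in \<open>auto simp: grid_val_def\<close>)
    show ?thesis
      by (rule M.cyl_zero) (use c eq ev in \<open>simp_all add: M.minus_eq M.r_neg\<close>)
  next
    case False
    \<comment> \<open>One leaf is spent on \<open>A\<close>, so fewer than \<open>c\<close>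
      variables remain outside it, and their coordinates \<open>J z\<close> omit some
      \<open>j < c\<close>.\<close>
    then have "fv_tm w - A \<subset> fv_tm w" by blast
    then have "card (fv_tm w - A) < card (fv_tm w)" by (intro psubset_card_mono) simp_all
    also have "\<dots> \<le> c" using monomial_card_fv[OF w(1)] w(2) by simp
    finally have "card (J ` (fv_tm w - A)) < card {..<c}"
      using card_image_le[of "fv_tm w - A" J] by simp
    then have "\<not> {..<c} \<subseteq> J ` (fv_tm w - A)"
      using card_mono[of "J ` (fv_tm w - A)" "{..<c}"] by auto
    then obtain j where j: "j < c" "j \<notin> J ` (fv_tm w - A)" by auto
    have eq: "eval M (grid_val A J a d i) w = eval M (grid_val A J a d i') w"
      if "i \<in> grid c n" "i' \<in> grid c n" "del j i = del j i'" for d i i'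
    proof (rule eval_cong)
      fix z
      assume z: "z \<in> fv_tm w"
      show "grid_val A J a d i z = grid_val A J a d i' z"
      proof (cases "z \<in> A")
        case False
        then have "J z \<noteq> j" using z j(2) by auto
        then have "i ! J z = i' ! J z"
          using del_eq_nth[OF that(3), of "J z"] that(1,2) J[of z] by (simp add: grid_def)
        then show ?thesis by (simp add: grid_val_def)
      qed (simp add: grid_val_def)
    qed
    show ?thesis
    proof (rule M.cyl.base[OF j(1)])
      fix i i'
      assume i: "i \<in> grid c n" "i' \<in> grid c n" "del j i = del j i'"
      show "eval M (grid_val A J a b i) w \<ominus>\<^bsub>alg_of M\<^esub> eval M (grid_val A J a b' i) w =
          eval M (grid_val A J a b i') w \<ominus>\<^bsub>alg_of M\<^esub> eval M (grid_val A J a b' i') w"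
        using eq[OF i] by simp
    qed (use ev in \<open>simp add: M.minus_eq\<close>)
  qed
qed

lemma comb_cyl:
  assumes c: "1 \<le> c" and J: "\<And>z. J z < c"
    and a: "\<And>z m. a z m \<in> univ M" and b: "\<And>z. b z \<in> univ M" and b': "\<And>z. b' z \<in> univ M"
  shows "(\<And>w. w \<in> set ws \<Longrightarrow> \<exists>m\<le>c. monomial Z m w) \<Longrightarrow> t \<in> combs F ws \<Longrightarrow> M.cyl c (grid c n)
    (\<lambda>i. eval M (grid_val A J a b i) t \<ominus>\<^bsub>alg_of M\<^esub> eval M (grid_val A J a b' i) t)"
proof (induction ws arbitrary: t)
  case Nil
  show ?case
    by (rule M.cyl_zero) (use c Nil in \<open>simp_all add: M.minus_eq M.r_neg\<close>)
next
  case (Cons w ws)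
  obtain x t' where t: "t = App Plus [App (Scale x) [w], t']" "x \<in> carrier F" "t' \<in> combs F ws"
    using Cons.prems(2) by auto
  obtain m where m: "m \<le> c" "monomial Z m w" using Cons.prems(1)[of w] by auto
  have mons: "\<exists>m\<le>c. monomial Z m u" if "u \<in> set ws" for u using Cons.prems(1)[of u] that by simp
  have "wf_tm (lla_lang F c) t'"
    by (rule wf_combs[OF t(3)]) (use mons monomial_wf in blast)
  then have ev: "eval M (grid_val A J a d i) w \<in> univ M" "eval M (grid_val A J a d i) t' \<in> univ M"
    if "range d \<subseteq> univ M" for d i
    using that a monomial_wf[OF m(2)] by (auto intro!: eval_in simp: grid_val_def)
  have ran: "range b \<subseteq> univ M" "range b' \<subseteq> univ M" using b b' by auto
  show ?case
  proof (rule M.cyl.plus)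
    show "M.cyl c (grid c n) (\<lambda>i. x \<odot>\<^bsub>alg_of M\<^esub>
        (eval M (grid_val A J a b i) w \<ominus>\<^bsub>alg_of M\<^esub> eval M (grid_val A J a b' i) w))"
      by (rule M.cyl_hom[OF monomial_cyl[OF m(2,1) c J a b b']]) (simp_all add: t(2) smult_r_distr)
    show "M.cyl c (grid c n)
        (\<lambda>i. eval M (grid_val A J a b i) t' \<ominus>\<^bsub>alg_of M\<^esub> eval M (grid_val A J a b' i) t')"
      by (rule Cons.IH[OF mons t(3)])
    show "eval M (grid_val A J a b i) t \<ominus>\<^bsub>alg_of M\<^esub> eval M (grid_val A J a b' i) t =
        x \<odot>\<^bsub>alg_of M\<^esub> (eval M (grid_val A J a b i) w \<ominus>\<^bsub>alg_of M\<^esub> eval M (grid_val A J a b' i) w) \<oplus>\<^bsub>alg_of M\<^esub>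
        (eval M (grid_val A J a b i) t' \<ominus>\<^bsub>alg_of M\<^esub> eval M (grid_val A J a b' i) t')" for i
      using ev[OF ran(1), of i] ev[OF ran(2), of i] t(1,2)
      by (simp add: M.minus_eq M.minus_add smult_r_distr smult_r_minus M.a_ac)
  qed
qed

text \<open>The parameters \<open>a\<close> stay fixed while \<open>b\<close> varies, which makes
  the differences cylinder functions. The subgroup is the layer \<open>P p\<close>; the case
  \<open>p = c + 1\<close> takes care of equations.\<close>

lemma comb_pattern_bound:
  assumes c: "1 \<le> c" and J: "\<And>z. J z < c" and a: "\<And>z m. a z m \<in> univ M"
    and ws: "\<And>w. w \<in> set ws \<Longrightarrow> \<exists>m\<le>c. monomial Z m w" and t: "t \<in> combs F ws"
    and p: "p \<in> {1..c + 1}"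
  shows "card ((\<lambda>b. {i \<in> grid c (2 ^ q). rel M (P p) [eval M (grid_val A J a b i) t]}) `
      {b. range b \<subseteq> univ M}) \<le> 2 ^ ((q * c + 1)\<^sup>2 * c * (2 ^ q) ^ (c - 1))"
proof -
  let ?e = "\<lambda>b i. eval M (grid_val A J a b i) t"
  have wf: "wf_tm (lla_lang F c) t"
    by (rule wf_combs[OF t]) (use ws monomial_wf in blast)
  have ev: "?e b i \<in> univ M" if "range b \<subseteq> univ M" for b i
    by (rule eval_in[OF wf]) (use that a in \<open>auto simp: grid_val_def\<close>)
  have "(\<lambda>b. {i \<in> grid c (2 ^ q). rel M (P p) [?e b i]}) ` {b. range b \<subseteq> univ M} =
      (\<lambda>e. {i \<in> grid c (2 ^ q). e i \<in> layer c M p}) ` (?e ` {b. range b \<subseteq> univ M})"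
    unfolding image_image using ev p by (intro image_cong) (auto simp: layer_def)
  moreover have "card ((\<lambda>e. {i \<in> grid c (2 ^ q). e i \<in> layer c M p}) ` (?e ` {b. range b \<subseteq> univ M}))
      \<le> 2 ^ ((q * c + 1)\<^sup>2 * c * (2 ^ q) ^ (c - 1))"
  proof (rule M.zero_pattern_bound[OF c layer_subgroup[OF p]])
    fix e e'
    assume "e \<in> ?e ` {b. range b \<subseteq> univ M}" "e' \<in> ?e ` {b. range b \<subseteq> univ M}"
    then obtain b b' where b: "range b \<subseteq> univ M" "e = ?e b" and b': "range b' \<subseteq> univ M" "e' = ?e b'"
      by (elim imageE CollectE)
    have "M.cyl c (grid c (2 ^ q)) (\<lambda>i. ?e b i \<ominus>\<^bsub>alg_of M\<^esub> ?e b' i)"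
      by (rule comb_cyl[OF c J a _ _ ws t]) (use b(1) b'(1) in auto)
    then show "M.cyl c (grid c (2 ^ q)) (\<lambda>i. e i \<ominus>\<^bsub>alg_of M\<^esub> e' i)" using b(2) b'(2) by simp
  qed (use ev in auto)
  ultimately show ?thesis by simp
qed

text \<open>Atomic formulas reduce to conditions on normal forms: an equation says that a difference
  lies in \<open>P (c + 1) = {0}\<close>, and every term may be replaced by its normal form.\<close>

lemma normal_forms_determine_sat:
  assumes uh: "ultrahomogeneous (lla_lang F c) M" and Z: "finite Z" "Z \<noteq> {}"
    and nf: "\<And>t. wf_tm (lla_lang F c) t \<Longrightarrow> fv_tm t \<subseteq> Z \<Longrightarrow> has_nf ws t"
    and v: "range v \<subseteq> univ M" and w: "range w \<subseteq> univ M"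
    and eq: "\<And>t p. t \<in> combs F ws \<Longrightarrow> p \<in> {1..c + 1} \<Longrightarrow>
      rel M (P p) [eval M v t] \<longleftrightarrow> rel M (P p) [eval M w t]"
    and \<phi>: "wf_fm (lla_lang F c) \<phi>" "fv \<phi> \<subseteq> Z"
  shows "sat M v \<phi> = sat M w \<phi>"
proof (rule ultrahomogeneous_sat_eq[OF is_structure uh v w Z _ _ \<phi>])
  have rel_eq: "rel M (P p) [eval M v t] \<longleftrightarrow> rel M (P p) [eval M w t]"
    if p: "p \<in> {1..c + 1}" and t: "wf_tm (lla_lang F c) t" "fv_tm t \<subseteq> Z" for p t
  proof -
    obtain u where "u \<in> combs F ws" "equal_tm t u"
      using nf[OF t] by (auto simp: has_nf_def)
    then show ?thesis using eq[of u p] p equal_tmD[of t u] v w by simp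
  qed
  fix s t
  assume st: "wf_tm (lla_lang F c) s" "wf_tm (lla_lang F c) t" "fv_tm s \<subseteq> Z" "fv_tm t \<subseteq> Z"
  let ?d = "App Plus [s, App Minus [t]]"
  have "layer c M (c + 1) = {\<zero>\<^bsub>alg_of M\<^esub>}" using is_lla by (simp add: is_lla_def)
  then have top: "rel M (P (c + 1)) [x] \<longleftrightarrow> x = \<zero>\<^bsub>alg_of M\<^esub>" if "x \<in> univ M" for x
    using that by (auto simp: layer_def)
  have "eval M u s = eval M u t \<longleftrightarrow> rel M (P (c + 1)) [eval M u ?d]" if u: "range u \<subseteq> univ M" for u
  proof -
    have in_M: "eval M u s \<in> univ M" "eval M u t \<in> univ M" using st u by (simp_all add: eval_in)
    have "eval M u s = eval M u t" if "eval M u s \<oplus>\<^bsub>alg_of M\<^esub> \<ominus>\<^bsub>alg_of M\<^esub> eval M u t = \<zero>\<^bsub>alg_of M\<^esub>"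
      using M.minus_equality[of "eval M u s" "\<ominus>\<^bsub>alg_of M\<^esub> eval M u t"] that in_M by simp
    then show ?thesis
      using in_M top[of "eval M u ?d"] by (auto simp: Minus_eq M.r_neg)
  qed
  then show "eval M v s = eval M v t \<longleftrightarrow> eval M w s = eval M w t"
    using rel_eq[of "c + 1" ?d] st v w by simp
next
  fix r ts
  assume *: "rel_arity (lla_lang F c) r = Some (length ts)"
    "\<forall>t\<in>set ts. wf_tm (lla_lang F c) t \<and> fv_tm t \<subseteq> Z"
  obtain p where p: "r = P p" by (cases r)
  then have "p \<in> {1..c + 1}" "length ts = 1" using *(1) by (auto split: if_splits)
  moreover then obtain t where "ts = [t]" by (auto simp: length_Suc_conv)
  ultimately show "rel M r (map (eval M v) ts) \<longleftrightarrow> rel M r (map (eval M w) ts)"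
  proof -
    obtain u where u: "u \<in> combs F ws" "equal_tm t u"
      using nf[of t] *(2) \<open>ts = [t]\<close> by (auto simp: has_nf_def)
    then show ?thesis
      using eq[of u p] \<open>p \<in> {1..c + 1}\<close> equal_tmD[OF u(2)] v w p \<open>ts = [t]\<close> by simp
  qed
qed

text \<open>If all subsets of the grid were cut out, each would be determined by the patterns of the
  conditions in \<open>?T\<close>. Every condition has at most \<open>?B\<close> patterns, and for
  suitable \<open>q\<close> the product of these bounds is smaller than the number of
  subsets.\<close>

theorem not_all_shattered:
  assumes fin: "finite (carrier F)" and c: "1 \<le> c" and uh: "ultrahomogeneous (lla_lang F c) M"
    and \<phi>: "wf_fm (lla_lang F c) \<phi>" and J: "\<And>z. J z < c"
  shows "\<exists>n. \<not> shatters M \<phi> A J c n"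
proof -
  \<comment> \<open>Variable \<open>0\<close> is added because the formula may have no free
    variables, whereas the generating set has to be nonempty.\<close>
  let ?Z = "insert 0 (fv \<phi>)"
  have Z: "finite ?Z" by simp
  obtain ws where ws0: "\<forall>w\<in>set ws. \<exists>m\<le>c. monomial ?Z m w"
    and nf0: "\<forall>t. wf_tm (lla_lang F c) t \<and> fv_tm t \<subseteq> ?Z \<longrightarrow> has_nf ws t"
    using exists_normal_forms[OF Z c] by (elim exE conjE)
  have ws: "\<exists>m\<le>c. monomial ?Z m w" if "w \<in> set ws" for w
    using ws0 that by (rule bspec)
  have nf: "has_nf ws t" if "wf_tm (lla_lang F c) t" "fv_tm t \<subseteq> ?Z" for t
    using nf0 that by blast
  let ?T = "combs F ws \<times> {1..c + 1}"
  have finT: "finite ?T" using finite_combs[OF fin] by simp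
  obtain q where q: "card ?T * ((q * c + 1)\<^sup>2 * c * (2 ^ q) ^ (c - 1)) < (2 ^ q) ^ c"
    using exponential_dominates[OF c] by blast
  let ?I = "grid c (2 ^ q)" and ?B = "2 ^ ((q * c + 1)\<^sup>2 * c * (2 ^ q) ^ (c - 1)) :: nat"
  have "\<not> shatters M \<phi> A J c (2 ^ q)"
  proof
    assume "shatters M \<phi> A J c (2 ^ q)"
    then obtain a b where a0: "\<forall>z m. a z m \<in> univ M" and b0: "\<forall>X z. b X z \<in> univ M"
      and ab0: "\<forall>X\<subseteq>?I. \<forall>i\<in>?I.
        sat M (\<lambda>z. if z \<in> A then b X z else a z (i ! J z)) \<phi> \<longleftrightarrow> i \<in> X"
      unfolding shatters_def by (elim exE conjE)
    have a: "a z m \<in> univ M" for z m using a0 by blast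
    have b: "range (b X) \<subseteq> univ M" for X using b0 by blast
    have ab: "sat M (grid_val A J a (b X) i) \<phi> \<longleftrightarrow> i \<in> X" if "X \<subseteq> ?I" "i \<in> ?I" for X i
      using ab0 that unfolding grid_val_def by blast
    define pat where "pat t p d = {i \<in> ?I. rel M (P p) [eval M (grid_val A J a d i) t]}" for t p d
    define pats where "pats = (\<lambda>(t, p). pat t p ` {d. range d \<subseteq> univ M})"
    \<comment> \<open>The profile of \<open>X\<close> collects the patterns that \<open>b X\<close>
      cuts out, over all normal forms and all layers; equal profiles give equal truth values of the
      formula at every grid point.\<close>
    define prof where "prof X = restrict (\<lambda>(t, p). pat t p (b X)) ?T" for X
    have card_pats: "card (pats x) \<le> ?B" if "x \<in> ?T" for x
      using that comb_pattern_bound[OF c J a ws, where q = q and A = A]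
      by (auto simp: pats_def pat_def)
    have fin_pats: "finite (pats x)" for x
    proof -
      have "pats x \<subseteq> Pow ?I" by (auto simp: pats_def pat_def split: prod.splits)
      then show ?thesis by (rule finite_subset) simp
    qed
    have sub: "X \<subseteq> Y" if X: "X \<subseteq> ?I" and Y: "Y \<subseteq> ?I" and eq: "prof X = prof Y" for X Y
    proof
      fix i
      assume "i \<in> X"
      then have i: "i \<in> ?I" using X by auto
      have val: "range (grid_val A J a (b X) i) \<subseteq> univ M" for X
        using a b[of X] by (auto simp: grid_val_def)
      have "sat M (grid_val A J a (b X) i) \<phi> = sat M (grid_val A J a (b Y) i) \<phi>"
      proof (rule normal_forms_determine_sat[OF uh Z _ nf val val _ \<phi>])
        fix t p
        assume "t \<in> combs F ws" "p \<in> {1..c + 1}"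
        then have "pat t p (b X) = pat t p (b Y)"
          using fun_cong[OF eq, of "(t, p)"] by (simp add: prof_def)
        then have "i \<in> pat t p (b X) \<longleftrightarrow> i \<in> pat t p (b Y)" by simp
        then show "rel M (P p) [eval M (grid_val A J a (b X) i) t] \<longleftrightarrow>
            rel M (P p) [eval M (grid_val A J a (b Y) i) t]"
          using i by (simp add: pat_def)
      qed auto
      then show "i \<in> Y" using ab[OF X i] ab[OF Y i] \<open>i \<in> X\<close> by simp
    qed
    have inj: "inj_on prof (Pow ?I)"
    proof (rule inj_onI)
      fix X Y
      assume "X \<in> Pow ?I" "Y \<in> Pow ?I" "prof X = prof Y"
      then show "X = Y" using sub[of X Y] sub[of Y X] by auto
    qed
    have "prof X \<in> Pi\<^sub>E ?T pats" for X
    proof (rule PiE_I)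
      fix x
      assume "x \<in> ?T"
      then show "prof X x \<in> pats x"
        using b[of X] by (cases x) (simp add: prof_def pats_def)
    qed (simp add: prof_def)
    then have "prof ` Pow ?I \<subseteq> Pi\<^sub>E ?T pats" by auto
    moreover have "finite (Pi\<^sub>E ?T pats)" by (rule finite_PiE[OF finT fin_pats])
    ultimately have "card (prof ` Pow ?I) \<le> card (Pi\<^sub>E ?T pats)" by (intro card_mono)
    also have "\<dots> = (\<Prod>x\<in>?T. card (pats x))" by (rule card_PiE[OF finT])
    also have "\<dots> \<le> (\<Prod>x\<in>?T. ?B)" by (rule prod_mono) (use card_pats in simp)
    also have "\<dots> = 2 ^ (card ?T * ((q * c + 1)\<^sup>2 * c * (2 ^ q) ^ (c - 1)))"
      by (simp only: prod_constant power_mult[symmetric] mult.commute)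
    also have "\<dots> < 2 ^ ((2 ^ q) ^ c)" using q by (rule power_strict_increasing) simp
    also have "\<dots> = card (Pow ?I)" by (simp only: card_Pow finite_grid card_grid)
    also have "\<dots> = card (prof ` Pow ?I)" by (rule card_image[OF inj, symmetric])
    finally show False by simp
  qed
  then show ?thesis by blast
qed

end

section \<open>A Lie algebra encoding subsets of a grid\<close>

lemma (in abelian_monoid) finsum_swap:
  assumes "finite A" "finite B" and f: "\<And>x y. x \<in> A \<Longrightarrow> y \<in> B \<Longrightarrow> f x y \<in> carrier G"
  shows "(\<Oplus>x\<in>A. \<Oplus>y\<in>B. f x y) = (\<Oplus>y\<in>B. \<Oplus>x\<in>A. f x y)"
  using assms(1) f
proof (induction A rule: finite_induct)
  case empty
  then show ?case by simp
next
  case (insert x A)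
  have in_B: "f x \<in> B \<rightarrow> carrier G" and "(\<lambda>y. \<Oplus>x\<in>A. f x y) \<in> B \<rightarrow> carrier G"
    using insert.prems by auto
  then have "(\<Oplus>y\<in>B. f x y \<oplus> (\<Oplus>x\<in>A. f x y)) = (\<Oplus>y\<in>B. f x y) \<oplus> (\<Oplus>y\<in>B. \<Oplus>x\<in>A. f x y)"
    by (rule finsum_addf)
  moreover have "(\<Oplus>x'\<in>insert x A. f x' y) = f x y \<oplus> (\<Oplus>x\<in>A. f x y)" if "y \<in> B" for y
    by (rule finsum_insert) (use insert.hyps insert.prems that in auto)
  then have "(\<Oplus>y\<in>B. \<Oplus>x'\<in>insert x A. f x' y) = (\<Oplus>y\<in>B. f x y \<oplus> (\<Oplus>x\<in>A. f x y))"
    by (intro finsum_cong') (use insert.prems in auto)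
  moreover have "(\<Oplus>x'\<in>insert x A. \<Oplus>y\<in>B. f x' y) = (\<Oplus>y\<in>B. f x y) \<oplus> (\<Oplus>x\<in>A. \<Oplus>y\<in>B. f x y)"
    by (rule finsum_insert) (use insert.hyps insert.prems in auto)
  moreover have "(\<Oplus>x\<in>A. \<Oplus>y\<in>B. f x y) = (\<Oplus>y\<in>B. \<Oplus>x\<in>A. f x y)"
    by (rule insert.IH) (use insert.prems in auto)
  ultimately show ?case by simp
qed

text \<open>The semidirect product of an abelian Lie algebra with basis \<open>cells\<close> and a module on which it
  acts by commuting operators: an element \<open>(a, f)\<close> consists of the coordinates \<open>a\<close> and a function
  \<open>f\<close> on sets of fewer than \<open>c\<close> cells, and the basis vector \<open>e\<close> acts by \<open>shift e\<close>. The basis vectors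
  have degree 1, and functions supported on sets of \<open>m\<close> cells have degree \<open>c - m\<close>.\<close>

locale grid_algebra = field F for F :: "('k, 'm) ring_scheme" (structure) +
  fixes c n :: nat
  assumes c: "1 \<le> c" and finite_F: "finite (carrier F)"
begin

text \<open>Cell \<open>(j, m)\<close> stands for parameter number \<open>m\<close> of coordinate
  \<open>j\<close>, in a grid with \<open>c - 1\<close> coordinates.\<close>

definition cells :: "(nat \<times> nat) set" where
  "cells = {..<c - 1} \<times> {..<n}"

definition coords :: "(nat \<times> nat \<Rightarrow> 'k) set" where
  "coords = {a. \<forall>e. (e \<in> cells \<longrightarrow> a e \<in> carrier F) \<and> (e \<notin> cells \<longrightarrow> a e = \<zero>)}"

text \<open>The bound keeps the degree \<open>c - card t\<close> at least \<open>1\<close> and still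
  admits the sets of \<open>c - 1\<close> cells that represent grid points.\<close>

definition small :: "(nat \<times> nat) set \<Rightarrow> bool" where
  "small t \<longleftrightarrow> t \<subseteq> cells \<and> card t < c"

definition funs :: "((nat \<times> nat) set \<Rightarrow> 'k) set" where
  "funs = {f. \<forall>t. (t \<in> Collect small \<longrightarrow> f t \<in> carrier F) \<and>
     (t \<notin> Collect small \<longrightarrow> f t = \<zero>)}"

text \<open>A function on sets of cells is a functional on square-free monomials, and
  \<open>shift e\<close> is the transpose of multiplication by the variable \<open>e\<close>; the
  case \<open>e \<in> t\<close> reflects that squares are zero.\<close>

definition shift :: "nat \<times> nat \<Rightarrow> ((nat \<times> nat) set \<Rightarrow> 'k) \<Rightarrow> (nat \<times> nat) set \<Rightarrow> 'k" where
  "shift e f t = (if e \<in> t then \<zero> else f (insert e t))"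

definition act :: "(nat \<times> nat \<Rightarrow> 'k) \<Rightarrow> ((nat \<times> nat) set \<Rightarrow> 'k) \<Rightarrow> (nat \<times> nat) set \<Rightarrow> 'k" where
  "act a f t = (\<Oplus>e\<in>cells. a e \<otimes> shift e f t)"

text \<open>The bracket is that of a semidirect product with abelian acting part,
  \<open>[(a, f), (b, g)] = (0, a g - b f)\<close>. The condition on \<open>f\<close> in
  \<open>P i\<close> is that its nonzero values sit in degree at least \<open>i\<close>, written
  without subtraction.\<close>

definition alg :: "('k lla_fun, lla_rel, (nat \<times> nat \<Rightarrow> 'k) \<times> ((nat \<times> nat) set \<Rightarrow> 'k)) interp" where
  "alg = \<lparr>univ = coords \<times> funs,
     fn = (\<lambda>g xs. case g of
         Plus \<Rightarrow> (\<lambda>e. fst (xs ! 0) e \<oplus> fst (xs ! 1) e, \<lambda>t. snd (xs ! 0) t \<oplus> snd (xs ! 1) t)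
       | Minus \<Rightarrow> (\<lambda>e. \<ominus> fst (xs ! 0) e, \<lambda>t. \<ominus> snd (xs ! 0) t)
       | Zero \<Rightarrow> (\<lambda>_. \<zero>, \<lambda>_. \<zero>)
       | Scale x \<Rightarrow> (\<lambda>e. x \<otimes> fst (xs ! 0) e, \<lambda>t. x \<otimes> snd (xs ! 0) t)
       | Bracket \<Rightarrow> (\<lambda>_. \<zero>,
           \<lambda>t. act (fst (xs ! 0)) (snd (xs ! 1)) t \<ominus> act (fst (xs ! 1)) (snd (xs ! 0)) t)),
     rel = (\<lambda>r xs. case r of P i \<Rightarrow>
       (i \<le> 1 \<or> (\<forall>e. fst (xs ! 0) e = \<zero>)) \<and> (\<forall>t. c < card t + i \<longrightarrow> snd (xs ! 0) t = \<zero>))\<rparr>"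

lemma univ_alg [simp]: "univ alg = coords \<times> funs"
  by (simp add: alg_def)

lemma fn_alg [simp]:
  "fn alg Plus [(a, f), (b, g)] = (\<lambda>e. a e \<oplus> b e, \<lambda>t. f t \<oplus> g t)"
  "fn alg Minus [(a, f)] = (\<lambda>e. \<ominus> a e, \<lambda>t. \<ominus> f t)"
  "fn alg Zero [] = (\<lambda>_. \<zero>, \<lambda>_. \<zero>)"
  "fn alg (Scale x) [(a, f)] = (\<lambda>e. x \<otimes> a e, \<lambda>t. x \<otimes> f t)"
  "fn alg Bracket [(a, f), (b, g)] = (\<lambda>_. \<zero>, \<lambda>t. act a g t \<ominus> act b f t)"
  by (simp_all add: alg_def)

lemma rel_alg [simp]:
  "rel alg (P i) [(a, f)] \<longleftrightarrow> (i \<le> 1 \<or> (\<forall>e. a e = \<zero>)) \<and> (\<forall>t. c < card t + i \<longrightarrow> f t = \<zero>)"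
  by (simp add: alg_def)

lemma finite_cells [simp]: "finite cells"
  by (simp add: cells_def)

lemma finite_alg: "finite (univ alg)"
proof -
  have "finite (Collect small)" 
    by (rule finite_subset[of _ "Pow cells"]) (auto simp: small_def)
  then have "finite funs" unfolding funs_def by (rule finite_set_of_finite_funs[OF _ finite_F])
  moreover have "finite coords"
    unfolding coords_def by (rule finite_set_of_finite_funs[OF finite_cells finite_F])
  ultimately show ?thesis by simp
qed

lemma coords_in: "a \<in> coords \<Longrightarrow> a e \<in> carrier F"
  by (cases "e \<in> cells") (simp_all add: coords_def del: split_paired_All)

lemma funs_in: "f \<in> funs \<Longrightarrow> f t \<in> carrier F"
  by (cases "small t") (simp_all add: funs_def)

lemma coords_zero: "a \<in> coords \<Longrightarrow> e \<notin> cells \<Longrightarrow> a e = \<zero>"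
  by (simp add: coords_def del: split_paired_All)

lemma funs_zero: "f \<in> funs \<Longrightarrow> \<not> small t \<Longrightarrow> f t = \<zero>"
  by (simp add: funs_def)

lemma coordsI: "(\<And>e. a e \<in> carrier F) \<Longrightarrow> (\<And>e. e \<notin> cells \<Longrightarrow> a e = \<zero>) \<Longrightarrow> a \<in> coords"
  by (simp add: coords_def)

lemma funsI:
  "(\<And>t. f t \<in> carrier F) \<Longrightarrow> (\<And>t. \<not> small t \<Longrightarrow> f t = \<zero>) \<Longrightarrow> f \<in> funs"
  by (simp add: funs_def)

lemma shift_in: "f \<in> funs \<Longrightarrow> shift e f t \<in> carrier F"
  by (simp add: shift_def funs_in)

lemma summand_in: "a \<in> coords \<Longrightarrow> f \<in> funs \<Longrightarrow> a e \<otimes> shift e f t \<in> carrier F"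
  by (simp add: coords_in shift_in)

lemma act_in: "a \<in> coords \<Longrightarrow> f \<in> funs \<Longrightarrow> act a f t \<in> carrier F"
  unfolding act_def by (intro finsum_closed) (simp add: summand_in)

lemma act_zero_if:
  assumes "a \<in> coords" "f \<in> funs" "\<And>e. e \<in> cells \<Longrightarrow> e \<notin> t \<Longrightarrow> f (insert e t) = \<zero> \<or> a e = \<zero>"
  shows "act a f t = \<zero>"
  unfolding act_def
proof (rule add.finprod_one_eqI)
  fix e
  assume "e \<in> cells"
  then show "a e \<otimes> shift e f t = \<zero>"
    using assms(3)[of e] coords_in[OF assms(1), of e] funs_in[OF assms(2), of "insert e t"]
    by (auto simp: shift_def)
qed

lemma act_funs: "a \<in> coords \<Longrightarrow> f \<in> funs \<Longrightarrow> act a f \<in> funs"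
proof (rule funsI)
  assume a: "a \<in> coords" and f: "f \<in> funs"
  show "act a f t \<in> carrier F" for t by (rule act_in[OF a f])
  show "act a f t = \<zero>" if t: "\<not> small t" for t
  proof (rule act_zero_if[OF a f])
    fix e
    assume e: "e \<in> cells" "e \<notin> t"
    have "\<not> small (insert e t)"
    proof
      assume *: "small (insert e t)"
      then have "finite t" using finite_subset[of t cells] by (simp add: small_def)
      then show False using * t e(2) by (simp add: small_def)
    qed
    then show "f (insert e t) = \<zero> \<or> a e = \<zero>" using funs_zero[OF f] by blast
  qed
qed

lemma act_add_left:
  assumes "a \<in> coords" "b \<in> coords" "f \<in> funs"
  shows "act (\<lambda>e. a e \<oplus> b e) f t = act a f t \<oplus> act b f t"
proof -
  have "act (\<lambda>e. a e \<oplus> b e) f t = (\<Oplus>e\<in>cells. a e \<otimes> shift e f t \<oplus> b e \<otimes> shift e f t)"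
    unfolding act_def using assms
    by (intro finsum_cong') (simp_all add: l_distr coords_in shift_in)
  also have "\<dots> = act a f t \<oplus> act b f t"
    unfolding act_def using assms by (intro finsum_addf) (simp_all add: summand_in)
  finally show ?thesis .
qed

lemma act_add_right:
  assumes "a \<in> coords" "f \<in> funs" "g \<in> funs"
  shows "act a (\<lambda>t. f t \<oplus> g t) t = act a f t \<oplus> act a g t"
proof -
  have "shift e (\<lambda>t. f t \<oplus> g t) t = shift e f t \<oplus> shift e g t" for e
    by (simp add: shift_def)
  then have "act a (\<lambda>t. f t \<oplus> g t) t = (\<Oplus>e\<in>cells. a e \<otimes> shift e f t \<oplus> a e \<otimes> shift e g t)"
    unfolding act_def using assms
    by (intro finsum_cong') (simp_all add: r_distr coords_in shift_in)
  also have "\<dots> = act a f t \<oplus> act a g t"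
    unfolding act_def using assms by (intro finsum_addf) (simp_all add: summand_in)
  finally show ?thesis .
qed

lemma act_smult_left:
  assumes "a \<in> coords" "x \<in> carrier F" "f \<in> funs"
  shows "act (\<lambda>e. x \<otimes> a e) f t = x \<otimes> act a f t"
proof -
  have "act (\<lambda>e. x \<otimes> a e) f t = (\<Oplus>e\<in>cells. x \<otimes> (a e \<otimes> shift e f t))"
    unfolding act_def using assms
    by (intro finsum_cong') (simp_all add: m_assoc coords_in shift_in)
  then show ?thesis
    unfolding act_def using assms by (simp add: finsum_rdistr summand_in)
qed

lemma act_smult_right:
  assumes "a \<in> coords" "x \<in> carrier F" "f \<in> funs"
  shows "act a (\<lambda>t. x \<otimes> f t) t = x \<otimes> act a f t"
proof -
  have "shift e (\<lambda>t. x \<otimes> f t) t = x \<otimes> shift e f t" for e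
    using assms(2) by (simp add: shift_def)
  then have "act a (\<lambda>t. x \<otimes> f t) t = (\<Oplus>e\<in>cells. x \<otimes> (a e \<otimes> shift e f t))"
    unfolding act_def using assms
    by (intro finsum_cong') (simp_all add: m_lcomm coords_in shift_in)
  then show ?thesis
    unfolding act_def using assms by (simp add: finsum_rdistr summand_in)
qed

lemma act_zero [simp]:
  "f \<in> funs \<Longrightarrow> act (\<lambda>_. \<zero>) f t = \<zero>"
  "a \<in> coords \<Longrightarrow> act a (\<lambda>_. \<zero>) t = \<zero>"
  by (rule act_zero_if; auto intro: coordsI funsI)+

text \<open>Both orders of two shifts read \<open>f\<close> at \<open>t\<close> with both cells
  added, and both vanish if the cells coincide or one lies in \<open>t\<close>; it remains to
  interchange the double sum over cells.\<close>

lemma act_commute: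
  assumes a: "a \<in> coords" and b: "b \<in> coords" and f: "f \<in> funs"
  shows "act a (act b f) t = act b (act a f) t"
proof -
  have shift2: "shift e (shift e' f) t = shift e' (shift e f) t" for e e'
    by (auto simp: shift_def insert_commute)
  have shift2_in: "shift e (shift e' f) t \<in> carrier F" for e e'
    using f by (simp add: shift_def funs_in)
  have expand: "act a (act b f) t = (\<Oplus>e\<in>cells. \<Oplus>e'\<in>cells. a e \<otimes> (b e' \<otimes> shift e (shift e' f) t))"
    if a: "a \<in> coords" and b: "b \<in> coords" for a b
  proof -
    have "shift e (act b f) t = (\<Oplus>e'\<in>cells. b e' \<otimes> shift e (shift e' f) t)" for e
    proof (cases "e \<in> t")
      case True
      then have "(\<Oplus>e'\<in>cells. b e' \<otimes> shift e (shift e' f) t) = \<zero>"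
        by (intro add.finprod_one_eqI) (simp add: shift_def coords_in[OF b])
      then show ?thesis using True by (simp add: shift_def[of e "act b f"])
    next
      case False
      then show ?thesis by (simp add: shift_def[of e] act_def)
    qed
    then show ?thesis
      unfolding act_def[of a]
      using a b by (intro finsum_cong') (simp_all add: finsum_rdistr coords_in shift2_in)
  qed
  have "act a (act b f) t = (\<Oplus>e'\<in>cells. \<Oplus>e\<in>cells. a e \<otimes> (b e' \<otimes> shift e (shift e' f) t))"
    unfolding expand[OF a b] using a b
    by (intro finsum_swap) (simp_all add: coords_in shift2_in)
  also have "\<dots> = act b (act a f) t"
    unfolding expand[OF b a] using a b
    by (intro finsum_cong') (simp_all add: coords_in shift2_in m_lcomm shift2)
  finally show ?thesis .
qed

lemma act_minus_right:
  assumes "a \<in> coords" "f \<in> funs" "g \<in> funs"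
  shows "act a (\<lambda>t. f t \<ominus> g t) t = act a f t \<ominus> act a g t"
proof -
  have 1: "(\<lambda>t. f t \<ominus> g t) = (\<lambda>t. f t \<oplus> (\<ominus> \<one>) \<otimes> g t)"
    using assms by (auto simp: minus_eq l_minus funs_in)
  have "(\<lambda>t. (\<ominus> \<one>) \<otimes> g t) \<in> funs"
    using assms(3) by (intro funsI) (simp_all add: funs_in funs_zero)
  then show ?thesis
    unfolding 1 using assms
    by (simp add: act_add_right act_smult_right act_in l_minus minus_eq)
qed

lemma bracket_funs:
  "a \<in> coords \<Longrightarrow> b \<in> coords \<Longrightarrow> f \<in> funs \<Longrightarrow> g \<in> funs \<Longrightarrow> (\<lambda>t. act a g t \<ominus> act b f t) \<in> funs"
  using act_funs[of a g] act_funs[of b f]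
  by (intro funsI) (simp_all add: minus_eq act_in funs_zero)

lemma is_structure_alg: "is_structure (lla_lang F c) alg"
  unfolding is_structure_def
proof (intro conjI allI impI)
  have zero: "(\<lambda>_. \<zero>) \<in> coords" "(\<lambda>_. \<zero>) \<in> funs" by (auto intro: coordsI funsI)
  then show "univ alg \<noteq> {}" by auto
  fix g m xs
  assume *: "fun_arity (lla_lang F c) g = Some m \<and> length xs = m \<and> set xs \<subseteq> univ alg"
  show "fn alg g xs \<in> univ alg"
  proof (cases g)
    case Plus
    then have "length xs = 2" using * by simp
    then obtain a f b h where xs: "xs = [(a, f), (b, h)]"
      by (auto simp: numeral_2_eq_2 length_Suc_conv)
    then have "a \<in> coords" "b \<in> coords" "f \<in> funs" "h \<in> funs" using * by auto
    then show ?thesis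
      using Plus xs by (auto intro!: coordsI funsI simp: coords_in funs_in coords_zero funs_zero)
  next
    case Minus
    then have "length xs = 1" using * by simp
    then obtain a f where xs: "xs = [(a, f)]" by (auto simp: length_Suc_conv)
    then have "a \<in> coords" "f \<in> funs" using * by auto
    then show ?thesis
      using Minus xs by (auto intro!: coordsI funsI simp: coords_in funs_in coords_zero funs_zero)
  next
    case Zero
    then have "xs = []" using * by auto
    then show ?thesis using Zero zero by simp
  next
    case (Scale x)
    then have "length xs = 1" and x: "x \<in> carrier F" using * by (auto split: if_splits)
    then obtain a f where xs: "xs = [(a, f)]" by (auto simp: length_Suc_conv)
    then have "a \<in> coords" "f \<in> funs" using * by auto
    then show ?thesis
      using Scale x xs by (auto intro!: coordsI funsI simp: coords_in funs_in coords_zero funs_zero)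
  next
    case Bracket
    then have "length xs = 2" using * by simp
    then obtain a f b h where xs: "xs = [(a, f), (b, h)]"
      by (auto simp: numeral_2_eq_2 length_Suc_conv)
    then have "a \<in> coords" "b \<in> coords" "f \<in> funs" "h \<in> funs" using * by auto
    then show ?thesis using Bracket xs zero bracket_funs by simp
  qed
qed

text \<open>Acting reads \<open>f\<close> at sets with one more cell, so it raises the degree by
  one.\<close>

lemma act_high_zero:
  assumes "a \<in> coords" "f \<in> funs" "\<And>t. c < card t + i \<Longrightarrow> f t = \<zero>" "c < card t + (i + 1)"
  shows "act a f t = \<zero>"
proof (cases "finite t")
  case True
  show ?thesis
    by (rule act_zero_if[OF assms(1,2)]) (use assms(3,4) True in auto)
next
  case False
  \<comment> \<open>An infinite set has cardinality \<open>0\<close>, so counting one more cell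
    fails for it; members of \<open>funs\<close> vanish there because the set is not
    \<open>small\<close>.\<close>
  have "\<not> small t" using False finite_subset[of t cells] by (auto simp: small_def)
  then show ?thesis using funs_zero[OF act_funs[OF assms(1,2)]] by simp
qed

lemma is_lla_alg: "is_lla F c alg"
proof (rule pointwise_lla.is_lla, rule pointwise_lla.intro[OF field_axioms is_structure_alg])
  fix x y i j X Y Z
  assume xy: "x \<in> carrier F" "y \<in> carrier F" and i: "i \<in> {1..c + 1}" and j: "j \<in> {1..c + 1}"
    and XYZ: "X \<in> univ alg" "Y \<in> univ alg" "Z \<in> univ alg"
  obtain a1 f1 a2 f2 a3 f3 where eqs: "X = (a1, f1)" "Y = (a2, f2)" "Z = (a3, f3)"
    by (cases X, cases Y, cases Z) simp
  have a: "a1 \<in> coords" "a2 \<in> coords" "a3 \<in> coords" and f: "f1 \<in> funs" "f2 \<in> funs" "f3 \<in> funs"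
    using XYZ eqs by auto
  note ins = coords_in[OF a(1)] coords_in[OF a(2)] coords_in[OF a(3)]
    funs_in[OF f(1)] funs_in[OF f(2)] funs_in[OF f(3)]
  have add_coords: "(\<lambda>e. a1 e \<oplus> a2 e) \<in> coords" "(\<lambda>e. x \<otimes> a1 e) \<in> coords"
    using xy a by (auto intro!: coordsI simp: coords_in coords_zero)
  have add_funs: "(\<lambda>t. f1 t \<oplus> f2 t) \<in> funs"
    using f by (auto intro!: funsI simp: funs_in funs_zero)
  show "lla_at F c alg x y i j X Y Z"
    unfolding lla_at_def alg_of_simps eqs
  proof (intro conjI impI)
    show "fn alg Plus [fn alg Minus [(a1, f1)], (a1, f1)] = fn alg Zero []"
      using a f by (simp add: coords_in funs_in l_neg)
    show "fn alg Bracket [fn alg Plus [(a1, f1), (a2, f2)], (a3, f3)] =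
        fn alg Plus [fn alg Bracket [(a1, f1), (a3, f3)], fn alg Bracket [(a2, f2), (a3, f3)]]"
      using a f by (simp add: act_add_left act_add_right act_in minus_eq minus_add a_ac)
    show "fn alg Bracket [(a1, f1), fn alg Plus [(a2, f2), (a3, f3)]] =
        fn alg Plus [fn alg Bracket [(a1, f1), (a2, f2)], fn alg Bracket [(a1, f1), (a3, f3)]]"
      using a f by (simp add: act_add_left act_add_right act_in minus_eq minus_add a_ac)
    show "fn alg Bracket [fn alg (Scale x) [(a1, f1)], (a2, f2)] =
        fn alg (Scale x) [fn alg Bracket [(a1, f1), (a2, f2)]]"
      using a f xy by (simp add: act_smult_left act_smult_right act_in minus_eq r_distr r_minus)
    show "fn alg Bracket [(a1, f1), fn alg (Scale x) [(a2, f2)]] =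
        fn alg (Scale x) [fn alg Bracket [(a1, f1), (a2, f2)]]"
      using a f xy by (simp add: act_smult_left act_smult_right act_in minus_eq r_distr r_minus)
    show "fn alg Bracket [(a1, f1), (a1, f1)] = fn alg Zero []"
      using a f by (simp add: act_in minus_eq r_neg)
    have comm: "act a3 (act a2 f1) t = act a2 (act a3 f1) t" "act a3 (act a1 f2) t = act a1 (act a3 f2) t"
      "act a2 (act a1 f3) t = act a1 (act a2 f3) t" for t
      using a f by (simp_all add: act_commute)
    show "fn alg Plus [fn alg Plus [fn alg Bracket [(a1, f1), fn alg Bracket [(a2, f2), (a3, f3)]],
        fn alg Bracket [(a2, f2), fn alg Bracket [(a3, f3), (a1, f1)]]],
        fn alg Bracket [(a3, f3), fn alg Bracket [(a1, f1), (a2, f2)]]] = fn alg Zero []"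
    \<comment> \<open>Inner brackets have zero coordinates, so only double actions survive; as
      actions commute, the cyclic sum has the form
      \<open>(u - v) + (w - u) + (v - w)\<close>.\<close>
    proof -
      have "(u \<ominus> v) \<oplus> (w \<ominus> u) \<oplus> (v \<ominus> w) = \<zero>"
        if "u \<in> carrier F" "v \<in> carrier F" "w \<in> carrier F" for u v w
        using that by algebra
      moreover have "u \<ominus> \<zero> = u" if "u \<in> carrier F" for u
        using that by (simp add: minus_eq)
      ultimately show ?thesis
        using a f by (simp add: act_minus_right act_funs act_in comm)
    qed
    show "rel alg (P (c + 1)) [(a1, f1)] \<longleftrightarrow> (a1, f1) = fn alg Zero []"
      using c by (auto simp: fun_eq_iff)
    show "rel alg (P 1) [(a1, f1)]"
      using funs_zero[OF f(1)] by (simp add: small_def)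
    show "rel alg (P (i + j)) [fn alg Bracket [(a1, f1), (a2, f2)]]"
      if P: "rel alg (P i) [(a1, f1)]" "rel alg (P j) [(a2, f2)]"
    proof -
      have "act a1 f2 t = \<zero>" if t: "c < card t + (i + j)" for t
      \<comment> \<open>For \<open>i = 1\<close> the action of \<open>a1\<close> raises the degree
        of \<open>f2\<close> by one; for larger \<open>i\<close> the coordinates \<open>a1\<close>
        are zero and nothing acts.\<close>
      proof (cases "i \<le> 1")
        case True
        then have "i = 1" using i by simp
        then show ?thesis using act_high_zero[OF a(1) f(2), of j t] P(2) t by (simp add: add.commute)
      next
        case False
        then have "a1 = (\<lambda>_. \<zero>)" using P(1) by auto
        then show ?thesis using f by simp
      qed
      moreover have "act a2 f1 t = \<zero>" if t: "c < card t + (i + j)" for t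
      proof (cases "j \<le> 1")
        case True
        then have "j = 1" using j by simp
        then show ?thesis using act_high_zero[OF a(2) f(1), of i t] P(1) t by simp
      next
        case False
        then have "a2 = (\<lambda>_. \<zero>)" using P(2) by auto
        then show ?thesis using f by simp
      qed
      ultimately show ?thesis by (simp add: minus_eq)
    qed
    \<comment> \<open>Beyond \<open>c + 1\<close> the condition for \<open>P (i + j)\<close> covers
      all sets \<open>t\<close>, even the empty one, and so forces the bracket to be zero.\<close>
    then show "fn alg Bracket [(a1, f1), (a2, f2)] = fn alg Zero []"
      if "\<not> i + j \<le> c + 1" "rel alg (P i) [(a1, f1)]" "rel alg (P j) [(a2, f2)]"
      using that by (auto simp: fun_eq_iff)
  qed (use ins xy in \<open>auto simp: a_ac l_distr r_distr m_assoc\<close>)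
qed

end

section \<open>Iterated brackets and the sets of grid points that they recognise\<close>

primrec bracket_tm :: "nat \<Rightarrow> 'k lla_fun tm" where
  "bracket_tm 0 = Var 0"
| "bracket_tm (Suc m) = App Bracket [Var (Suc m), bracket_tm m]"

lemma wf_bracket_tm: "wf_tm (lla_lang F c) (bracket_tm m)"
  by (induction m) auto

lemma fv_bracket_tm: "fv_tm (bracket_tm m) = {..m}"
  by (induction m) auto

lemma grid_nth: "i \<in> grid k n \<Longrightarrow> j < k \<Longrightarrow> i ! j < n"
proof -
  assume i: "i \<in> grid k n" and "j < k"
  then have "i ! j \<in> set i" by (intro nth_mem) (simp add: grid_def)
  then show "i ! j < n" using i by (auto simp: grid_def)
qed

context grid_algebra
begin

text \<open>Parameters will be indexed by all natural numbers; those outside the grid become zero,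
  which keeps them in the finite algebra.\<close>

definition cell_vec :: "nat \<times> nat \<Rightarrow> (nat \<times> nat \<Rightarrow> 'k) \<times> ((nat \<times> nat) set \<Rightarrow> 'k)" where
  "cell_vec e = (\<lambda>e'. if e' = e \<and> e \<in> cells then \<one> else \<zero>, \<lambda>_. \<zero>)"

definition graph :: "nat \<Rightarrow> nat list \<Rightarrow> (nat \<times> nat) set" where
  "graph m i = (\<lambda>j. (j, i ! j)) ` {..<m}"

text \<open>The indicator of the grid points outside \<open>X\<close>, each represented by its
  graph. The complement appears because the formula asserts that a bracket vanishes.\<close>

definition set_vec :: "nat list set \<Rightarrow> (nat \<times> nat \<Rightarrow> 'k) \<times> ((nat \<times> nat) set \<Rightarrow> 'k)" where
  "set_vec X = (\<lambda>_. \<zero>, \<lambda>t. if t \<in> graph (c - 1) ` (grid (c - 1) n - X) then \<one> else \<zero>)"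

lemma cell_vec_in: "cell_vec e \<in> univ alg"
  by (auto simp: cell_vec_def intro!: coordsI funsI)

lemma small_graph:
  assumes "i \<in> grid (c - 1) n"
  shows "small (graph (c - 1) i)"
proof -
  have "i ! j < n" if "j < c - 1" for j
    using grid_nth[OF assms that] .
  moreover have "card (graph (c - 1) i) \<le> c - 1"
    unfolding graph_def by (metis card_image_le card_lessThan finite_lessThan)
  ultimately show ?thesis using c by (auto simp: small_def graph_def cells_def)
qed

lemma set_vec_in: "set_vec X \<in> univ alg"
  using small_graph by (auto simp: set_vec_def intro!: coordsI funsI)

lemma act_cell_vec:
  assumes e: "e \<in> cells" and f: "f \<in> funs"
  shows "act (\<lambda>e'. if e' = e \<and> e \<in> cells then \<one> else \<zero>) f t = shift e f t"
proof -
  have "act (\<lambda>e'. if e' = e \<and> e \<in> cells then \<one> else \<zero>) f t = (\<Oplus>e'\<in>cells. if e = e' then shift e' f t else \<zero>)"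
    unfolding act_def using e f by (intro finsum_cong') (auto simp: shift_in)
  also have "\<dots> = shift e f t"
    using e f by (intro finsum_singleton) (auto simp: shift_in)
  finally show ?thesis .
qed

text \<open>Each bracket with a cell vector is one shift, and the cells used are distinct since
  their first components are; so the shifts combine to reading \<open>f\<close> at the union with
  \<open>graph m i\<close>.\<close>

lemma eval_bracket_tm:
  assumes i: "i \<in> grid (c - 1) n" and v: "range v \<subseteq> univ alg" and v0: "v 0 = (\<lambda>_. \<zero>, f)"
    and vS: "\<And>j. j < c - 1 \<Longrightarrow> v (Suc j) = cell_vec (j, i ! j)"
  shows "m \<le> c - 1 \<Longrightarrow> eval alg v (bracket_tm m) =
    (\<lambda>_. \<zero>, \<lambda>t. if t \<inter> graph m i = {} then f (graph m i \<union> t) else \<zero>)"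
proof (induction m)
  case 0
  then show ?case by (simp add: v0 graph_def)
next
  case (Suc m)
  let ?g = "\<lambda>t. if t \<inter> graph m i = {} then f (graph m i \<union> t) else \<zero>"
  let ?e = "(m, i ! m)"
  have IH: "eval alg v (bracket_tm m) = (\<lambda>_. \<zero>, ?g)" using Suc by simp
  have "eval alg v (bracket_tm m) \<in> univ alg"
    using v by (intro eval_closed[OF is_structure_alg wf_bracket_tm]) auto
  then have g: "?g \<in> funs" unfolding IH by simp
  have zero: "(\<lambda>_. \<zero>) \<in> funs" by (simp add: funsI)
  have m: "m < c - 1" using Suc.prems by simp
  have "i ! m < n" by (rule grid_nth[OF i m])
  then have e: "?e \<in> cells" using m by (simp add: cells_def)
  have graph_Suc: "graph (Suc m) i = insert ?e (graph m i)"
    by (auto simp: graph_def lessThan_Suc)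
  have e_notin: "?e \<notin> graph m i" by (auto simp: graph_def)
  have "act (\<lambda>e'. if e' = ?e \<and> ?e \<in> cells then \<one> else \<zero>) ?g t \<ominus> act (\<lambda>_. \<zero>) (\<lambda>_. \<zero>) t = shift ?e ?g t" for t
    using act_cell_vec[OF e g, of t] act_zero(1)[OF zero, of t] shift_in[OF g] by (simp add: minus_eq)
  moreover have "shift ?e ?g t = (if t \<inter> graph (Suc m) i = {} then f (graph (Suc m) i \<union> t) else \<zero>)" for t
    using e_notin by (auto simp: shift_def graph_Suc)
  ultimately show ?case
    by (simp add: vS[OF m] cell_vec_def IH)
qed

lemma graph_inj:
  assumes "i \<in> grid (c - 1) n" "i' \<in> grid (c - 1) n" "graph (c - 1) i \<subseteq> graph (c - 1) i'"
  shows "i = i'"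
proof (rule nth_equalityI)
  show "length i = length i'" using assms by (simp add: grid_def)
  fix j
  assume "j < length i"
  then have "(j, i ! j) \<in> graph (c - 1) i" using assms(1) by (auto simp: graph_def grid_def)
  then have "(j, i ! j) \<in> graph (c - 1) i'" using assms(3) by blast
  then show "i ! j = i' ! j" by (auto simp: graph_def)
qed

text \<open>At the empty set the bracket returns the indicator at the graph of \<open>i\<close>.
  Elsewhere the union with that graph can be the graph of a grid point only if that point is
  \<open>i\<close>, as an inclusion between two graphs determines the point.\<close>

lemma bracket_zero_iff:
  assumes i: "i \<in> grid (c - 1) n" and v: "range v \<subseteq> univ alg" and v0: "v 0 = set_vec X"
    and vS: "\<And>j. j < c - 1 \<Longrightarrow> v (Suc j) = cell_vec (j, i ! j)"
  shows "eval alg v (bracket_tm (c - 1)) = fn alg Zero [] \<longleftrightarrow> i \<in> X"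
proof -
  let ?G = "graph (c - 1) i"
  let ?f = "\<lambda>t. if t \<in> graph (c - 1) ` (grid (c - 1) n - X) then \<one> else \<zero>"
  have ev: "eval alg v (bracket_tm (c - 1)) =
      (\<lambda>_. \<zero>, \<lambda>t. if t \<inter> ?G = {} then ?f (?G \<union> t) else \<zero>)"
    by (rule eval_bracket_tm[OF i v _ vS]) (simp_all add: v0 set_vec_def)
  show ?thesis
  proof
    assume "eval alg v (bracket_tm (c - 1)) = fn alg Zero []"
    then have "(\<lambda>t. if t \<inter> ?G = {} then ?f (?G \<union> t) else \<zero>) = (\<lambda>_. \<zero>)"
      unfolding ev by simp
    from fun_cong[OF this, of "{}"] have "?f ?G = \<zero>" by simp
    then show "i \<in> X" using i one_not_zero by (auto split: if_splits)
  next
    assume X: "i \<in> X"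
    have "?G \<union> t \<notin> graph (c - 1) ` (grid (c - 1) n - X)" for t
    proof
      assume "?G \<union> t \<in> graph (c - 1) ` (grid (c - 1) n - X)"
      then obtain i' where "i' \<in> grid (c - 1) n - X" "?G \<union> t = graph (c - 1) i'" by auto
      then show False using graph_inj[OF i, of i'] X by blast
    qed
    then show "eval alg v (bracket_tm (c - 1)) = fn alg Zero []" unfolding ev by auto
  qed
qed

end

section \<open>The independence property\<close>

text \<open>Variable \<open>0\<close> is \<open>x\<close> and variable \<open>Suc j\<close> is the
  parameter of coordinate \<open>j\<close>. For \<open>m = 0\<close>, the case \<open>c = 1\<close>,
  the formula says \<open>x = 0\<close> and has no parameters.\<close>

definition bracket_fm :: "nat \<Rightarrow> ('k lla_fun, lla_rel) fm" where
  "bracket_fm m = Eq (bracket_tm m) (App Zero [])"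

lemma wf_bracket_fm: "wf_fm (lla_lang F c) (bracket_fm m)"
  by (simp add: bracket_fm_def wf_bracket_tm)

lemma fv_bracket_fm: "fv (bracket_fm m) = {..m}"
  by (simp add: bracket_fm_def fv_bracket_tm)

text \<open>The witnesses are images of cell vectors and set vectors, and an embedding preserves and
  reflects the equation. \<open>X\<close> ranges over arbitrary sets of tuples so that, for one
  infinite \<open>X\<close>, the witnesses for all \<open>n\<close> form a sequence.\<close>

lemma limit_shatters_finite_grids:
  fixes M :: "('k lla_fun, lla_rel, 'a) interp"
  assumes F: "field F" and fin: "finite (carrier F)" and c: "1 \<le> c"
    and M: "fraisse_limit (lla_lang F c) (fg_llas F c) M"
  shows "\<exists>\<alpha> \<beta>. (\<forall>j m. \<alpha> j m \<in> univ M) \<and> (\<forall>X. \<beta> X \<in> univ M) \<and>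
    (\<forall>X. \<forall>i\<in>grid (c - 1) n. \<forall>v. v 0 = \<beta> X \<longrightarrow> (\<forall>j<c - 1. v (Suc j) = \<alpha> j (i ! j)) \<longrightarrow>
      (sat M v (bracket_fm (c - 1)) \<longleftrightarrow> i \<in> X))"
proof -
  interpret field F by (rule F)
  interpret grid_algebra F c n by unfold_locales (rule c, rule fin)
  obtain h where h: "embedding (lla_lang F c) alg M h"
    using finite_lla_embeds_in_limit[OF F M is_lla_alg finite_alg] by blast
  have h_in: "h x \<in> univ M" if "x \<in> univ alg" for x
    using h that by (auto simp: embedding_def)
  have h_zero: "h (fn alg Zero []) = fn M Zero []"
    using embedding_fn[OF h, of Zero "[]"] by simp
  have "sat M v (bracket_fm (c - 1)) \<longleftrightarrow> i \<in> X"
    if i: "i \<in> grid (c - 1) n" and v0: "v 0 = h (set_vec X)"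
      and vS: "\<forall>j<c - 1. v (Suc j) = h (cell_vec (j, i ! j))" for X i v
  proof -
    \<comment> \<open>Variables beyond \<open>c - 1\<close> do not occur in the bracket; they
      receive \<open>set_vec X\<close> only to stay in the universe.\<close>
    define u where "u z = (case z of 0 \<Rightarrow> set_vec X
      | Suc j \<Rightarrow> if j < c - 1 then cell_vec (j, i ! j) else set_vec X)" for z
    have u: "range u \<subseteq> univ alg"
      using set_vec_in cell_vec_in by (auto simp: u_def simp del: univ_alg split: nat.splits)
    have "eval M v (bracket_tm (c - 1)) = eval M (\<lambda>z. h (u z)) (bracket_tm (c - 1))"
      by (rule eval_cong) (use v0 vS in \<open>auto simp: fv_bracket_tm u_def split: nat.splits\<close>)
    also have "\<dots> = h (eval alg u (bracket_tm (c - 1)))"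
      by (rule embedding_eval[OF is_structure_alg h wf_bracket_tm]) (use u in blast)
    finally have ev: "eval M v (bracket_tm (c - 1)) = h (eval alg u (bracket_tm (c - 1)))" .
    have inj: "inj_on h (univ alg)" using h by (simp add: embedding_def)
    have "eval alg u (bracket_tm (c - 1)) \<in> univ alg"
      by (rule eval_closed[OF is_structure_alg wf_bracket_tm]) (use u in blast)
    moreover have "fn alg Zero [] \<in> univ alg"
      by (rule lla_closed(5)[OF is_structure_alg])
    ultimately have "h (eval alg u (bracket_tm (c - 1))) = h (fn alg Zero []) \<longleftrightarrow>
        eval alg u (bracket_tm (c - 1)) = fn alg Zero []"
      by (rule inj_on_eq_iff[OF inj])
    also have "\<dots> \<longleftrightarrow> i \<in> X"
      by (rule bracket_zero_iff[OF i u]) (simp_all add: u_def)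
    finally show ?thesis by (simp only: bracket_fm_def sat.simps eval.simps list.map ev h_zero)
  qed
  then show ?thesis
    using h_in cell_vec_in set_vec_in
    by (intro exI[of _ "\<lambda>j m. h (cell_vec (j, m))"] exI[of _ "\<lambda>X. h (set_vec X)"]) blast
qed

text \<open>Witnesses for the grids of side \<open>n\<close> are assembled into sequences indexed by
  \<open>n\<close>. A fixed tuple \<open>i\<close> belongs to the grid for all but finitely many
  \<open>n\<close>, so the classes of these sequences answer correctly for every \<open>i\<close>
  and every \<open>X\<close>.\<close>

lemma has_IP_limit:
  fixes M :: "('k lla_fun, lla_rel, 'a) interp"
  assumes F: "field F" and fin: "finite (carrier F)" and c: "1 \<le> c"
    and M: "fraisse_limit (lla_lang F c) (fg_llas F c) M"
  shows "has_IP (lla_lang F c) (theory_of (lla_lang F c) M) (c - 1) TYPE(nat set)"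
proof -
  define k where "k = c - 1"
  define good where "good n \<alpha> \<beta> \<longleftrightarrow> (\<forall>j m. \<alpha> j m \<in> univ M) \<and> (\<forall>X. \<beta> X \<in> univ M) \<and>
    (\<forall>X. \<forall>i\<in>grid k n. \<forall>v. v 0 = \<beta> X \<longrightarrow> (\<forall>j<k. v (Suc j) = \<alpha> j (i ! j)) \<longrightarrow>
      (sat M v (bracket_fm k) \<longleftrightarrow> i \<in> X))" for n \<alpha> \<beta>
  have "\<forall>n. \<exists>p. good n (fst p) (snd p)"
    using limit_shatters_finite_grids[OF F fin c M] unfolding good_def k_def by simp
  then obtain p where p: "\<And>n. good n (fst (p n)) (snd (p n))" using choice by metis
  define \<alpha> where "\<alpha> n = fst (p n)" for n
  define \<beta> where "\<beta> n = snd (p n)" for n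
  have \<alpha>: "\<alpha> n j m \<in> univ M" and \<beta>: "\<beta> n X \<in> univ M" for n j m X
    using p[of n] unfolding good_def \<alpha>_def \<beta>_def by blast+
  have \<alpha>\<beta>: "sat M v (bracket_fm k) \<longleftrightarrow> i \<in> X"
    if "i \<in> grid k n" "v 0 = \<beta> n X" "\<forall>j<k. v (Suc j) = \<alpha> n j (i ! j)" for n X i v
    using p[of n] that unfolding good_def \<alpha>_def \<beta>_def by blast
  have str: "is_structure (lla_lang F c) M" and cnt: "countable (univ M)"
    using M by (simp_all add: fraisse_limit_def)
  obtain U where U: "free_ultrafilter U" using free_ultrafilter_exists by blast
  have "univ M \<noteq> {}" using str by (simp add: is_structure_def)
  obtain dec :: "nat set \<Rightarrow> nat \<Rightarrow> 'a"
    where dec: "\<And>x n. dec x n \<in> univ M" "\<And>f. range f \<subseteq> univ M \<Longrightarrow> \<exists>x. dec x = f"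
    using sequence_coding[OF cnt \<open>univ M \<noteq> {}\<close>] by metis
  interpret ultrapower U "lla_lang F c" M dec
    by (intro ultrapower.intro U ultrapower_axioms.intro str dec)
  define ys where "ys = map (\<lambda>j. [Suc j]) [0..<k]"
  define a where "a j m = [cls (\<lambda>n. \<alpha> n j m)]" for j m
  define b where "b X = [cls (\<lambda>n. \<beta> n X)]" for X
  have \<alpha>_ran: "range (\<lambda>n. \<alpha> n j m) \<subseteq> univ M" and \<beta>_ran: "range (\<lambda>n. \<beta> n X) \<subseteq> univ M" for j m X
    using \<alpha> \<beta> by auto
  have len: "length ys = k" by (simp add: ys_def)
  have ys_nth: "ys ! j = [Suc j]" if "j < k" for j using that by (simp add: ys_def)
  have concat_ys: "concat ys = map Suc [0..<k]" by (simp add: ys_def concat_map_singleton)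
  have sat_iff: "sat N (assign ([0] @ concat ys) (b X @ concat (map (\<lambda>j. a j (i ! j)) [0..<k]))) (bracket_fm k)
      \<longleftrightarrow> i \<in> X" if i: "length i = k" for X i
  proof -
    define w where "w z = (case z of 0 \<Rightarrow> cls (\<lambda>n. \<beta> n X)
      | Suc j \<Rightarrow> if j < k then cls (\<lambda>n. \<alpha> n j (i ! j)) else cls (\<lambda>n. \<beta> n X))" for z
    have w: "range w \<subseteq> univ N"
      using cls_in[OF \<alpha>_ran] cls_in[OF \<beta>_ran] by (auto simp: w_def split: nat.splits)
    let ?as = "map (\<lambda>j. a j (i ! j)) [0..<k]"
    have "sat N (assign ([0] @ concat ys) (b X @ concat ?as)) (bracket_fm k) = sat N w (bracket_fm k)"
    proof (rule sat_cong)
      fix z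
      assume z: "z \<in> fv (bracket_fm k :: ('k lla_fun, lla_rel) fm)"
      have len_b: "length (b X) = length [0]" by (simp add: b_def)
      show "assign ([0] @ concat ys) (b X @ concat ?as) z = w z"
      proof (cases z)
        case 0
        then show ?thesis
          unfolding assign_append[OF len_b] by (simp add: w_def b_def assign_def)
      next
        case (Suc j)
        then have j: "j < k" using z by (simp add: fv_bracket_fm)
        have "assign (concat ys) (concat ?as) z = assign (ys ! j) (?as ! j) z"
          by (rule assign_concat)
            (use j Suc len concat_ys ys_nth in \<open>auto simp: list_all2_conv_all_nth a_def distinct_map\<close>)
        also have "\<dots> = w z" using j Suc by (simp add: ys_nth a_def w_def assign_def)
        finally show ?thesis unfolding assign_append[OF len_b] using Suc by simp
      qed
    qed
    also have "\<dots> \<longleftrightarrow> {n. sat M (\<lambda>z. dec (w z) n) (bracket_fm k)} \<in> U"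
      by (rule sat_N[OF wf_bracket_fm w])
    also have "\<dots> \<longleftrightarrow> {n :: nat. i \<in> X} \<in> U"
    proof (rule Collect_cong_mem)
      let ?B = "{n. dec (w 0) n = \<beta> n X}"
      let ?A = "{n. \<forall>j\<in>{..<k}. dec (w (Suc j)) n = \<alpha> n j (i ! j)}"
      let ?C = "{n. \<forall>j\<in>{..<k}. i ! j < n}"
      have "?B \<in> U" using dec_cls[OF \<beta>_ran[of X]] by (simp add: w_def)
      moreover have "?A \<in> U"
        using dec_cls[OF \<alpha>_ran] by (intro Collect_ball_mem) (simp_all add: w_def)
      \<comment> \<open>Once \<open>n\<close> exceeds all entries of \<open>i\<close>, the tuple
        lies in the grid of side \<open>n\<close>; freeness of the ultrafilter makes this cofinite
        set large.\<close>
      moreover have "?C \<in> U"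
      proof (rule Collect_ball_mem)
        fix j
        have "- {n. i ! j < n} = {..i ! j}" by auto
        then have "finite (- {n. i ! j < n})" by simp
        then show "{n. i ! j < n} \<in> U" using finite_notin compl_iff by blast
      qed simp
      ultimately have "?B \<inter> ?A \<inter> ?C \<in> U" by (intro Int_mem)
      then show "{n. n \<in> ?B \<inter> ?A \<inter> ?C} \<in> U" by (simp only: Collect_mem_eq)
      fix n
      assume n: "n \<in> ?B \<inter> ?A \<inter> ?C"
      then have "i \<in> grid k n" using i by (auto simp: grid_def in_set_conv_nth)
      then show "sat M (\<lambda>z. dec (w z) n) (bracket_fm k) \<longleftrightarrow> i \<in> X"
        by (rule \<alpha>\<beta>) (use n in auto)
    qed
    also have "\<dots> \<longleftrightarrow> i \<in> X"
      using UNIV_mem finite_notin[of "{}"] by (cases "i \<in> X") simp_all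
    finally show ?thesis .
  qed
  have "has_IP_in N (bracket_fm k) [0] ys"
    unfolding has_IP_in_def Let_def len
  proof (intro exI[of _ a] exI[of _ b] conjI allI impI ballI)
    fix j m
    assume "j < k"
    then show "length (a j m) = length (ys ! j)" by (simp add: a_def ys_nth)
    show "set (a j m) \<subseteq> univ N" using cls_in[OF \<alpha>_ran] by (simp add: a_def)
  next
    show "length (b X) = length [0]" "set (b X) \<subseteq> univ N" for X
      using cls_in[OF \<beta>_ran] by (simp_all add: b_def)
  next
    fix X i
    assume "i \<in> {is :: nat list. length is = k}"
    then show "sat N (assign ([0] @ concat ys) (b X @ concat (map (\<lambda>j. a j (i ! j)) [0..<k]))) (bracket_fm k)
        \<longleftrightarrow> i \<in> X" by (intro sat_iff) simp
  qed
  moreover have "partitioned_formula (lla_lang F c) (bracket_fm k :: ('k lla_fun, lla_rel) fm) [0] ys"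
  proof -
    have "z \<in> set ([0] @ concat ys)" if "z \<le> k" for z
      using that by (cases z) (auto simp: concat_ys)
    then show ?thesis
      unfolding partitioned_formula_def fv_bracket_fm
      by (auto simp: wf_bracket_fm concat_ys distinct_map)
  qed
  ultimately show ?thesis
    unfolding has_IP_def using is_model_N len k_def by blast
qed

text \<open>The model carrying the pattern may have any universe; only its finite grids are used,
  each described by one formula and therefore already shattered in the limit.\<close>

lemma k_dependent_limit:
  fixes M :: "('k lla_fun, lla_rel, 'a) interp"
  assumes F: "field F" and fin: "finite (carrier F)" and c: "1 \<le> c"
    and M: "fraisse_limit (lla_lang F c) (fg_llas F c) M"
  shows "k_dependent (lla_lang F c) (theory_of (lla_lang F c) M) c TYPE('u)"
  unfolding k_dependent_def
proof
  have str: "is_structure (lla_lang F c) M" and uh: "ultrahomogeneous (lla_lang F c) M"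
    using M by (simp_all add: fraisse_limit_def)
  have lla: "is_lla F c M" by (rule is_lla_limit[OF F M])
  have "lie_algebra F (alg_of M)" using lla by (simp add: is_lla_def)
  then interpret lla F c M by (intro lla.intro lla_axioms.intro lla)
  assume "has_IP (lla_lang F c) (theory_of (lla_lang F c) M) c TYPE('u)"
  then obtain \<phi> x ys and N :: "('k lla_fun, lla_rel, 'u) interp"
    where part: "partitioned_formula (lla_lang F c) \<phi> x ys" and ys: "length ys = c"
      and N: "is_model (lla_lang F c) (theory_of (lla_lang F c) M) N" and IP: "has_IP_in N \<phi> x ys"
    unfolding has_IP_def by blast
  have "is_structure (lla_lang F c) N" using N by (simp add: is_model_def)
  moreover have "0 < c" using c by simp
  ultimately obtain J where J: "\<forall>z. J z < c" "\<forall>n. shatters N \<phi> (set x) J c n"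
    using IP_shatters[OF part IP _ ys] by blast
  have wf: "wf_fm (lla_lang F c) \<phi>" using part by (simp add: partitioned_formula_def)
  have "shatters M \<phi> (set x) J c n" for n
    using J(2) by (intro shatters_transfer[OF str N wf]) simp
  moreover have "\<exists>n. \<not> shatters M \<phi> (set x) J c n"
    using J(1) by (intro not_all_shattered[OF fin c uh wf]) simp
  ultimately show False by blast
qed

theorem theorem5p18:
  fixes F :: "('k, 'm) ring_scheme"
    and c :: nat
    and M :: "('k lla_fun, lla_rel, 'a) interp"
    and T :: "('k lla_fun, lla_rel) fm set"
  assumes "field F" and "finite (carrier F)" and "c \<ge> 1"
    and "fraisse_limit (lla_lang F c) (fg_llas F c) M"
    and "T = theory_of (lla_lang F c) M"
  shows "k_dependent (lla_lang F c) T c TYPE('u) \<and>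
         has_IP (lla_lang F c) T (c - 1) TYPE(nat set)"
  using k_dependent_limit[OF assms(1-4)] has_IP_limit[OF assms(1-4)] assms(5) by simp

end
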